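(* Let $\ell$ be a positive, nondecreasing function on $(0,\infty)$ that is slowly varying at $\infty$, and put $\ell^*(n)=\sum_{j=1}^n \frac{1}{j\,\ell(j)}$. If $$\sum_{n=1}^{\infty} n^{-3/2}\sqrt{\ell(n)}\,\log(n)\,\|E(S_n\mid\mathcal{F}_0)\|<\infty,$$ then $$\lim_{n\to\infty}\frac{R_n}{\sqrt{n\,\ell^*(n)}}=0\qquad\text{with probability }1.$$
   Context: Setting: $(\Omega,\mathcal{A},P)$ is a probability space with an ergodic, measure-preserving transformation $\theta:\Omega\to\Omega$, and $(W_k)_{k\in\mathbb{Z}}$ is a stationary, ergodic Markov chain defined on it, with state space $\mathcal{W}$, transition function $Q$ and common marginal distribution $\pi$ (so $\pi(B)=P[W_n\in B]$), such that $W_k\circ\theta=W_{k+1}$ for all $k$. For $f\in L^1(\pi)$, $Qf(w)=E[f(W_{n+1})\mid W_n=w]$, and $Q^k$ denotes the iterates of $Q$. The function $g:\mathcal{W}\to\mathbb{R}$ is in $L^2(\pi)$ with $\int g\,d\pi=0$; $X_k=g(W_k)$, $S_n=X_1+\cdots+X_n$, $\mathcal{F}_k=\sigma(\ldots,W_{k-1},W_k)$, and $\|\cdot\|$ is the norm in $L^2(P)$. Definition of $R_n$: for $\varepsilon>0$ let $h_\varepsilon=\sum_{k=1}^\infty \frac{Q^{k-1}g}{(1+\varepsilon)^k}\in L^2(\pi)$ and $H_\varepsilon(w_0,w_1)=h_\varepsilon(w_1)-Qh_\varepsilon(w_0)$. Let $\pi_1$ be the joint distribution of $(W_0,W_1)$.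 It is known that if $\sum_n n^{-3/2}\|E(S_n\mid\mathcal{F}_0)\|<\infty$ (which is implied by the hypothesis of the claim), then $H:=\lim_{\varepsilon\downarrow0}H_\varepsilon$ exists in $L^2(\pi_1)$, and $M_n:=\sum_{k=1}^n H(W_{k-1},W_k)$ is a square integrable martingale with stationary ergodic increments. Set $R_n=S_n-M_n$. *)

theory Defs
  imports "HOL-Probability.Probability"
begin

section \<open>The space $L^2$\<close>

definition L2_fun :: "'a measure \<Rightarrow> ('a \<Rightarrow> real) \<Rightarrow> bool" where
  "L2_fun N f \<longleftrightarrow> f \<in> borel_measurable N \<and> integrable N (\<lambda>x. (f x)\<^sup>2)"

definition L2_norm :: "'a measure \<Rightarrow> ('a \<Rightarrow> real) \<Rightarrow> real" where
  "L2_norm N f = sqrt (\<integral>x. (f x)\<^sup>2 \<partial>N)"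

text \<open>The membership conditions matter: the Bochner integral in \<open>L2_norm\<close> is \<open>0\<close> for
  functions that are not square integrable.\<close>

definition L2_tendsto :: "'a measure \<Rightarrow> ('b \<Rightarrow> 'a \<Rightarrow> real) \<Rightarrow> ('a \<Rightarrow> real) \<Rightarrow> 'b filter \<Rightarrow> bool" where
  "L2_tendsto N f h F \<longleftrightarrow>
     L2_fun N h \<and> (\<forall>\<^sub>F e in F. L2_fun N (f e)) \<and>
     ((\<lambda>e. L2_norm N (\<lambda>x. f e x - h x)) \<longlongrightarrow> 0) F"

text \<open>A version of the $L^2$ limit; by \<open>L2_tendsto_unique\<close> below, any two versions agree
  almost everywhere.\<close>

definition L2_lim :: "'a measure \<Rightarrow> ('b \<Rightarrow> 'a \<Rightarrow> real) \<Rightarrow> 'b filter \<Rightarrow> ('a \<Rightarrow> real)" where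
  "L2_lim N f F = (SOME h. L2_tendsto N f h F)"

lemma L2_fun_diff:
  assumes "L2_fun N f" "L2_fun N h"
  shows "L2_fun N (\<lambda>x. f x - h x)"
  unfolding L2_fun_def
proof
  have [measurable]: "f \<in> borel_measurable N" "h \<in> borel_measurable N"
    using assms by (auto simp: L2_fun_def)
  show "(\<lambda>x. f x - h x) \<in> borel_measurable N" by measurable
  have "integrable N (\<lambda>x. 2 * (f x)\<^sup>2 + 2 * (h x)\<^sup>2)"
    using assms by (auto simp: L2_fun_def)
  then show "integrable N (\<lambda>x. (f x - h x)\<^sup>2)"
  proof (rule Bochner_Integration.integrable_bound)
    have "(f x - h x)\<^sup>2 \<le> 2 * (f x)\<^sup>2 + 2 * (h x)\<^sup>2" for x
      using zero_le_power2[of "f x + h x"] by (simp add: power2_eq_square algebra_simps)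
    then show "AE x in N. norm ((f x - h x)\<^sup>2) \<le> norm (2 * (f x)\<^sup>2 + 2 * (h x)\<^sup>2)"
      by (auto intro!: AE_I2 order.trans[OF _ abs_ge_self])
  qed measurable
qed

lemma L2_tendsto_unique:
  assumes "L2_tendsto N f h F" "L2_tendsto N f h' F" "F \<noteq> bot"
  shows "AE x in N. h x = h' x"
proof -
  let ?I = "\<lambda>u. \<integral>x. (u x)\<^sup>2 \<partial>N"
  have L: "L2_fun N h" "L2_fun N h'" "\<forall>\<^sub>F e in F. L2_fun N (f e)"
    using assms by (auto simp: L2_tendsto_def)
  have lim: "((\<lambda>e. ?I (\<lambda>x. f e x - k x)) \<longlongrightarrow> 0) F" if "L2_tendsto N f k F" for k
  proof -
    have "((\<lambda>e. (L2_norm N (\<lambda>x. f e x - k x))\<^sup>2) \<longlongrightarrow> 0\<^sup>2) F"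
      using that by (intro tendsto_power) (auto simp: L2_tendsto_def)
    then show ?thesis by (simp add: L2_norm_def)
  qed
  have "((\<lambda>e. 2 * ?I (\<lambda>x. f e x - h x) + 2 * ?I (\<lambda>x. f e x - h' x)) \<longlongrightarrow> 2 * 0 + 2 * 0) F"
    by (intro tendsto_intros lim assms)
  moreover have "\<forall>\<^sub>F e in F. ?I (\<lambda>x. h x - h' x) \<le> 2 * ?I (\<lambda>x. f e x - h x) + 2 * ?I (\<lambda>x. f e x - h' x)"
    using L(3)
  proof eventually_elim
    case (elim e)
    have i: "integrable N (\<lambda>x. (f e x - h x)\<^sup>2)" "integrable N (\<lambda>x. (f e x - h' x)\<^sup>2)"
      "integrable N (\<lambda>x. (h x - h' x)\<^sup>2)"
      using L2_fun_diff[OF elim L(1)] L2_fun_diff[OF elim L(2)] L2_fun_diff[OF L(1,2)]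
      by (auto simp: L2_fun_def)
    have "(h x - h' x)\<^sup>2 \<le> 2 * (f e x - h x)\<^sup>2 + 2 * (f e x - h' x)\<^sup>2" for x
      using zero_le_power2[of "(f e x - h x) + (f e x - h' x)"]
      by (simp add: power2_eq_square algebra_simps)
    then have "?I (\<lambda>x. h x - h' x) \<le> (\<integral>x. 2 * (f e x - h x)\<^sup>2 + 2 * (f e x - h' x)\<^sup>2 \<partial>N)"
      using i by (intro integral_mono) auto
    then show ?case using i by simp
  qed
  ultimately have "?I (\<lambda>x. h x - h' x) \<le> 0"
    using tendsto_lowerbound assms(3) by fastforce
  then have "?I (\<lambda>x. h x - h' x) = 0"
    by (intro order.antisym) (auto intro!: Bochner_Integration.integral_nonneg)
  moreover have "integrable N (\<lambda>x. (h x - h' x)\<^sup>2)"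
    using L2_fun_diff[OF L(1,2)] by (auto simp: L2_fun_def)
  ultimately have "AE x in N. (h x - h' x)\<^sup>2 = 0"
    by (subst (asm) integral_nonneg_eq_0_iff_AE) auto
  then show ?thesis by simp
qed

section \<open>Stationary ergodic Markov chains\<close>

definition ergodic_transformation :: "'a measure \<Rightarrow> ('a \<Rightarrow> 'a) \<Rightarrow> bool" where
  "ergodic_transformation M \<theta> \<longleftrightarrow>
     \<theta> \<in> M \<rightarrow>\<^sub>M M \<and> distr M M \<theta> = M \<and>
     (\<forall>A\<in>sets M. \<theta> -` A \<inter> space M = A \<longrightarrow> measure M A = 0 \<or> measure M A = 1)"

text \<open>The past $\sigma(\ldots, W_{k-1}, W_k)$; as an argument of \<open>real_cond_exp\<close> only its
  \<open>\<sigma>\<close>-algebra matters.\<close>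

definition past :: "'a measure \<Rightarrow> 'w measure \<Rightarrow> (int \<Rightarrow> 'a \<Rightarrow> 'w) \<Rightarrow> int \<Rightarrow> 'a measure" where
  "past M S W k = sigma (space M) {W j -` B \<inter> space M |j B. j \<le> k \<and> B \<in> sets S}"

text \<open>The process \<open>W\<close> takes values in the measurable space \<open>S\<close>; the law \<open>Q w\<close> is the transition
  probability from state \<open>w\<close>. Stationarity and ergodicity of \<open>W\<close> as a process are consequences
  of \<open>ergodic\<close> and \<open>W_shift\<close>, see \<open>path_stationary\<close> and \<open>path_ergodic\<close>.\<close>

locale ergodic_markov_chain = prob_space M
  for M :: "'a measure" +
  fixes \<theta> :: "'a \<Rightarrow> 'a"
    and S :: "'w measure"
    and W :: "int \<Rightarrow> 'a \<Rightarrow> 'w"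
    and Q :: "'w \<Rightarrow> 'w measure"
    and \<pi> :: "'w measure"
  assumes ergodic: "ergodic_transformation M \<theta>"
    and W_measurable: "\<And>k. W k \<in> M \<rightarrow>\<^sub>M S"
    and W_shift: "\<And>k \<omega>. \<omega> \<in> space M \<Longrightarrow> W k (\<theta> \<omega>) = W (k + 1) \<omega>"
    and W_marginal: "\<And>k. distr M S (W k) = \<pi>"
    and Q_kernel: "Q \<in> S \<rightarrow>\<^sub>M prob_algebra S"
    and W_markov: "\<And>k B. B \<in> sets S \<Longrightarrow>
      AE \<omega> in M. real_cond_exp M (past M S W k) (indicator (W (k + 1) -` B \<inter> space M)) \<omega>
        = measure (Q (W k \<omega>)) B"
begin

lemma path_measurable: "(\<lambda>\<omega> k. W k \<omega>) \<in> M \<rightarrow>\<^sub>M (\<Pi>\<^sub>M k\<in>UNIV. S)"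
  by (rule measurable_PiM_single') (use W_measurable measurable_space[OF W_measurable] in auto)

lemma path_stationary:
  "distr M (\<Pi>\<^sub>M k\<in>UNIV. S) (\<lambda>\<omega> k. W (k + 1) \<omega>) = distr M (\<Pi>\<^sub>M k\<in>UNIV. S) (\<lambda>\<omega> k. W k \<omega>)"
proof -
  have \<theta>: "\<theta> \<in> M \<rightarrow>\<^sub>M M" "distr M M \<theta> = M"
    using ergodic by (auto simp: ergodic_transformation_def)
  have "distr M (\<Pi>\<^sub>M k\<in>UNIV. S) (\<lambda>\<omega> k. W k \<omega>)
      = distr (distr M M \<theta>) (\<Pi>\<^sub>M k\<in>UNIV. S) (\<lambda>\<omega> k. W k \<omega>)"
    by (simp add: \<theta>)
  also have "\<dots> = distr M (\<Pi>\<^sub>M k\<in>UNIV. S) ((\<lambda>\<omega> k. W k \<omega>) \<circ> \<theta>)"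
    using path_measurable \<theta>(1) by (intro distr_distr) auto
  also have "\<dots> = distr M (\<Pi>\<^sub>M k\<in>UNIV. S) (\<lambda>\<omega> k. W (k + 1) \<omega>)"
    by (intro distr_cong) (auto simp: W_shift)
  finally show ?thesis by simp
qed

lemma path_ergodic:
  assumes A: "A \<in> sets (\<Pi>\<^sub>M k\<in>(UNIV :: int set). S)"
    and inv: "(\<lambda>w k. w (k + 1)) -` A \<inter> space (\<Pi>\<^sub>M k\<in>UNIV. S) = A"
  shows "prob {\<omega>\<in>space M. (\<lambda>k. W k \<omega>) \<in> A} \<in> {0, 1}"
proof -
  let ?B = "{\<omega>\<in>space M. (\<lambda>k. W k \<omega>) \<in> A}"
  have \<theta>: "\<theta> \<in> M \<rightarrow>\<^sub>M M"
    using ergodic by (auto simp: ergodic_transformation_def)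
  have path: "(\<lambda>k. W k \<omega>) \<in> space (\<Pi>\<^sub>M k\<in>UNIV. S)" if "\<omega> \<in> space M" for \<omega>
    using measurable_space[OF path_measurable that] by simp
  have "?B \<in> sets M"
    using measurable_sets[OF path_measurable A] by (simp add: vimage_def Int_def conj_commute)
  moreover have "(\<lambda>k. W (k + 1) \<omega>) \<in> A \<longleftrightarrow> (\<lambda>k. W k \<omega>) \<in> A" if "\<omega> \<in> space M" for \<omega>
  proof -
    have "(\<lambda>k. W k \<omega>) \<in> (\<lambda>w k. w (k + 1)) -` A \<inter> space (\<Pi>\<^sub>M k\<in>UNIV. S)
        \<longleftrightarrow> (\<lambda>k. W (k + 1) \<omega>) \<in> A"
      using path[OF that] by simp
    then show ?thesis by (simp add: inv)
  qed
  then have "\<theta> -` ?B \<inter> space M = ?B"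
    using measurable_space[OF \<theta>] by (auto simp: W_shift)
  ultimately show ?thesis
    using ergodic by (auto simp: ergodic_transformation_def)
qed

end

section \<open>The partial sums and their martingale approximation\<close>

definition partial_sum :: "(int \<Rightarrow> 'a \<Rightarrow> 'w) \<Rightarrow> ('w \<Rightarrow> real) \<Rightarrow> nat \<Rightarrow> 'a \<Rightarrow> real" where
  "partial_sum W g n \<omega> = (\<Sum>k=1..n. g (W (int k) \<omega>))"

definition transition_op :: "('w \<Rightarrow> 'w measure) \<Rightarrow> ('w \<Rightarrow> real) \<Rightarrow> ('w \<Rightarrow> real)" where
  "transition_op Q f w = (\<integral>v. f v \<partial>(Q w))"

text \<open>The series is written pointwise. If \<open>g\<close> is square integrable for the stationary
  distribution \<open>\<pi>\<close>, it converges absolutely at \<open>\<pi>\<close>-almost every point, as well as in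
  $L^2(\pi)$, to the same function. The summation index is shifted by one to start at \<open>0\<close>.\<close>

definition resolvent :: "('w \<Rightarrow> 'w measure) \<Rightarrow> ('w \<Rightarrow> real) \<Rightarrow> real \<Rightarrow> 'w \<Rightarrow> real" where
  "resolvent Q g \<epsilon> w = (\<Sum>k. (transition_op Q ^^ k) g w / (1 + \<epsilon>) ^ Suc k)"

definition increment_approx ::
    "('w \<Rightarrow> 'w measure) \<Rightarrow> ('w \<Rightarrow> real) \<Rightarrow> real \<Rightarrow> 'w \<times> 'w \<Rightarrow> real" where
  "increment_approx Q g \<epsilon> = (\<lambda>(w\<^sub>0, w\<^sub>1). resolvent Q g \<epsilon> w\<^sub>1 - transition_op Q (resolvent Q g \<epsilon>) w\<^sub>0)"

definition joint_law :: "'a measure \<Rightarrow> 'w measure \<Rightarrow> (int \<Rightarrow> 'a \<Rightarrow> 'w) \<Rightarrow> ('w \<times> 'w) measure" where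
  "joint_law M S W = distr M (S \<Otimes>\<^sub>M S) (\<lambda>\<omega>. (W 0 \<omega>, W 1 \<omega>))"

definition mart_increment ::
    "'a measure \<Rightarrow> 'w measure \<Rightarrow> (int \<Rightarrow> 'a \<Rightarrow> 'w) \<Rightarrow> ('w \<Rightarrow> 'w measure) \<Rightarrow> ('w \<Rightarrow> real)
      \<Rightarrow> 'w \<times> 'w \<Rightarrow> real" where
  "mart_increment M S W Q g = L2_lim (joint_law M S W) (increment_approx Q g) (at_right 0)"

definition mart_part ::
    "'a measure \<Rightarrow> 'w measure \<Rightarrow> (int \<Rightarrow> 'a \<Rightarrow> 'w) \<Rightarrow> ('w \<Rightarrow> 'w measure) \<Rightarrow> ('w \<Rightarrow> real)
      \<Rightarrow> nat \<Rightarrow> 'a \<Rightarrow> real" where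
  "mart_part M S W Q g n \<omega> =
     (\<Sum>k=1..n. mart_increment M S W Q g (W (int k - 1) \<omega>, W (int k) \<omega>))"

definition mart_remainder ::
    "'a measure \<Rightarrow> 'w measure \<Rightarrow> (int \<Rightarrow> 'a \<Rightarrow> 'w) \<Rightarrow> ('w \<Rightarrow> 'w measure) \<Rightarrow> ('w \<Rightarrow> real)
      \<Rightarrow> nat \<Rightarrow> 'a \<Rightarrow> real" where
  "mart_remainder M S W Q g n \<omega> = partial_sum W g n \<omega> - mart_part M S W Q g n \<omega>"

section \<open>Slowly varying functions\<close>

definition slowly_varying :: "(real \<Rightarrow> real) \<Rightarrow> bool" where
  "slowly_varying ell \<longleftrightarrow> (\<forall>t>0. ((\<lambda>x. ell (t * x) / ell x) \<longlongrightarrow> 1) at_top)"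

definition ell_star :: "(real \<Rightarrow> real) \<Rightarrow> nat \<Rightarrow> real" where
  "ell_star ell n = (\<Sum>j=1..n. 1 / (real j * ell (real j)))"

end

theory Submission
  imports Defs
begin

text \<open>Write \<open>a\<^sub>n\<close> for the norm of \<open>E(S\<^sub>n | F\<^sub>0)\<close>. The resolvent equation
  \<open>(1 + \<epsilon>) h\<^sub>\<epsilon> = g + Q h\<^sub>\<epsilon>\<close> bounds the norm of \<open>h\<^sub>\<epsilon>\<close> by
  \<open>\<Phi>(\<epsilon>) = \<parallel>g\<parallel> + \<epsilon> \<Sum>\<^sub>k a\<^sub>k (1 + \<epsilon>)\<^bsup>-k-1\<^esup>\<close> and the distance of \<open>H\<^sub>\<epsilon>\<close> and \<open>H\<^sub>\<delta>\<close>,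
  \<open>\<delta> \<le> \<epsilon>\<close>, by \<open>\<surd>(2 \<epsilon>) (\<Phi>(\<epsilon>) + \<Phi>(\<delta>))\<close>. With \<open>c\<^sub>N = 2\<^bsup>-N/2\<^esup> \<Phi>(2\<^bsup>-N\<^esup>)\<close> this gives
  \<open>2\<^bsup>-N/2\<^esup> \<parallel>R\<^bsub>2^N\<^esub>\<parallel> \<le> 10 \<Sum>\<^bsub>k \<ge> N\<^esub> c\<^sub>k\<close>. The hypothesis implies
  \<open>\<Sum>\<^sub>N N \<surd>\<ell>(2\<^sup>N) c\<^sub>N < \<infinity>\<close>, where the factor \<open>N\<close> is what summing the tails costs, so that
  \<open>\<Sum>\<^sub>N \<surd>\<ell>(2\<^sup>N) 2\<^bsup>-N/2\<^esup> \<parallel>R\<^bsub>2^N\<^esub>\<parallel> < \<infinity>\<close>.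

  Since \<open>R\<close> has stationary increments, \<open>R\<^sub>k\<close> is a sum of shifted copies of \<open>R\<^bsub>2^j\<^esub>\<close>, one for each
  binary digit of \<open>k\<close>. The Borel-Cantelli lemma bounds all copies of level \<open>j\<close> simultaneously,
  and the Cauchy-Schwarz inequality over the levels, with \<open>\<Sum>\<^bsub>2^j \<le> k\<^esub> 1 / \<ell>(2\<^sup>j) \<le> 2 \<ell>\<^sup>*(k)\<close>,
  gives the claim.\<close>

section \<open>Square integrable functions\<close>

lemma L2_fun_measurable [measurable_dest]: "L2_fun N f \<Longrightarrow> f \<in> borel_measurable N"
  by (simp add: L2_fun_def)

lemma L2_fun_uminus: "L2_fun N f \<Longrightarrow> L2_fun N (\<lambda>x. - f x)"
  by (auto simp: L2_fun_def)

lemma L2_fun_cmult: "L2_fun N f \<Longrightarrow> L2_fun N (\<lambda>x. c * f x)"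
  by (auto simp: L2_fun_def power_mult_distrib)

lemma L2_fun_zero [simp]: "L2_fun N (\<lambda>x. 0)"
  by (simp add: L2_fun_def)

lemma L2_fun_add:
  assumes "L2_fun N f" "L2_fun N h"
  shows "L2_fun N (\<lambda>x. f x + h x)"
  using L2_fun_diff[OF assms(1) L2_fun_uminus[OF assms(2)]] by simp

lemma L2_fun_sum: "(\<And>i. i \<in> I \<Longrightarrow> L2_fun N (f i)) \<Longrightarrow> L2_fun N (\<lambda>x. \<Sum>i\<in>I. f i x)"
  by (induction I rule: infinite_finite_induct) (auto intro: L2_fun_add)

lemma L2_fun_abs: "L2_fun N f \<Longrightarrow> L2_fun N (\<lambda>x. \<bar>f x\<bar>)"
  by (auto simp: L2_fun_def)

lemma L2_fun_mult_integrable: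
  assumes "L2_fun N f" "L2_fun N h"
  shows "integrable N (\<lambda>x. f x * h x)"
proof -
  have [measurable]: "f \<in> borel_measurable N" "h \<in> borel_measurable N"
    using assms by (auto simp: L2_fun_def)
  show ?thesis
  proof (rule Bochner_Integration.integrable_bound)
    show "integrable N (\<lambda>x. (f x)\<^sup>2 + (h x)\<^sup>2)"
      using assms by (auto simp: L2_fun_def)
    have "\<bar>f x * h x\<bar> \<le> (f x)\<^sup>2 + (h x)\<^sup>2" for x
      using zero_le_power2[of "\<bar>f x\<bar> - \<bar>h x\<bar>"] mult_nonneg_nonneg[OF abs_ge_zero[of "f x"] abs_ge_zero[of "h x"]]
      unfolding abs_mult power2_diff power2_abs mult.assoc by linarith
    then show "AE x in N. norm (f x * h x) \<le> norm ((f x)\<^sup>2 + (h x)\<^sup>2)"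
      by (auto intro!: AE_I2 order.trans[OF _ abs_ge_self])
  qed measurable
qed

lemma (in finite_measure) L2_fun_integrable:
  assumes "L2_fun M f" shows "integrable M f"
proof -
  have "L2_fun M (\<lambda>x. 1)" by (simp add: L2_fun_def)
  from L2_fun_mult_integrable[OF assms this] show ?thesis by simp
qed

lemma L2_norm_nonneg [simp]: "0 \<le> L2_norm N f"
  by (simp add: L2_norm_def)

lemma L2_norm_power2: "(L2_norm N f)\<^sup>2 = (\<integral>x. (f x)\<^sup>2 \<partial>N)"
  by (simp add: L2_norm_def)

lemma L2_norm_zero [simp]: "L2_norm N (\<lambda>x. 0) = 0"
  by (simp add: L2_norm_def)

lemma L2_norm_uminus [simp]: "L2_norm N (\<lambda>x. - f x) = L2_norm N f"
  by (simp add: L2_norm_def)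

lemma L2_norm_commute: "L2_norm N (\<lambda>x. f x - h x) = L2_norm N (\<lambda>x. h x - f x)"
  by (simp add: L2_norm_def power2_commute)

lemma L2_norm_cmult: "L2_norm N (\<lambda>x. c * f x) = \<bar>c\<bar> * L2_norm N f"
  by (simp add: L2_norm_def power_mult_distrib real_sqrt_mult)

lemma L2_norm_abs [simp]: "L2_norm N (\<lambda>x. \<bar>f x\<bar>) = L2_norm N f"
  by (simp add: L2_norm_def)

lemma L2_norm_cong_AE:
  assumes "AE x in N. f x = h x" "f \<in> borel_measurable N" "h \<in> borel_measurable N"
  shows "L2_norm N f = L2_norm N h"
  unfolding L2_norm_def
  by (rule arg_cong[of _ _ sqrt], rule integral_cong_AE) (use assms in auto)

lemma L2_norm_eq_0D:
  assumes "L2_fun N f" "L2_norm N f \<le> 0"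
  shows "AE x in N. f x = 0"
proof -
  have "(\<integral>x. (f x)\<^sup>2 \<partial>N) = 0"
    using assms(2) L2_norm_nonneg[of N f] L2_norm_power2[of N f] by simp
  then have "AE x in N. (f x)\<^sup>2 = 0"
    using assms(1) by (subst (asm) integral_nonneg_eq_0_iff_AE) (auto simp: L2_fun_def)
  then show ?thesis by simp
qed

lemma L2_Cauchy_Schwarz:
  assumes f: "L2_fun N f" and h: "L2_fun N h"
  shows "\<bar>\<integral>x. f x * h x \<partial>N\<bar> \<le> L2_norm N f * L2_norm N h"
proof (cases "L2_norm N f = 0 \<or> L2_norm N h = 0")
  case True
  then have "AE x in N. f x * h x = 0"
    using L2_norm_eq_0D[OF f] L2_norm_eq_0D[OF h] by (auto elim!: eventually_mono)
  then have "(\<integral>x. f x * h x \<partial>N) = (\<integral>x. 0 \<partial>N)"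
    using f h by (intro integral_cong_AE) (auto simp: L2_fun_def)
  then show ?thesis using L2_norm_nonneg[of N f] L2_norm_nonneg[of N h] by simp
next
  case False
  define A B where "A = L2_norm N f" and "B = L2_norm N h"
  have pos: "A > 0" "B > 0"
    using False L2_norm_nonneg[of N f] L2_norm_nonneg[of N h] by (auto simp: A_def B_def order.order_iff_strict)
  have i: "integrable N (\<lambda>x. (f x)\<^sup>2)" "integrable N (\<lambda>x. (h x)\<^sup>2)" "integrable N (\<lambda>x. \<bar>f x * h x\<bar>)"
    using f h L2_fun_mult_integrable[OF f h] by (auto simp: L2_fun_def)
  \<comment> \<open>Weighting each function by the norm of the other makes both integrals on the
    right equal to \<open>(A * B)\<^sup>2\<close>. The case split keeps \<open>A * B\<close> nonzero
    for the final division.\<close>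
  have "(\<integral>x. 2 * (A * B) * \<bar>f x * h x\<bar> \<partial>N) \<le> (\<integral>x. B\<^sup>2 * (f x)\<^sup>2 + A\<^sup>2 * (h x)\<^sup>2 \<partial>N)"
  proof (rule integral_mono)
    fix x
    show "2 * (A * B) * \<bar>f x * h x\<bar> \<le> B\<^sup>2 * (f x)\<^sup>2 + A\<^sup>2 * (h x)\<^sup>2"
      using zero_le_power2[of "B * \<bar>f x\<bar> - A * \<bar>h x\<bar>"]
      by (simp add: power2_diff power_mult_distrib abs_mult mult_ac)
  qed (use i in auto)
  also have "\<dots> = 2 * (A * B) * (A * B)"
    using i by (simp add: L2_norm_power2[symmetric] A_def B_def) (simp add: power2_eq_square)
  finally have "(\<integral>x. \<bar>f x * h x\<bar> \<partial>N) \<le> A * B"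
    using pos by simp
  then show ?thesis
    unfolding A_def B_def by (rule order.trans[OF integral_abs_bound])
qed

lemma L2_norm_add_power2:
  assumes f: "L2_fun N f" and h: "L2_fun N h"
  shows "(L2_norm N (\<lambda>x. f x + h x))\<^sup>2 = (L2_norm N f)\<^sup>2 + (L2_norm N h)\<^sup>2 + 2 * (\<integral>x. f x * h x \<partial>N)"
proof -
  have "(L2_norm N (\<lambda>x. f x + h x))\<^sup>2 = (\<integral>x. (f x)\<^sup>2 + (h x)\<^sup>2 + 2 * (f x * h x) \<partial>N)"
    by (simp add: L2_norm_power2 power2_sum mult.assoc)
  also have "\<dots> = (L2_norm N f)\<^sup>2 + (L2_norm N h)\<^sup>2 + 2 * (\<integral>x. f x * h x \<partial>N)"
    using f h L2_fun_mult_integrable[OF f h] by (simp add: L2_norm_power2 L2_fun_def)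
  finally show ?thesis .
qed

lemma L2_norm_add_le:
  assumes f: "L2_fun N f" and h: "L2_fun N h"
  shows "L2_norm N (\<lambda>x. f x + h x) \<le> L2_norm N f + L2_norm N h"
proof (rule power2_le_imp_le)
  show "(L2_norm N (\<lambda>x. f x + h x))\<^sup>2 \<le> (L2_norm N f + L2_norm N h)\<^sup>2"
    using L2_Cauchy_Schwarz[OF f h] by (simp add: L2_norm_add_power2[OF f h] power2_sum)
qed simp

lemma L2_norm_diff_le:
  assumes f: "L2_fun N f" and h: "L2_fun N h"
  shows "L2_norm N (\<lambda>x. f x - h x) \<le> L2_norm N f + L2_norm N h"
  using L2_norm_add_le[OF f L2_fun_uminus[OF h]] by simp

lemma L2_norm_triangle:
  assumes "L2_fun N f" "L2_fun N k" "L2_fun N h"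
  shows "L2_norm N (\<lambda>x. f x - h x) \<le> L2_norm N (\<lambda>x. f x - k x) + L2_norm N (\<lambda>x. k x - h x)"
  using L2_norm_add_le[OF L2_fun_diff[OF assms(1,2)] L2_fun_diff[OF assms(2,3)]] by simp

lemma L2_norm_sum_le:
  assumes "\<And>i. i \<in> I \<Longrightarrow> L2_fun N (f i)"
  shows "L2_norm N (\<lambda>x. \<Sum>i\<in>I. f i x) \<le> (\<Sum>i\<in>I. L2_norm N (f i))"
  using assms
proof (induction I rule: infinite_finite_induct)
  case (insert i I)
  have "L2_norm N (\<lambda>x. f i x + (\<Sum>i\<in>I. f i x)) \<le> L2_norm N (f i) + L2_norm N (\<lambda>x. \<Sum>i\<in>I. f i x)"
    using insert by (intro L2_norm_add_le L2_fun_sum) auto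
  then show ?case using insert by force
qed auto

lemma L2_fun_distr:
  assumes "T \<in> M \<rightarrow>\<^sub>M N" "L2_fun (distr M N T) f"
  shows "L2_fun M (\<lambda>x. f (T x))" "L2_norm M (\<lambda>x. f (T x)) = L2_norm (distr M N T) f"
proof -
  have [measurable]: "f \<in> borel_measurable N" using assms(2) by (simp add: L2_fun_def)
  show "L2_fun M (\<lambda>x. f (T x))"
    using assms integrable_distr_eq[OF assms(1), of "\<lambda>x. (f x)\<^sup>2"] by (simp add: L2_fun_def)
  show "L2_norm M (\<lambda>x. f (T x)) = L2_norm (distr M N T) f"
    using integral_distr[OF assms(1), of "\<lambda>x. (f x)\<^sup>2"] by (simp add: L2_norm_def)
qed

lemma (in prob_space) L1_le_L2_norm:
  assumes "L2_fun M f"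
  shows "(\<integral>x. \<bar>f x\<bar> \<partial>M) \<le> L2_norm M f"
proof -
  have one: "L2_fun M (\<lambda>x. 1)" "L2_norm M (\<lambda>x. 1) = 1"
    by (simp_all add: L2_fun_def L2_norm_def prob_space)
  have "\<bar>\<integral>x. \<bar>f x\<bar> * 1 \<partial>M\<bar> \<le> L2_norm M (\<lambda>x. \<bar>f x\<bar>) * L2_norm M (\<lambda>x. 1)"
    by (rule L2_Cauchy_Schwarz) (use assms one in \<open>auto intro: L2_fun_abs\<close>)
  then show ?thesis by (simp add: one)
qed

text \<open>\<open>resolvent\<close> is a pointwise series, so convergence in L2 alone would not
  identify its values. On a probability space the L1 norm is below the L2 norm, hence the series of
  absolute values has finite integral and converges almost everywhere; Fatou's lemma along the
  partial sums then bounds the pointwise sum in L2. The lemma also serves as completeness of L2 when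
  H is constructed.\<close>

lemma (in prob_space) L2_series:
  assumes f: "\<And>k. L2_fun M (f k)" and s: "summable (\<lambda>k. L2_norm M (f k))"
  shows "AE x in M. summable (\<lambda>k. f k x)"
    and "L2_fun M (\<lambda>x. \<Sum>k. f k x)"
    and "L2_norm M (\<lambda>x. \<Sum>k. f k x) \<le> (\<Sum>k. L2_norm M (f k))"
proof -
  have [measurable]: "f k \<in> borel_measurable M" for k using f[of k] by (simp add: L2_fun_def)
  have "(\<integral>\<^sup>+x. (\<Sum>k. ennreal \<bar>f k x\<bar>) \<partial>M) = (\<Sum>k. \<integral>\<^sup>+x. ennreal \<bar>f k x\<bar> \<partial>M)"
    by (rule nn_integral_suminf) measurable
  also have "\<dots> \<le> (\<Sum>k. ennreal (L2_norm M (f k)))"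
  proof (rule suminf_le)
    fix k
    have "(\<integral>\<^sup>+x. ennreal \<bar>f k x\<bar> \<partial>M) = ennreal (\<integral>x. \<bar>f k x\<bar> \<partial>M)"
      by (rule nn_integral_eq_integral) (use L2_fun_integrable[OF f[of k]] in auto)
    then show "(\<integral>\<^sup>+x. ennreal \<bar>f k x\<bar> \<partial>M) \<le> ennreal (L2_norm M (f k))"
      using L1_le_L2_norm[OF f[of k]] by (simp add: ennreal_leI)
  qed auto
  also have "\<dots> < \<infinity>"
    using s by (simp add: suminf_ennreal2 ennreal_less_top)
  finally have "AE x in M. (\<Sum>k. ennreal \<bar>f k x\<bar>) \<noteq> \<infinity>"
    by (intro nn_integral_PInf_AE) auto
  then show summ: "AE x in M. summable (\<lambda>k. f k x)"
  proof eventually_elim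
    case (elim x)
    then have "summable (\<lambda>k. \<bar>f k x\<bar>)"
      by (intro summable_suminf_not_top) auto
    then show ?case by (rule summable_rabs_cancel)
  qed
  define C where "C = (\<Sum>k. L2_norm M (f k))"
  have C0: "C \<ge> 0" unfolding C_def by (rule suminf_nonneg[OF s]) simp
  let ?T = "\<lambda>n x. \<Sum>k<n. f k x" and ?F = "\<lambda>x. \<Sum>k. f k x"
  have [measurable]: "?F \<in> borel_measurable M" by measurable
  have "(\<integral>\<^sup>+x. ennreal ((?F x)\<^sup>2) \<partial>M) = (\<integral>\<^sup>+x. liminf (\<lambda>n. ennreal ((?T n x)\<^sup>2)) \<partial>M)"
    using summ
  proof (intro nn_integral_cong_AE, eventually_elim)
    case (elim x)
    have "(\<lambda>n. ennreal ((?T n x)\<^sup>2)) \<longlonglongrightarrow> ennreal ((?F x)\<^sup>2)"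
      by (intro tendsto_intros summable_LIMSEQ elim)
    from lim_imp_Liminf[OF sequentially_bot this] show ?case by simp
  qed
  also have "\<dots> \<le> liminf (\<lambda>n. \<integral>\<^sup>+x. ennreal ((?T n x)\<^sup>2) \<partial>M)"
    by (rule nn_integral_liminf) measurable
  also have "\<dots> \<le> liminf (\<lambda>n. ennreal (C\<^sup>2))"
  proof (rule Liminf_mono, rule always_eventually, rule allI)
    fix n
    have L: "L2_fun M (?T n)" by (intro L2_fun_sum f)
    have "L2_norm M (?T n) \<le> (\<Sum>k<n. L2_norm M (f k))" by (intro L2_norm_sum_le f)
    also have "\<dots> \<le> C" unfolding C_def by (rule sum_le_suminf[OF s]) auto
    finally have "(L2_norm M (?T n))\<^sup>2 \<le> C\<^sup>2" by (intro power_mono) auto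
    moreover have "(\<integral>\<^sup>+x. ennreal ((?T n x)\<^sup>2) \<partial>M) = ennreal ((L2_norm M (?T n))\<^sup>2)"
      unfolding L2_norm_power2
      by (rule nn_integral_eq_integral) (use L in \<open>auto simp: L2_fun_def\<close>)
    ultimately show "(\<integral>\<^sup>+x. ennreal ((?T n x)\<^sup>2) \<partial>M) \<le> ennreal (C\<^sup>2)"
      by (simp add: ennreal_leI)
  qed
  also have "\<dots> = ennreal (C\<^sup>2)" by (simp add: Liminf_const)
  finally have le: "(\<integral>\<^sup>+x. ennreal ((?F x)\<^sup>2) \<partial>M) \<le> ennreal (C\<^sup>2)" .
  have int: "integrable M (\<lambda>x. (?F x)\<^sup>2)"
    by (rule integrableI_nonneg) (use le in \<open>auto simp: le_less_trans[OF _ ennreal_less_top]\<close>)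
  then show L: "L2_fun M ?F" by (simp add: L2_fun_def)
  have "ennreal ((L2_norm M ?F)\<^sup>2) \<le> ennreal (C\<^sup>2)"
    using le nn_integral_eq_integral[OF int] by (simp add: L2_norm_power2)
  then have "(L2_norm M ?F)\<^sup>2 \<le> C\<^sup>2" by simp
  then show "L2_norm M ?F \<le> (\<Sum>k. L2_norm M (f k))"
    using C0 unfolding C_def[symmetric] by (rule power2_le_imp_le)
qed

text \<open>The remainder agrees almost everywhere with the series started at \<open>n\<close>, to
  which the norm bound of \<open>L2_series\<close> applies again.\<close>

lemma (in prob_space) L2_series_tail:
  assumes f: "\<And>k. L2_fun M (f k)" and s: "summable (\<lambda>k. L2_norm M (f k))"
  shows "(\<lambda>n. L2_norm M (\<lambda>x. (\<Sum>k. f k x) - (\<Sum>k<n. f k x))) \<longlonglongrightarrow> 0"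
proof (rule tendsto_sandwich[where f = "\<lambda>n. 0" and h = "\<lambda>n. \<Sum>k. L2_norm M (f (k + n))"])
  note [measurable] = f[THEN L2_fun_measurable]
  have "L2_norm M (\<lambda>x. (\<Sum>k. f k x) - (\<Sum>k<n. f k x)) \<le> (\<Sum>k. L2_norm M (f (k + n)))" for n
  proof -
    have "AE x in M. (\<Sum>k. f k x) - (\<Sum>k<n. f k x) = (\<Sum>k. f (k + n) x)"
      using L2_series(1)[OF f s]
      by eventually_elim (rule suminf_minus_initial_segment[symmetric])
    then have "L2_norm M (\<lambda>x. (\<Sum>k. f k x) - (\<Sum>k<n. f k x)) = L2_norm M (\<lambda>x. \<Sum>k. f (k + n) x)"
      by (rule L2_norm_cong_AE) measurable
    also have "\<dots> \<le> (\<Sum>k. L2_norm M (f (k + n)))"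
      by (rule L2_series(3)[OF f]) (rule summable_ignore_initial_segment[OF s])
    finally show ?thesis .
  qed
  then show "\<forall>\<^sub>F n in sequentially. L2_norm M (\<lambda>x. (\<Sum>k. f k x) - (\<Sum>k<n. f k x)) \<le> (\<Sum>k. L2_norm M (f (k + n)))"
    by simp
qed (use suminf_exist_split2[OF s] in auto)

section \<open>Stationary increments\<close>

text \<open>Clear the binary digits of \<open>k\<close> from the lowest upwards. Clearing digit
  \<open>j\<close> changes the truncation only if \<open>k div 2 ^ j\<close> is odd, and then moves
  it down by one aligned block of length \<open>2 ^ j\<close>, the one with index
  \<open>k div 2 ^ j - 1\<close>. After \<open>m\<close> digits nothing is left of
  \<open>k\<close>.\<close>

lemma binary_block_sum:
  fixes r :: "nat \<Rightarrow> real"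
  assumes "r 0 = 0" and "k < 2 ^ m"
    and y: "\<And>j i. \<bar>r (Suc i * 2 ^ j) - r (i * 2 ^ j)\<bar> \<le> y j i"
  shows "\<bar>r k\<bar> \<le> (\<Sum>j<m. if odd (k div 2 ^ j) then y j (k div 2 ^ j - 1) else 0)"
proof -
  let ?T = "\<lambda>j. if odd (k div 2 ^ j) then y j (k div 2 ^ j - 1) else 0"
  \<comment> \<open>Stated for every \<open>m\<close> (the name is rebound here), since the
    intermediate truncations need not be 0; the bound on \<open>k\<close> enters only at the
    end.\<close>
  have "\<bar>r k - r (k div 2 ^ m * 2 ^ m)\<bar> \<le> (\<Sum>j<m. ?T j)" for m
  proof (induction m)
    case (Suc m)
    let ?q = "k div 2 ^ m"
    have eq: "k div 2 ^ Suc m * 2 ^ Suc m = (if odd ?q then (?q - 1) * 2 ^ m else ?q * 2 ^ m)"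
    proof -
      have "k div 2 ^ Suc m * 2 ^ Suc m = (?q div 2 * 2) * 2 ^ m"
        by (simp add: div_mult2_eq[symmetric] mult.commute)
      also have "?q div 2 * 2 = (if odd ?q then ?q - 1 else ?q)"
        by (auto elim!: oddE evenE)
      finally show ?thesis by simp
    qed
    have "\<bar>r (?q * 2 ^ m) - r (k div 2 ^ Suc m * 2 ^ Suc m)\<bar> \<le> ?T m"
      unfolding eq using y[of "?q - 1" m] by (auto elim!: oddE)
    then show ?case using Suc by simp
  qed simp
  from this[of m] show ?thesis using assms by simp
qed

text \<open>The pathwise half of the almost sure statement: probability will enter through
  \<open>y_lim\<close> and \<open>y_le\<close>. The uniform bound \<open>y_le\<close> and the
  smallness of the tail of \<open>s\<close> are available for large \<open>j\<close> only, so the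
  finitely many lower levels are treated one at a time by \<open>y_lim\<close>, and the upper ones
  by Cauchy-Schwarz, pairing \<open>s j\<close> with \<open>1 / e j\<close>.\<close>

lemma block_sum_bound:
  fixes r e s L :: "nat \<Rightarrow> real"
  assumes r0: "r 0 = 0"
    and y: "\<And>j i. \<bar>r (Suc i * 2 ^ j) - r (i * 2 ^ j)\<bar> \<le> y j i"
    and y_lim: "\<And>j. (\<lambda>i. y j i / sqrt (real (Suc i))) \<longlonglongrightarrow> 0"
    and y_le: "\<forall>\<^sub>F j in sequentially. \<forall>i. y j i \<le> sqrt (real (Suc i)) * sqrt (2 ^ j * (s j / e j))"
    and e: "\<And>j. 0 < e j" and s: "\<And>j. 0 \<le> s j" "summable s"
    and L: "0 < c" "\<And>k. 0 < k \<Longrightarrow> c \<le> L k"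
    and eL: "\<And>m k. 2 ^ m \<le> k \<Longrightarrow> (\<Sum>j\<le>m. 1 / e j) \<le> 2 * L k"
  shows "(\<lambda>k. r k / sqrt (real k * L k)) \<longlonglongrightarrow> 0"
proof -
  define T where "T k j = (if odd (k div 2 ^ j) then y j (k div 2 ^ j - 1) else 0)" for k j
  have T0: "0 \<le> T k j" for k j
    using order.trans[OF abs_ge_zero y] by (simp add: T_def)
  have lim: "(\<lambda>k. T k j / sqrt (real k)) \<longlonglongrightarrow> 0" for j
  proof -
    let ?z = "\<lambda>k. y j (k div 2 ^ j - 1) / sqrt (real (Suc (k div 2 ^ j - 1)))"
    show ?thesis
    proof (rule tendsto_sandwich[where f = "\<lambda>k. 0" and h = ?z])
    have "filterlim (\<lambda>k. k div 2 ^ j - 1) sequentially sequentially"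
      unfolding filterlim_at_top
    proof
      fix Z :: nat
      show "\<forall>\<^sub>F k in sequentially. Z \<le> k div 2 ^ j - 1"
        using eventually_ge_at_top[of "Suc Z * 2 ^ j"]
      proof eventually_elim
        case (elim k)
        then have "Suc Z \<le> k div 2 ^ j" by (simp add: less_eq_div_iff_mult_less_eq)
        then show ?case by simp
      qed
    qed
    from filterlim_compose[OF y_lim[of j] this] show "?z \<longlonglongrightarrow> 0" .
    show "(\<lambda>k. 0) \<longlonglongrightarrow> (0::real)" by simp
    show "\<forall>\<^sub>F k in sequentially. 0 \<le> T k j / sqrt (real k)"
      using T0 by (intro always_eventually allI divide_nonneg_nonneg) auto
    show "\<forall>\<^sub>F k in sequentially. T k j / sqrt (real k) \<le> ?z k"
      using eventually_gt_at_top[of 0]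
    proof eventually_elim
      case (elim k)
      have y0: "0 \<le> y j (k div 2 ^ j - 1)" by (rule order.trans[OF abs_ge_zero y])
      show ?case
      proof (cases "odd (k div 2 ^ j)")
        case True
        then have "Suc (k div 2 ^ j - 1) = k div 2 ^ j" by (auto elim!: oddE)
        then have "Suc (k div 2 ^ j - 1) \<le> k" by (simp add: div_le_dividend)
        then have "sqrt (real (Suc (k div 2 ^ j - 1))) \<le> sqrt (real k)" by (simp only: real_sqrt_le_iff of_nat_le_iff)
        then show ?thesis using y0 True elim odd_pos[OF True]
          by (auto simp: T_def intro!: divide_left_mono mult_pos_pos)
      qed (use y0 in \<open>auto simp: T_def\<close>)
    qed
  qed
  qed
  show ?thesis
  proof (rule LIMSEQ_I)
    fix \<epsilon> :: real assume \<epsilon>: "0 < \<epsilon>"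
    obtain J0 where J0: "\<And>j i. J0 \<le> j \<Longrightarrow> y j i \<le> sqrt (real (Suc i)) * sqrt (2 ^ j * (s j / e j))"
      using y_le unfolding eventually_sequentially by auto
    \<comment> \<open>Chosen so that \<open>sqrt \<delta> * sqrt (2 * L k)\<close> is exactly
      \<open>\<epsilon> / 2 * sqrt (L k)\<close>, half of the allowed error.\<close>
    define \<delta> where "\<delta> = \<epsilon>\<^sup>2 / 8"
    have \<delta>: "0 < \<delta>" using \<epsilon> by (simp add: \<delta>_def)
    obtain J1 where J1: "\<And>n. J1 \<le> n \<Longrightarrow> norm (\<Sum>i. s (i + n)) < \<delta>"
      using suminf_exist_split[OF \<delta> s(2)] by auto
    define J where "J = max J0 J1"
    have tail: "(\<Sum>j\<in>{J..m}. s j) \<le> \<delta>" for m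
    proof -
      have "(\<Sum>j\<in>{J..m}. s j) = (\<Sum>i<Suc m - J. s (i + J))"
        by (rule sum.reindex_bij_witness[of _ "\<lambda>i. i + J" "\<lambda>j. j - J"]) auto
      also have "\<dots> \<le> (\<Sum>i. s (i + J))"
        using s by (intro sum_le_suminf) (auto simp: summable_iff_shift)
      also have "\<dots> \<le> \<delta>" using J1[of J] by (simp add: J_def)
      finally show ?thesis .
    qed
    have "(\<lambda>k. \<Sum>j<J. T k j / sqrt (real k)) \<longlonglongrightarrow> (\<Sum>j<J. 0)"
      by (intro tendsto_sum lim)
    \<comment> \<open>The low levels are measured against the constant \<open>c\<close> in place of
      the varying \<open>L k\<close>, so that a plain limit in \<open>k\<close> suffices for
      them.\<close>
    moreover have "0 < \<epsilon> / 2 * sqrt c" using \<epsilon> L by simp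
    ultimately have "\<forall>\<^sub>F k in sequentially. (\<Sum>j<J. T k j / sqrt (real k)) < \<epsilon> / 2 * sqrt c"
      by (intro order_tendstoD(2)) auto
    then have "\<forall>\<^sub>F k in sequentially. norm (r k / sqrt (real k * L k) - 0) < \<epsilon>"
      using eventually_gt_at_top[of 0]
    proof eventually_elim
      case (elim k)
      have k: "0 < sqrt (real k)" using elim by simp
      have Lk: "0 < L k" "sqrt c \<le> sqrt (L k)" using L(1) L(2)[OF elim(2)] by auto
      obtain m where m: "2 ^ m \<le> k" "k < 2 ^ Suc m" using ex_power_ivl1[of 2 k] elim by auto
      have "\<bar>r k\<bar> \<le> (\<Sum>j<Suc m. T k j)"
        unfolding T_def by (rule binary_block_sum[OF r0 m(2) y])
      also have "\<dots> \<le> (\<Sum>j\<in>{..<J} \<union> {J..m}. T k j)"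
        by (intro sum_mono2 T0) auto
      also have "\<dots> = (\<Sum>j<J. T k j) + (\<Sum>j\<in>{J..m}. T k j)"
        by (intro sum.union_disjoint) auto
      also have "(\<Sum>j<J. T k j) < sqrt (real k) * (\<epsilon> / 2 * sqrt (L k))"
      proof -
        have "(\<Sum>j<J. T k j) = sqrt (real k) * (\<Sum>j<J. T k j / sqrt (real k))"
          using k by (simp add: sum_distrib_left)
        also have "\<dots> < sqrt (real k) * (\<epsilon> / 2 * sqrt c)"
          using elim(1) k by (intro mult_strict_left_mono)
        also have "\<dots> \<le> sqrt (real k) * (\<epsilon> / 2 * sqrt (L k))"
          using \<epsilon> Lk by (intro mult_left_mono) auto
        finally show ?thesis .
      qed
      also have "(\<Sum>j\<in>{J..m}. T k j) \<le> sqrt (real k) * (\<epsilon> / 2 * sqrt (L k))"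
      proof -
        \<comment> \<open>The block index is \<open>k div 2 ^ j - 1\<close>, so the weight
          \<open>sqrt (Suc i)\<close> of \<open>y_le\<close> is the root of
          \<open>k div 2 ^ j\<close>. Together with \<open>sqrt (2 ^ j)\<close> it is at most
          \<open>sqrt k\<close>, whatever the level.\<close>
        have "T k j \<le> sqrt (real k) * (sqrt (s j) * sqrt (1 / e j))" if "J \<le> j" for j
        proof (cases "odd (k div 2 ^ j)")
          case True
          let ?q = "k div 2 ^ j"
          have q: "Suc (?q - 1) = ?q" using True by (auto elim!: oddE)
          have "real (?q * 2 ^ j) \<le> real k" by (intro of_nat_mono) simp
          then have "real ?q * 2 ^ j \<le> real k" by simp
          then have qk: "real ?q * (2 ^ j * (s j / e j)) \<le> real k * (s j / e j)"
            using mult_right_mono[of "real ?q * 2 ^ j" "real k" "s j / e j"] s(1)[of j] e[of j]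
            by (simp add: mult.assoc)
          have "T k j \<le> sqrt (real ?q) * sqrt (2 ^ j * (s j / e j))"
            using True J0[of j "?q - 1"] that unfolding q by (simp add: T_def J_def)
          also have "\<dots> \<le> sqrt (real k * (s j / e j))"
            using qk by (simp only: real_sqrt_mult[symmetric] real_sqrt_le_iff)
          also have "\<dots> = sqrt (real k) * (sqrt (s j) * sqrt (1 / e j))"
            by (simp add: real_sqrt_mult[symmetric])
          finally show ?thesis .
        qed (use s(1)[of j] e[of j] in \<open>simp add: T_def\<close>)
        then have "(\<Sum>j\<in>{J..m}. T k j) \<le> (\<Sum>j\<in>{J..m}. sqrt (real k) * (\<bar>sqrt (s j)\<bar> * \<bar>sqrt (1 / e j)\<bar>))"
          using s(1) e by (intro sum_mono) (simp add: less_imp_le)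
        also have "\<dots> = sqrt (real k) * (\<Sum>j\<in>{J..m}. \<bar>sqrt (s j)\<bar> * \<bar>sqrt (1 / e j)\<bar>)"
          by (simp add: sum_distrib_left)
        also have "\<dots> \<le> sqrt (real k) * (L2_set (\<lambda>j. sqrt (s j)) {J..m} * L2_set (\<lambda>j. sqrt (1 / e j)) {J..m})"
          by (intro mult_left_mono L2_set_mult_ineq) simp
        also have "\<dots> = sqrt (real k) * (sqrt (\<Sum>j\<in>{J..m}. s j) * sqrt (\<Sum>j\<in>{J..m}. 1 / e j))"
          using s(1) e unfolding L2_set_def by (simp add: less_imp_le)
        also have "\<dots> \<le> sqrt (real k) * (sqrt \<delta> * sqrt (2 * L k))"
        proof (intro mult_left_mono mult_mono real_sqrt_le_mono tail)
          have "(\<Sum>j\<in>{J..m}. 1 / e j) \<le> (\<Sum>j\<le>m. 1 / e j)"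
            using e by (intro sum_mono2) (auto intro: less_imp_le)
          then show "(\<Sum>j\<in>{J..m}. 1 / e j) \<le> 2 * L k" using eL[OF m(1)] by simp
        qed (use \<delta> e in \<open>auto intro!: sum_nonneg simp: less_imp_le\<close>)
        also have "sqrt \<delta> * sqrt (2 * L k) = \<epsilon> / 2 * sqrt (L k)"
        proof -
          have "sqrt \<delta> * sqrt (2 * L k) = sqrt ((\<epsilon> / 2)\<^sup>2 * L k)"
            by (simp add: \<delta>_def real_sqrt_mult[symmetric] power2_eq_square)
          then show ?thesis using \<epsilon> by (simp add: real_sqrt_mult)
        qed
        finally show ?thesis .
      qed
      finally have "\<bar>r k\<bar> < \<epsilon> * sqrt (real k * L k)"
        by (simp add: real_sqrt_mult algebra_simps)
      then show ?case using k Lk by (simp add: pos_divide_less_eq abs_mult)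
    qed
    then show "\<exists>N. \<forall>k\<ge>N. norm (r k / sqrt (real k * L k) - 0) < \<epsilon>"
      unfolding eventually_sequentially .
  qed
qed

section \<open>Tail probabilities of stationary shifts and the Borel-Cantelli lemma\<close>

text \<open>A discrete layer-cake estimate: used under the integral with \<open>x\<close> the square
  of a function over a constant, it turns a sum of tail probabilities into a second moment.\<close>

lemma count_less_le:
  assumes "0 \<le> x"
  shows "(\<Sum>i<n. of_bool (real (Suc i) < x)) \<le> x"
proof (induction n)
  case (Suc n)
  show ?case
  proof (cases "real (Suc n) < x")
    case True
    have "(\<Sum>i<Suc n. of_bool (real (Suc i) < x) :: real) \<le> (\<Sum>i<Suc n. 1)"
      by (intro sum_mono) auto
    also have "\<dots> \<le> x" using True by simp
    finally show ?thesis .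
  qed (use Suc in simp)
qed (use assms in simp)

text \<open>No maximal ergodic theorem is needed: the \<open>i\<close>-th term is only compared with \<open>i + 1\<close>.\<close>

lemma (in prob_space) sum_prob_square_le:
  assumes Y: "L2_fun M Y" and T: "\<And>i. T i \<in> M \<rightarrow>\<^sub>M M" "\<And>i. distr M M (T i) = M" and "0 < c"
  shows "(\<Sum>i<n. prob {\<omega>\<in>space M. c * real (Suc i) < (Y (T i \<omega>))\<^sup>2}) \<le> (L2_norm M Y)\<^sup>2 / c"
proof -
  have [measurable]: "Y \<in> borel_measurable M" using Y by (simp add: L2_fun_def)
  let ?A = "\<lambda>i. {\<omega>\<in>space M. c * real (Suc i) < (Y \<omega>)\<^sup>2}"
  have "prob {\<omega>\<in>space M. c * real (Suc i) < (Y (T i \<omega>))\<^sup>2} = prob (?A i)" for i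
  proof -
    have "measure (distr M M (T i)) (?A i) = prob (T i -` ?A i \<inter> space M)"
      by (rule measure_distr) (use T in auto)
    also have "T i -` ?A i \<inter> space M = {\<omega>\<in>space M. c * real (Suc i) < (Y (T i \<omega>))\<^sup>2}"
      using measurable_space[OF T(1)] by auto
    finally show ?thesis by (simp add: T)
  qed
  then have "(\<Sum>i<n. prob {\<omega>\<in>space M. c * real (Suc i) < (Y (T i \<omega>))\<^sup>2}) = (\<Sum>i<n. \<integral>\<omega>. indicator (?A i) \<omega> \<partial>M)"
    by simp
  also have "\<dots> = (\<integral>\<omega>. (\<Sum>i<n. indicator (?A i) \<omega>) \<partial>M)"
    by (rule Bochner_Integration.integral_sum[symmetric]) (auto intro!: integrable_real_indicator simp: emeasure_eq_measure)
  also have "\<dots> \<le> (\<integral>\<omega>. (Y \<omega>)\<^sup>2 / c \<partial>M)"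
  proof (rule integral_mono)
    fix \<omega> assume "\<omega> \<in> space M"
    then have "(\<Sum>i<n. indicator (?A i) \<omega>) = (\<Sum>i<n. of_bool (real (Suc i) < (Y \<omega>)\<^sup>2 / c) :: real)"
      using \<open>0 < c\<close> by (intro sum.cong) (auto simp: indicator_def field_simps)
    also have "\<dots> \<le> (Y \<omega>)\<^sup>2 / c" using \<open>0 < c\<close> by (intro count_less_le) simp
    finally show "(\<Sum>i<n. indicator (?A i) \<omega>) \<le> (Y \<omega>)\<^sup>2 / c" .
  qed (use Y in \<open>auto intro!: Bochner_Integration.integrable_sum integrable_real_indicator simp: emeasure_eq_measure L2_fun_def\<close>)
  finally show ?thesis by (simp add: L2_norm_power2)
qed

text \<open>For each \<open>c\<close> the probabilities that the square exceeds
  \<open>c * (i + 1)\<close> sum to at most the second moment over \<open>c\<close>, so by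
  Borel-Cantelli only finitely many exceedances occur. The countably many levels
  \<open>c = 1 / (n + 1)\<close> suffice for the limit.\<close>

lemma (in prob_space) stationary_div_sqrt_tendsto_0:
  assumes Y: "L2_fun M Y" and T: "\<And>i. T i \<in> M \<rightarrow>\<^sub>M M" "\<And>i. distr M M (T i) = M"
  shows "AE \<omega> in M. (\<lambda>i. \<bar>Y (T i \<omega>)\<bar> / sqrt (real (Suc i))) \<longlonglongrightarrow> 0"
proof -
  have [measurable]: "Y \<in> borel_measurable M" "\<And>i. T i \<in> M \<rightarrow>\<^sub>M M" using Y T by (auto simp: L2_fun_def)
  let ?A = "\<lambda>c i. {\<omega>\<in>space M. c * real (Suc i) < (Y (T i \<omega>))\<^sup>2}"
  have "AE \<omega> in M. \<forall>n. \<forall>\<^sub>F i in sequentially. \<omega> \<in> space M - ?A (1 / real (Suc n)) i"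
    unfolding AE_all_countable
  proof
    fix n
    show "AE \<omega> in M. \<forall>\<^sub>F i in sequentially. \<omega> \<in> space M - ?A (1 / real (Suc n)) i"
    proof (rule borel_cantelli_AE1)
      show "summable (\<lambda>i. prob (?A (1 / real (Suc n)) i))"
        by (rule summableI_nonneg_bounded[OF _ sum_prob_square_le[OF Y T]]) auto
    qed (auto simp: emeasure_eq_measure)
  qed
  then show ?thesis
  proof eventually_elim
    case (elim \<omega>)
    show ?case
    proof (rule LIMSEQ_I)
      fix \<epsilon> :: real assume \<epsilon>: "0 < \<epsilon>"
      then obtain n where n: "1 / real (Suc n) < \<epsilon>\<^sup>2"
        using reals_Archimedean[of "\<epsilon>\<^sup>2"] by (auto simp: inverse_eq_divide)
      from elim[rule_format, of n] have "\<forall>\<^sub>F i in sequentially. norm (\<bar>Y (T i \<omega>)\<bar> / sqrt (real (Suc i)) - 0) < \<epsilon>"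
      proof eventually_elim
        case (elim i)
        have "(Y (T i \<omega>))\<^sup>2 \<le> 1 / real (Suc n) * real (Suc i)" using elim by (auto simp: not_less)
        also have "\<dots> < \<epsilon>\<^sup>2 * real (Suc i)" using n by (intro mult_strict_right_mono) auto
        finally have "\<bar>Y (T i \<omega>)\<bar> < \<epsilon> * sqrt (real (Suc i))"
          using real_sqrt_less_mono[of "(Y (T i \<omega>))\<^sup>2" "\<epsilon>\<^sup>2 * real (Suc i)"] \<epsilon> by (simp add: real_sqrt_mult)
        then show ?case by (simp add: pos_divide_less_eq del: of_nat_Suc)
      qed
      then show "\<exists>N. \<forall>i\<ge>N. norm (\<bar>Y (T i \<omega>)\<bar> / sqrt (real (Suc i)) - 0) < \<epsilon>"
        unfolding eventually_sequentially .
    qed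
  qed
qed

text \<open>All blocks of level \<open>j\<close> are governed by one event: at thresholds growing
  like \<open>i + 1\<close>, the union bound over infinitely many shifts costs a single second
  moment. Borel-Cantelli over \<open>j\<close> then gives the bound \<open>y_le\<close> of
  \<open>block_sum_bound\<close> on almost every path.\<close>

lemma (in prob_space) stationary_increments_AE_tendsto_0:
  fixes R :: "nat \<Rightarrow> 'a \<Rightarrow> real" and e L :: "nat \<Rightarrow> real"
  assumes \<theta>: "\<theta> \<in> M \<rightarrow>\<^sub>M M" "distr M M \<theta> = M"
    and R0: "\<And>\<omega>. R 0 \<omega> = 0"
    and R_shift: "\<And>m n \<omega>. \<omega> \<in> space M \<Longrightarrow> R (m + n) \<omega> - R m \<omega> = R n ((\<theta> ^^ m) \<omega>)"
    and R_L2: "\<And>n. L2_fun M (R n)"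
    and e: "\<And>j. 0 < e j"
    and summ: "summable (\<lambda>j. sqrt (e j) * ((1 / sqrt 2) ^ j * L2_norm M (R (2 ^ j))))"
    and L: "0 < c" "\<And>k. 0 < k \<Longrightarrow> c \<le> L k"
    and eL: "\<And>m k. 2 ^ m \<le> k \<Longrightarrow> (\<Sum>j\<le>m. 1 / e j) \<le> 2 * L k"
  shows "AE \<omega> in M. (\<lambda>k. R k \<omega> / sqrt (real k * L k)) \<longlonglongrightarrow> 0"
proof -
  have T1 [measurable]: "(\<theta> ^^ m) \<in> M \<rightarrow>\<^sub>M M" for m
    by (rule measurable_compose_n[OF \<theta>(1)])
  have T2: "distr M M (\<theta> ^^ m) = M" for m
  proof (induction m)
    case (Suc m)
    have "distr M M (\<theta> \<circ> (\<theta> ^^ m)) = distr (distr M M (\<theta> ^^ m)) M \<theta>"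
      by (rule distr_distr[symmetric]) (use \<theta> T1 in auto)
    then show ?case using Suc \<theta> by (simp add: comp_def)
  qed (simp add: id_def)
  have [measurable]: "R n \<in> borel_measurable M" for n using R_L2[of n] by (simp add: L2_fun_def)
  define N where "N j = sqrt (e j) * ((1 / sqrt 2) ^ j * L2_norm M (R (2 ^ j)))" for j
  \<comment> \<open>The geometric term keeps \<open>s j\<close> positive where \<open>N j\<close>
    vanishes, so that division by \<open>s j\<close> is safe, and it preserves summability.\<close>
  define s where "s j = N j + (1/2) ^ j" for j
  have N0: "0 \<le> N j" for j using e[of j] by (simp add: N_def)
  have s0: "0 < s j" for j using N0[of j] by (simp add: s_def add_nonneg_pos)
  have ss: "summable s"
    unfolding s_def by (intro summable_add summ[folded N_def] summable_geometric) simp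
  \<comment> \<open>With this threshold the squared norm of \<open>R (2 ^ j)\<close> over
    \<open>l j\<close> equals \<open>(N j)\<^sup>2 / s j\<close>, which is at most
    \<open>s j\<close>, hence summable.\<close>
  define l where "l j = 2 ^ j * (s j / e j)" for j
  have l0: "0 < l j" for j using s0[of j] e[of j] by (simp add: l_def)
  define y where "y \<omega> j i = \<bar>R (2 ^ j) ((\<theta> ^^ (i * 2 ^ j)) \<omega>)\<bar>" for \<omega> j i
  define A where "A j i = {\<omega>\<in>space M. l j * real (Suc i) < (R (2 ^ j) ((\<theta> ^^ (i * 2 ^ j)) \<omega>))\<^sup>2}" for j i
  have A [measurable]: "A j i \<in> sets M" for j i unfolding A_def by measurable
  have "prob (\<Union>i. A j i) \<le> s j" for j
  proof -
    have *: "(\<Sum>i<n. prob (A j i)) \<le> (L2_norm M (R (2 ^ j)))\<^sup>2 / l j" for n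
      unfolding A_def by (rule sum_prob_square_le[OF R_L2 T1 T2 l0])
    then have sA: "summable (\<lambda>i. prob (A j i))"
      by (intro summableI_nonneg_bounded) auto
    have "prob (\<Union>i. A j i) \<le> (\<Sum>i. prob (A j i))"
      using A sA by (intro finite_measure_subadditive_countably) auto
    also have "\<dots> \<le> (L2_norm M (R (2 ^ j)))\<^sup>2 / l j"
      using sA * by (intro suminf_le_const)
    also have "\<dots> = (N j)\<^sup>2 / s j"
    proof -
      have "((1 / sqrt 2) ^ j)\<^sup>2 = (((1 / sqrt 2))\<^sup>2) ^ j" by (simp only: power_mult[symmetric] mult.commute)
      also have "\<dots> = 1 / 2 ^ j" by (simp add: power_divide)
      finally have "(N j)\<^sup>2 = e j * (1 / 2 ^ j * (L2_norm M (R (2 ^ j)))\<^sup>2)"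
        unfolding N_def power_mult_distrib using e[of j] by simp
      then show ?thesis using e[of j] by (simp add: l_def)
    qed
    also have "\<dots> \<le> (s j)\<^sup>2 / s j"
      using N0[of j] s0[of j] by (intro divide_right_mono power_mono) (auto simp: s_def)
    finally show ?thesis using s0[of j] by (simp add: power2_eq_square)
  qed
  then have "summable (\<lambda>j. prob (\<Union>i. A j i))"
    by (intro summable_comparison_test[OF _ ss]) auto
  then have "AE \<omega> in M. \<forall>\<^sub>F j in sequentially. \<omega> \<in> space M - (\<Union>i. A j i)"
    by (intro borel_cantelli_AE1) (auto simp: emeasure_eq_measure)
  moreover have "AE \<omega> in M. \<forall>j. (\<lambda>i. y \<omega> j i / sqrt (real (Suc i))) \<longlonglongrightarrow> 0"
    unfolding AE_all_countable y_def
    by (intro allI stationary_div_sqrt_tendsto_0 R_L2 T1 T2)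
  ultimately show ?thesis using AE_space
  proof eventually_elim
    case (elim \<omega>)
    show ?case
    proof (rule block_sum_bound[where y = "y \<omega>" and s = s and e = e and L = L])
      show "\<bar>R (Suc i * 2 ^ j) \<omega> - R (i * 2 ^ j) \<omega>\<bar> \<le> y \<omega> j i" for j i
        using R_shift[OF elim(3), of "i * 2 ^ j" "2 ^ j"] by (simp add: y_def add.commute)
      show "\<forall>\<^sub>F j in sequentially. \<forall>i. y \<omega> j i \<le> sqrt (real (Suc i)) * sqrt (2 ^ j * (s j / e j))"
        using elim(1)
      proof eventually_elim
        case (elim j)
        show ?case
        proof
          fix i
          have "(R (2 ^ j) ((\<theta> ^^ (i * 2 ^ j)) \<omega>))\<^sup>2 \<le> real (Suc i) * l j"
            using elim by (auto simp: A_def not_less mult.commute)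
          then have "sqrt ((R (2 ^ j) ((\<theta> ^^ (i * 2 ^ j)) \<omega>))\<^sup>2) \<le> sqrt (real (Suc i) * l j)"
            by (rule real_sqrt_le_mono)
          then show "y \<omega> j i \<le> sqrt (real (Suc i)) * sqrt (2 ^ j * (s j / e j))"
            by (simp only: y_def l_def real_sqrt_mult real_sqrt_abs)
        qed
      qed
    qed (use elim R0 e s0 ss L eL in \<open>auto intro: less_imp_le\<close>)
  qed
qed

section \<open>Slowly varying weights on dyadic scales\<close>

lemma one_plus_power_ge:
  fixes x :: real assumes "x \<ge> 0"
  shows "1 + real n * x + real n * (real n - 1) / 2 * x\<^sup>2 \<le> (1 + x) ^ n"
proof (induction n)
  case (Suc n)
  have "1 + real (Suc n) * x + real (Suc n) * (real (Suc n) - 1) / 2 * x\<^sup>2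
      \<le> (1 + x) * (1 + real n * x + real n * (real n - 1) / 2 * x\<^sup>2)"
  proof -
    have "0 \<le> real n * (real n - 1) / 2 * x\<^sup>2 * x"
      using assms by (cases n) auto
    then show ?thesis by (simp add: field_simps power2_eq_square)
  qed
  also have "\<dots> \<le> (1 + x) * (1 + x) ^ n"
    using Suc assms by (intro mult_left_mono) auto
  finally show ?case by simp
qed simp

lemma slowly_varying_double_le:
  assumes pos: "\<And>x. 0 < x \<Longrightarrow> 0 < ell x" and slow: "slowly_varying ell" and "1 < c"
  shows "\<forall>\<^sub>F N in sequentially. ell (2 ^ Suc N) \<le> c * ell (2 ^ N)"
proof -
  have "((\<lambda>x. ell (2 * x) / ell x) \<longlongrightarrow> 1) at_top"
    using slow by (simp add: slowly_varying_def)
  then have "\<forall>\<^sub>F x in at_top. ell (2 * x) / ell x < c"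
    using \<open>1 < c\<close> by (rule order_tendstoD)
  moreover have "filterlim (\<lambda>N. 2 ^ N :: real) at_top sequentially"
    by (intro filterlim_at_infinity_imp_filterlim_at_top filterlim_realpow_sequentially_gt1) auto
  ultimately have "\<forall>\<^sub>F N in sequentially. ell (2 * 2 ^ N) / ell (2 ^ N) < c"
    by (rule eventually_compose_filterlim)
  then show ?thesis
  proof eventually_elim
    case (elim N)
    then show ?case using pos[of "2 ^ N"] by (simp add: divide_less_eq less_imp_le)
  qed
qed

text \<open>The constant 6/5 is small enough that 6/5 times \<open>1 / sqrt 2\<close> is below 1. It
  splits as 12/11 times 11/10: the linear factor grows by at most 12/11 once
  \<open>N \<ge> 10\<close>, and slow variation, with ratio 121/100, gives 11/10 for the square
  root.\<close>

lemma dyadic_weight_growth: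
  assumes pos: "\<And>x. 0 < x \<Longrightarrow> 0 < ell x" and slow: "slowly_varying ell"
  shows "\<forall>\<^sub>F N in sequentially.
    real (Suc N + 1) * sqrt (ell (2 ^ Suc N)) \<le> 6/5 * (real (N + 1) * sqrt (ell (2 ^ N)))"
proof -
  have "\<forall>\<^sub>F N in sequentially. ell (2 ^ Suc N) \<le> 121/100 * ell (2 ^ N)"
    by (rule slowly_varying_double_le) (use pos slow in auto)
  then show ?thesis
  using eventually_ge_at_top[of 10]
proof eventually_elim
  case (elim N)
  have "sqrt (ell (2 ^ Suc N)) \<le> sqrt ((11/10)\<^sup>2 * ell (2 ^ N))"
    using elim by (intro real_sqrt_le_mono) (simp add: power2_eq_square)
  also have "\<dots> = 11/10 * sqrt (ell (2 ^ N))"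
    by (simp only: real_sqrt_mult real_sqrt_abs)
  finally have *: "sqrt (ell (2 ^ Suc N)) \<le> 11/10 * sqrt (ell (2 ^ N))" .
  have "real (Suc N + 1) * sqrt (ell (2 ^ Suc N)) \<le> (12/11 * real (N + 1)) * (11/10 * sqrt (ell (2 ^ N)))"
    using elim(2) * pos[of "2^N"] pos[of "2^Suc N"] by (intro mult_mono) auto
  moreover have "(12/11 * x) * (11/10 * y) = 6/5 * (x * y)" for x y :: real by simp
  ultimately show ?case by (simp only:)
qed
qed

text \<open>The function \<Phi> of the overview, detached from the chain so that the dyadic
  summation becomes a statement about real sequences.\<close>

definition resolvent_bound :: "real \<Rightarrow> (nat \<Rightarrow> real) \<Rightarrow> real \<Rightarrow> real" where
  "resolvent_bound G a \<epsilon> = G + \<epsilon> * (\<Sum>k. a k / (1 + \<epsilon>) ^ Suc k)"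

lemma summable_linear_resolvent:
  assumes a: "\<And>k. 0 \<le> a k" "\<And>k. a k \<le> real k * G" and "0 < (\<epsilon>::real)"
  shows "summable (\<lambda>k. a k / (1 + \<epsilon>) ^ Suc k)"
proof (rule summable_comparison_test)
  let ?r = "inverse (1 + \<epsilon>)"
  have r: "norm ?r < 1" using \<open>0 < \<epsilon>\<close> by (simp add: field_simps)
  \<comment> \<open>\<open>diffs\<close> of the constant sequence 1 is \<open>Suc k\<close>: the
    majorant is the termwise derivative of the geometric series.\<close>
  have "summable (\<lambda>k. diffs (\<lambda>k. 1) k * ?r ^ k)"
    by (rule termdiff_converges[of _ 1]) (use r in \<open>auto intro: summable_geometric\<close>)
  then have s: "summable (\<lambda>k. \<bar>G\<bar> * (real (Suc k) * ?r ^ k))"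
    by (intro summable_mult) (simp add: diffs_def)
  then show "summable (\<lambda>k. \<bar>G\<bar> * (real (Suc k) * ?r ^ k))" .
  show "\<exists>N. \<forall>k\<ge>N. norm (a k / (1 + \<epsilon>) ^ Suc k) \<le> \<bar>G\<bar> * (real (Suc k) * ?r ^ k)"
  proof (intro exI allI impI)
    fix k
    have "a k / (1 + \<epsilon>) ^ Suc k \<le> (\<bar>G\<bar> * real (Suc k)) / (1 + \<epsilon>) ^ k"
    proof (rule frac_le)
      have "a k \<le> real k * \<bar>G\<bar>" using a(2)[of k] by (rule order.trans) (simp add: mult_left_mono)
      also have "\<dots> \<le> \<bar>G\<bar> * real (Suc k)" by (simp add: algebra_simps)
      finally show "a k \<le> \<bar>G\<bar> * real (Suc k)" .
    qed (use \<open>0 < \<epsilon>\<close> in auto)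
    then show "norm (a k / (1 + \<epsilon>) ^ Suc k) \<le> \<bar>G\<bar> * (real (Suc k) * ?r ^ k)"
      using a(1)[of k] \<open>0 < \<epsilon>\<close> by (simp add: power_inverse divide_inverse mult_ac)
  qed
qed

lemma resolvent_bound_nonneg:
  assumes a: "\<And>k. 0 \<le> a k" "\<And>k. a k \<le> real k * G" and "0 \<le> G" "0 < \<epsilon>"
  shows "0 \<le> resolvent_bound G a \<epsilon>"
  unfolding resolvent_bound_def
  using assms suminf_nonneg[OF summable_linear_resolvent[OF a \<open>0 < \<epsilon>\<close>]] by simp

text \<open>The series decreases in its argument while the prefactor at most doubles. Thus any
  \<epsilon> in a dyadic interval may be replaced by the left endpoint.\<close>

lemma resolvent_bound_le_double:
  assumes a: "\<And>k. 0 \<le> a k" "\<And>k. a k \<le> real k * G" and "0 \<le> G" and \<delta>: "0 < \<delta>" "\<delta> \<le> \<epsilon>" "\<epsilon> \<le> 2 * \<delta>"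
  shows "resolvent_bound G a \<epsilon> \<le> 2 * resolvent_bound G a \<delta>"
proof -
  have \<epsilon>: "0 < \<epsilon>" using \<delta> by simp
  note s = summable_linear_resolvent[OF a]
  have "(\<Sum>k. a k / (1 + \<epsilon>) ^ Suc k) \<le> (\<Sum>k. a k / (1 + \<delta>) ^ Suc k)"
    using \<delta> a by (intro suminf_le s \<epsilon> divide_left_mono power_mono mult_pos_pos) auto
  then have "\<epsilon> * (\<Sum>k. a k / (1 + \<epsilon>) ^ Suc k) \<le> (2 * \<delta>) * (\<Sum>k. a k / (1 + \<delta>) ^ Suc k)"
    using \<delta> a \<epsilon> by (intro mult_mono suminf_nonneg s) auto
  then show ?thesis using \<open>0 \<le> G\<close> by (simp add: resolvent_bound_def)
qed

lemma sum_lessThan_add: "(\<Sum>i<a + b. f i) = (\<Sum>i<a. f i) + (\<Sum>i<b. f (a + i))"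
  for f :: "nat \<Rightarrow> 'a::comm_monoid_add"
  by (induction b) (auto simp: add.assoc)

lemma inverse_sqrt_two_less: "1 / sqrt 2 < 5 / 6"
proof -
  have "6 / 5 < sqrt 2" by (rule real_less_rsqrt) (simp add: power2_eq_square)
  then show ?thesis by (simp add: pos_divide_less_eq)
qed

lemma sum_power_sqrt2_le: "(\<Sum>N\<le>m. sqrt 2 ^ N) \<le> 4 * sqrt 2 ^ m"
proof (induction m)
  case (Suc m)
  \<comment> \<open>The induction step needs \<open>4 + sqrt 2 \<le> 4 * sqrt 2\<close>, which is
    this inequality.\<close>
  have "4 / 3 \<le> sqrt 2" by (rule real_le_rsqrt) (simp add: power2_eq_square)
  then have "4 * sqrt 2 ^ m \<le> (3 * sqrt 2) * sqrt 2 ^ m"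
    by (intro mult_right_mono) auto
  moreover have "(\<Sum>N\<le>Suc m. sqrt 2 ^ N) = (\<Sum>N\<le>m. sqrt 2 ^ N) + sqrt 2 * sqrt 2 ^ m" by simp
  moreover have "4 * sqrt 2 ^ Suc m = 4 * sqrt 2 * sqrt 2 ^ m" by simp
  ultimately show ?case using Suc by linarith
qed simp

text \<open>The two regimes \<open>2\<^sup>N \<le> n\<close> and \<open>2\<^sup>N > n\<close> both give geometric sums dominated by the term
  at \<open>2\<^sup>N \<approx> n\<close>.\<close>

lemma dyadic_kernel_bound:
  fixes p :: "nat \<Rightarrow> real"
  assumes p: "\<And>N. 0 \<le> p N" "incseq p" "\<And>N. N \<ge> N0 \<Longrightarrow> p (Suc N) \<le> 6/5 * p N"
    and n: "2 ^ m \<le> n" and m: "N0 \<le> m"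
  shows "(\<Sum>N=N0..<N1. p N * (1 / sqrt 2) ^ N * (1/2) ^ N / (1 + (1/2) ^ N) ^ Suc n)
    \<le> 9 * (p m * (1 / sqrt 2) ^ m * (1/2) ^ m)"
proof -
  let ?s = "1 / sqrt 2 :: real"
  let ?t = "\<lambda>N. p N * ?s ^ N * (1/2) ^ N / (1 + (1/2) ^ N) ^ Suc n"
  define q where "q = p m * ?s ^ m * (1/2) ^ m"
  have q0: "q \<ge> 0" using p(1) by (simp add: q_def)
  have t0: "?t N \<ge> 0" for N using p(1)[of N] by simp
  have n0: "n > 0" using n by (metis gr0I not_less zero_less_numeral zero_less_power)
  have s2: "?s ^ N * sqrt 2 ^ N = 1" for N by (simp add: power_mult_distrib[symmetric])
  have ss: "sqrt 2 ^ N * sqrt 2 ^ N = 2 ^ N" for N by (simp add: power_mult_distrib[symmetric])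
  \<comment> \<open>For \<open>N \<le> m\<close> monotonicity replaces \<open>p N\<close> by
    \<open>p m\<close>, and the quadratic Bernoulli term bounds the denominator; what remains is
    geometric with ratio \<open>sqrt 2\<close>, dominated by its last term.\<close>
  have low: "?t N \<le> 2 * p m / (real n)\<^sup>2 * sqrt 2 ^ N" if "N \<le> m" for N
  proof -
    let ?x = "(1/2) ^ N :: real"
    have "(real n)\<^sup>2 / 2 * ?x\<^sup>2 \<le> 1 + real (Suc n) * ?x + real (Suc n) * (real (Suc n) - 1) / 2 * ?x\<^sup>2"
    proof -
      have "(real n)\<^sup>2 / 2 * ?x\<^sup>2 \<le> real (Suc n) * (real (Suc n) - 1) / 2 * ?x\<^sup>2"
        by (intro mult_right_mono) (auto simp: power2_eq_square algebra_simps)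
      moreover have "0 \<le> real (Suc n) * ?x" by simp
      ultimately show ?thesis by linarith
    qed
    also have "\<dots> \<le> (1 + ?x) ^ Suc n" by (rule one_plus_power_ge) simp
    finally have "?t N \<le> p m * ?s ^ N * ?x / ((real n)\<^sup>2 / 2 * ?x\<^sup>2)"
    proof (intro frac_le)
      show "p N * ?s ^ N * ?x \<le> p m * ?s ^ N * ?x"
        using incseqD[OF p(2) that] by (intro mult_right_mono) auto
    qed (use p(1)[of m] n0 in auto)
    also have "\<dots> = 2 * p m / (real n)\<^sup>2 * (?s ^ N * 2 ^ N)"
      using n0 by (simp add: field_simps power2_eq_square power_one_over)
    also have "?s ^ N * 2 ^ N = sqrt 2 ^ N"
      using s2[of N] ss[of N, symmetric] by (metis mult.assoc mult_1)
    finally show ?thesis .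
  qed
  have sumlow: "(\<Sum>N\<le>m. ?t N) \<le> 8 * q"
  proof -
    have "(\<Sum>N\<le>m. ?t N) \<le> (\<Sum>N\<le>m. 2 * p m / (real n)\<^sup>2 * sqrt 2 ^ N)"
      by (intro sum_mono low) simp
    also have "\<dots> = 2 * p m / (real n)\<^sup>2 * (\<Sum>N\<le>m. sqrt 2 ^ N)"
      by (simp add: sum_distrib_left)
    also have "\<dots> \<le> 2 * p m / (2 ^ m)\<^sup>2 * (4 * sqrt 2 ^ m)"
    proof (intro mult_mono sum_power_sqrt2_le divide_left_mono power_mono)
      show "2 ^ m \<le> real n" using n by (metis of_nat_le_iff of_nat_numeral of_nat_power)
    qed (use p(1)[of m] n0 in \<open>auto intro!: sum_nonneg divide_nonneg_nonneg\<close>)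
    also have "\<dots> = 8 * (p m * (sqrt 2 ^ m / 2 ^ m) * (1/2) ^ m)"
      by (simp add: field_simps power2_eq_square power_one_over)
    also have "sqrt 2 ^ m / 2 ^ m = ?s ^ m"
      using s2[of m] ss[of m, symmetric] by (simp add: field_simps power_one_over)
    finally show ?thesis by (simp add: q_def)
  qed
  have high: "?t (Suc m + i) \<le> q * (1/2) ^ Suc i" for i
  proof -
    \<comment> \<open>Per step \<open>p\<close> grows by at most 6/5 and \<open>?s\<close>
      contributes at most 5/6, so these two cancel and \<open>(1/2) ^ N\<close> is left to supply
      the decay.\<close>
    have *: "p (m + i) * ?s ^ (m + i) * (1/2) ^ (m + i) \<le> q * (1/2) ^ i" for i
    proof (induction i)
      case (Suc i)
      have b: "?s \<le> 5/6" using inverse_sqrt_two_less by simp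
      have "p (m + Suc i) * ?s ^ (m + Suc i) * (1/2) ^ (m + Suc i)
          = p (Suc (m + i)) * (?s * ?s ^ (m + i)) * (1/2 * (1/2) ^ (m + i))" by simp
      also have "\<dots> \<le> (6/5 * p (m + i)) * (5/6 * ?s ^ (m + i)) * (1/2 * (1/2) ^ (m + i))"
        using m b p(1)[of "m+i"] by (intro mult_right_mono mult_mono p(3)) auto
      also have "\<dots> = 1/2 * (p (m + i) * ?s ^ (m + i) * (1/2) ^ (m + i))" by simp
      also have "\<dots> \<le> 1/2 * (q * (1/2) ^ i)" using Suc by (intro mult_left_mono) auto
      finally show ?case by simp
    qed (simp add: q_def)
    have "?t (Suc m + i) \<le> p (Suc m + i) * ?s ^ (Suc m + i) * (1/2) ^ (Suc m + i) / 1"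
    proof (rule divide_left_mono)
      show "1 \<le> (1 + (1/2) ^ (Suc m + i) :: real) ^ Suc n" by (rule one_le_power) simp
      then show "0 < (1 + (1/2) ^ (Suc m + i) :: real) ^ Suc n * 1" by linarith
    qed (use p(1)[of "Suc m + i"] in simp)
    also have "\<dots> \<le> q * (1/2) ^ Suc i" using *[of "Suc i"] by simp
    finally show ?thesis .
  qed
  have "(\<Sum>N=N0..<N1. ?t N) \<le> (\<Sum>N<Suc m + N1. ?t N)"
    by (intro sum_mono2 t0) auto
  also have "\<dots> = (\<Sum>N\<le>m. ?t N) + (\<Sum>i<N1. ?t (Suc m + i))"
    unfolding sum_lessThan_add lessThan_Suc_atMost ..
  also have "(\<Sum>i<N1. ?t (Suc m + i)) \<le> (\<Sum>i<N1. q * (1/2) ^ Suc i)"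
    by (intro sum_mono high)
  also have "\<dots> \<le> q"
  proof -
    have "(\<Sum>i<N1. (1/2) ^ Suc i) \<le> (1::real)"
      using sum_le_suminf[OF sums_summable[OF power_half_series], of "{..<N1}"]
        sums_unique[OF power_half_series] by simp
    from mult_left_mono[OF this q0] show ?thesis by (simp add: sum_distrib_left)
  qed
  finally show ?thesis using sumlow by (simp add: q_def)
qed

text \<open>Expanding \<open>resolvent_bound\<close> gives a series with \<open>G\<close>, which
  converges by the ratio test, and a double series in \<open>N\<close> and \<open>k\<close>. Summing
  the latter over \<open>N\<close> first, \<open>dyadic_kernel_bound\<close> makes the coefficient
  of \<open>a k\<close> a multiple of the weight in the hypothesis for
  \<open>k \<ge> 2 ^ N0\<close>; the finitely many smaller \<open>k\<close> need only finite
  coefficients.\<close>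

lemma dyadic_resolvent_summable:
  fixes G :: real
  assumes pos: "\<And>x. 0 < x \<Longrightarrow> 0 < ell x" and mono: "mono_on {0<..} ell"
    and slow: "slowly_varying ell" and G: "0 \<le> G"
    and a: "\<And>k. 0 \<le> a k" "\<And>k. a k \<le> real k * G"
    and series: "summable (\<lambda>m. let n = Suc m in
      real n powr (- 3 / 2) * sqrt (ell (real n)) * ln (real n) * a n)"
  shows "summable (\<lambda>N. real (N + 1) * sqrt (ell (2 ^ N)) * (1 / sqrt 2) ^ N * resolvent_bound G a ((1/2) ^ N))"
proof -
  let ?s = "1 / sqrt 2 :: real"
  define p where "p N = real (N + 1) * sqrt (ell (2 ^ N))" for N
  define w where "w n = real n powr (- 3 / 2) * sqrt (ell (real n)) * ln (real n) * a n" for n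
  have p0: "0 \<le> p N" for N using pos[of "2^N"] by (simp add: p_def)
  have inc: "incseq p"
    unfolding p_def
  proof (intro incseq_SucI mult_mono)
    fix N show "sqrt (ell (2 ^ N)) \<le> sqrt (ell (2 ^ Suc N))"
      using mono_onD[OF mono, of "2^N" "2^Suc N"] by simp
  qed (use pos in \<open>auto intro: less_imp_le\<close>)
  \<comment> \<open>\<open>N0 \<ge> 1\<close> forces \<open>m \<ge> 1\<close> below, where
    \<open>m + 1\<close> has to be at most a multiple of \<open>ln n\<close>; at
    \<open>n = 1\<close> the logarithm vanishes.\<close>
  obtain N0 where N0: "\<And>N. N \<ge> N0 \<Longrightarrow> p (Suc N) \<le> 6/5 * p N" "N0 \<ge> 1"
  proof -
    from dyadic_weight_growth[OF pos slow] obtain K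
      where "\<And>N. N \<ge> K \<Longrightarrow> p (Suc N) \<le> 6/5 * p N"
      unfolding p_def eventually_sequentially by auto
    then show ?thesis by (intro that[of "max 1 K"]) auto
  qed
  have sG: "summable (\<lambda>N. p N * ?s ^ N * G)"
  proof (rule summable_mult2, rule summable_ratio_test)
    show "6/5 * ?s < 1"
      using inverse_sqrt_two_less by linarith
    fix N assume "N \<ge> N0"
    then have "p (Suc N) * (?s * ?s ^ N) \<le> (6/5 * p N) * (?s * ?s ^ N)"
      by (intro mult_right_mono N0) auto
    then show "norm (p (Suc N) * ?s ^ Suc N) \<le> 6/5 * ?s * norm (p N * ?s ^ N)"
      using p0[of N] p0[of "Suc N"] by (simp add: abs_mult)
  qed
  define t where "t N k = p N * ?s ^ N * (1/2) ^ N / (1 + (1/2) ^ N) ^ Suc k * a k" for N k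
  have st: "summable (t N)" for N
    using summable_mult[OF summable_linear_resolvent[OF a, of "(1/2)^N"], of "p N * ?s ^ N * (1/2) ^ N"]
    by (simp add: t_def[abs_def])
  have tk: "(\<Sum>k. t N k) = p N * ?s ^ N * ((1/2) ^ N * (\<Sum>k. a k / (1 + (1/2)^N) ^ Suc k))" for N
    using suminf_mult[OF summable_linear_resolvent[OF a, of "(1/2)^N"], of "p N * ?s ^ N * (1/2) ^ N"]
    by (simp add: t_def mult.assoc)
  \<comment> \<open>Truncating in \<open>N\<close> leaves a finite sum to exchange with the series
    over \<open>k\<close>; the bounds on \<open>v\<close> have to be uniform in
    \<open>N1\<close>.\<close>
  define v where "v N1 k = (\<Sum>N=N0..<N1. t N k)" for N1 k
  have v0: "0 \<le> v N1 k" for N1 k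
    unfolding v_def t_def using p0 a by (intro sum_nonneg mult_nonneg_nonneg divide_nonneg_nonneg) auto
  have bound: "v N1 n \<le> 81 * w n" if n: "n \<ge> 2 ^ N0" for N1 n
  proof -
    have n0: "n > 0" using n by (metis gr0I not_less zero_less_numeral zero_less_power)
    obtain m where m: "2 ^ m \<le> n" "n < 2 ^ Suc m"
      using ex_power_ivl1[of 2 n] n0 by auto
    have mN: "N0 \<le> m"
    proof (rule ccontr)
      assume "\<not> N0 \<le> m"
      then have "2 ^ Suc m \<le> (2::nat) ^ N0" by (intro power_increasing) auto
      with m n show False by simp
    qed
    have mr: "2 ^ m \<le> real n" "real n \<le> 2 * 2 ^ m"
      using of_nat_mono[OF m(1), where 'a=real] of_nat_mono[OF less_imp_le[OF m(2)], where 'a=real] by auto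
    have "v N1 n = (\<Sum>N=N0..<N1. p N * ?s ^ N * (1/2) ^ N / (1 + (1/2) ^ N) ^ Suc n) * a n"
      by (simp add: v_def t_def sum_distrib_right)
    also have "\<dots> \<le> (9 * (p m * ?s ^ m * (1/2) ^ m)) * a n"
      by (intro mult_right_mono dyadic_kernel_bound p0 inc N0 m mN a)
    \<comment> \<open>One factor 3 comes from \<open>m + 1 \<le> 2 * m\<close> and
      \<open>2/3 \<le> ln 2\<close>, the other from \<open>n \<le> 2 * 2 ^ m\<close>, which costs
      \<open>2 powr (3/2) \<le> 3\<close>.\<close>
    also have "\<dots> \<le> (9 * ((3 * ln (real n) * sqrt (ell (real n))) * (3 * real n powr (-3/2)))) * a n"
    proof -
      have "real (m + 1) \<le> 3 * ln (real n)"
      proof -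
        have "real m * ln 2 = ln (2 ^ m)" by (simp add: ln_realpow)
        also have "\<dots> \<le> ln (real n)" using mr by (intro ln_mono) auto
        finally have "real m * ln 2 \<le> ln (real n)" .
        moreover have "2/3 \<le> ln (2::real)" using ln2_ge_two_thirds .
        ultimately have "real m * (2/3) \<le> ln (real n)"
          by (meson mult_left_mono of_nat_0_le_iff order_trans)
        then show ?thesis using mN N0(2) by simp
      qed
      moreover have "sqrt (ell (2 ^ m)) \<le> sqrt (ell (real n))"
        using mono_onD[OF mono, of "2^m" "real n"] mr n0 by simp
      ultimately have pm: "p m \<le> 3 * ln (real n) * sqrt (ell (real n))"
        unfolding p_def using pos[of "2^m"] pos[of "real n"] n0 by (intro mult_mono) auto
      have "?s ^ m * (1/2) ^ m = (2 ^ m) powr (-3/2)"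
      proof -
        have "?s * (1/2) = 2 powr (-1/2) * 2 powr (-1)"
          by (simp add: powr_minus_divide powr_half_sqrt)
        also have "\<dots> = 2 powr (-3/2)"
          by (simp only: powr_add[symmetric]) simp
        finally have "?s ^ m * (1/2) ^ m = (2 powr (-3/2)) ^ m"
          by (simp only: power_mult_distrib[symmetric])
        also have "\<dots> = 2 powr (real m * (-3/2))" by (rule powr_power) simp
        also have "\<dots> = (2 powr real m) powr (-3/2)" by (rule powr_powr[symmetric])
        also have "\<dots> = (2 ^ m) powr (-3/2)" by (simp only: powr_realpow zero_less_numeral)
        finally show ?thesis .
      qed
      also have "\<dots> \<le> (real n / 2) powr (-3/2)"
        using mr n0 by (intro powr_mono2') auto
      also have "\<dots> = 2 powr (3/2) * real n powr (-3/2)"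
        by (simp add: powr_divide powr_minus_divide)
      also have "\<dots> \<le> 3 * real n powr (-3/2)"
      proof (rule mult_right_mono)
        have "2 powr (3/2) = 2 * sqrt (2::real)"
          using powr_add[of "2::real" 1 "1/2"] by (simp add: powr_half_sqrt)
        also have "\<dots> \<le> 3" using real_le_lsqrt[of "3/2" 2] by (simp add: power2_eq_square)
        finally show "2 powr (3/2) \<le> (3::real)" .
      qed simp
      finally have sm: "?s ^ m * (1/2) ^ m \<le> 3 * real n powr (-3/2)" .
      have "p m * (?s ^ m * (1/2) ^ m) \<le> (3 * ln (real n) * sqrt (ell (real n))) * (3 * real n powr (-3/2))"
        using order.trans[OF p0[of m] pm] by (intro mult_mono[OF pm sm]) auto
      then show ?thesis using a by (intro mult_right_mono) (simp_all add: mult_ac)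
    qed
    also have "\<dots> = 81 * w n" by (simp add: w_def)
    finally show ?thesis .
  qed
  \<comment> \<open>A majorant of all \<open>v N1\<close>. Below \<open>2 ^ N0\<close> the weight in
    the hypothesis cannot be used, so the full series in \<open>N\<close> serves there; changing
    finitely many terms does not affect summability in \<open>n\<close>.\<close>
  define z where "z n = (if n < 2 ^ N0 then \<Sum>N. t (N + N0) n else 81 * w n)" for n
  have sz: "summable z"
  proof -
    have "summable w"
      using series unfolding w_def[abs_def] Let_def by (subst summable_Suc_iff[symmetric])
    then have "summable (\<lambda>n. 81 * w n)" by (rule summable_mult)
    moreover have "\<forall>\<^sub>F n in sequentially. z n = 81 * w n"
      using eventually_ge_at_top[of "2 ^ N0"] by eventually_elim (simp add: z_def)
    ultimately show ?thesis by (subst summable_cong)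
  qed
  have vz: "v N1 n \<le> z n" for N1 n
  proof (cases "n < 2 ^ N0")
    case True
    have t0: "0 \<le> t N k" for N k
      unfolding t_def using p0 a by (intro mult_nonneg_nonneg divide_nonneg_nonneg) auto
    have "summable (\<lambda>N. t N n)"
    proof (rule summable_comparison_test)
      show "summable (\<lambda>N. p N * ?s ^ N * (real n * G))"
        using summable_mult2[OF sG, of "real n"] by (simp add: mult_ac)
      show "\<exists>N. \<forall>k\<ge>N. norm (t k n) \<le> p k * ?s ^ k * (real n * G)"
      proof (intro exI allI impI)
        fix k
        have "(1/2) ^ k / (1 + (1/2) ^ k) ^ Suc n \<le> 1 / (1::real)"
          by (rule frac_le) (simp_all add: power_le_one one_le_power del: power_Suc)
        then have "p k * ?s ^ k * ((1/2) ^ k / (1 + (1/2) ^ k) ^ Suc n) * a n \<le> p k * ?s ^ k * 1 * (real n * G)"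
          using p0[of k] a G by (intro mult_mono) (auto intro!: mult_nonneg_nonneg divide_nonneg_nonneg)
        then show "norm (t k n) \<le> p k * ?s ^ k * (real n * G)"
          using t0[of k n] by (simp add: t_def)
      qed
    qed
    then have s: "summable (\<lambda>N. t (N + N0) n)" by (rule summable_ignore_initial_segment)
    have "v N1 n = (\<Sum>N<N1 - N0. t (N + N0) n)"
      unfolding v_def by (rule sum.reindex_bij_witness[of _ "\<lambda>N. N + N0" "\<lambda>N. N - N0"]) auto
    also have "\<dots> \<le> (\<Sum>N. t (N + N0) n)"
      by (rule sum_le_suminf[OF s]) (auto simp: t0)
    finally show ?thesis using True by (simp add: z_def)
  qed (use bound in \<open>simp add: z_def\<close>)
  have "summable (\<lambda>N. \<Sum>k. t N k)"
  proof -
    have "summable (\<lambda>N. \<Sum>k. t (N + N0) k)"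
    proof (rule summableI_nonneg_bounded)
      fix N
      have "0 \<le> t N k" for N k
        unfolding t_def using p0 a by (intro mult_nonneg_nonneg divide_nonneg_nonneg) auto
      then show "0 \<le> (\<Sum>k. t (N + N0) k)" by (intro suminf_nonneg st)
      have "(\<Sum>i<N. \<Sum>k. t (i + N0) k) = (\<Sum>k. \<Sum>i<N. t (i + N0) k)"
        by (rule suminf_sum[symmetric]) (rule st)
      also have "\<dots> = (\<Sum>k. v (N + N0) k)"
        unfolding v_def
        by (intro suminf_cong sum.reindex_bij_witness[of _ "\<lambda>N. N - N0" "\<lambda>N. N + N0"]) auto
      also have "\<dots> \<le> (\<Sum>k. z k)"
        by (intro suminf_le vz sz) (auto simp: v_def intro!: summable_sum st)
      finally show "(\<Sum>i<N. \<Sum>k. t (i + N0) k) \<le> (\<Sum>k. z k)" .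
    qed
    then show ?thesis by (rule iffD1[OF summable_iff_shift[of "\<lambda>N. \<Sum>k. t N k" N0]])
  qed
  from summable_add[OF sG this] show ?thesis
    unfolding tk by (simp add: p_def resolvent_bound_def algebra_simps)
qed

section \<open>Comparison with \<open>ell_star\<close>, dyadic intervals and weighted tails\<close>

lemma ell_star_lower:
  assumes pos: "\<And>x. 0 < x \<Longrightarrow> 0 < ell x" and "0 < k"
  shows "1 / ell 1 \<le> ell_star ell k"
proof -
  have "(\<Sum>j\<in>{1}. 1 / (real j * ell (real j))) \<le> ell_star ell k"
    unfolding ell_star_def by (rule sum_mono2) (use assms in \<open>auto simp: less_imp_le\<close>)
  then show ?thesis by simp
qed

text \<open>Cauchy condensation: the \<open>2 ^ m\<close> indices in the block from
  \<open>2 ^ m + 1\<close> to \<open>2 ^ Suc m\<close> each contribute at least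
  \<open>1 / (2 ^ Suc m * ell (2 ^ Suc m))\<close> since \<open>ell\<close> is nondecreasing, in
  total half of \<open>1 / ell (2 ^ Suc m)\<close>.\<close>

lemma sum_dyadic_le_ell_star:
  assumes pos: "\<And>x. 0 < x \<Longrightarrow> 0 < ell x" and mono: "mono_on {0<..} ell" and "2 ^ m \<le> k"
  shows "(\<Sum>j\<le>m. 1 / ell (2 ^ j)) \<le> 2 * ell_star ell k"
proof -
  let ?f = "\<lambda>i. 1 / (real i * ell (real i))"
  have f0: "0 \<le> ?f i" for i using pos[of "real i"] by (cases "i = 0") auto
  have "(\<Sum>j\<le>m. 1 / ell (2 ^ j)) \<le> 2 * (\<Sum>i=1..2 ^ m. ?f i)"
  proof (induction m)
    case (Suc m)
    have "1 / ell (2 ^ Suc m) = 2 * (\<Sum>i\<in>{Suc (2 ^ m)..2 ^ Suc m}. 1 / (2 ^ Suc m * ell (2 ^ Suc m)))"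
      by simp
    also have "\<dots> \<le> 2 * (\<Sum>i\<in>{Suc (2 ^ m)..2 ^ Suc m}. ?f i)"
    proof (intro mult_left_mono sum_mono)
      fix i assume i: "i \<in> {Suc (2 ^ m)..2 ^ Suc m}"
      then have i0: "0 < i" "real i \<le> 2 ^ Suc m"
        using of_nat_mono[of i "2 ^ Suc m", where 'a=real] by auto
      have "ell (real i) \<le> ell (2 ^ Suc m)" using i0 by (intro mono_onD[OF mono]) auto
      then show "1 / (2 ^ Suc m * ell (2 ^ Suc m)) \<le> ?f i"
        using i0 pos[of "real i"] pos[of "2 ^ Suc m"]
        by (intro divide_left_mono mult_mono mult_pos_pos) auto
    qed simp
    moreover have "(\<Sum>i=1..2 ^ Suc m. ?f i) = (\<Sum>i=1..2 ^ m. ?f i) + (\<Sum>i\<in>{Suc (2 ^ m)..2 ^ Suc m}. ?f i)"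
      using sum.ub_add_nat[of 1 "2 ^ m" ?f "2 ^ m"] by (simp add: mult_2)
    ultimately show ?case using Suc by simp
  qed (use pos[of 1] in \<open>simp add: divide_right_mono\<close>)
  also have "\<dots> \<le> 2 * ell_star ell k"
    unfolding ell_star_def using assms(3) f0 by (intro mult_left_mono sum_mono2) auto
  finally show ?thesis .
qed

lemma dyadic_bracket:
  fixes \<epsilon> :: real
  assumes "0 < \<epsilon>" "\<epsilon> \<le> 1"
  obtains N where "(1/2) ^ Suc N < \<epsilon>" "\<epsilon> \<le> (1/2) ^ N"
proof -
  obtain n where n: "(1/2) ^ n < \<epsilon>" using real_arch_pow_inv[of \<epsilon> "1/2"] assms by auto
  define m where "m = (LEAST n. (1/2) ^ n < \<epsilon>)"
  have m: "(1/2) ^ m < \<epsilon>" unfolding m_def by (rule LeastI[of _ n]) (rule n)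
  then have "m \<noteq> 0" using assms by (intro notI) simp
  then obtain N where N: "m = Suc N" by (cases m) auto
  then have "\<not> (1/2) ^ N < \<epsilon>" using not_less_Least[of N "\<lambda>n. (1/2) ^ n < \<epsilon>"] by (simp add: m_def)
  then show ?thesis using m N by (intro that[of N]) auto
qed

text \<open>After exchanging the sums, \<open>c k\<close> is multiplied by the sum of the
  \<open>k + 1\<close> weights \<open>L N\<close> with \<open>N \<le> k\<close>, each at most
  \<open>L k\<close>. Tails are written with a cut-off over all \<open>k\<close>, so that the
  exchange needs no index shift.\<close>

lemma weighted_tail_summable:
  fixes L c :: "nat \<Rightarrow> real"
  assumes L: "incseq L" "0 < L 0" and c: "\<And>k. 0 \<le> c k"
    and s: "summable (\<lambda>k. real (k + 1) * L k * c k)"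
  shows "summable c" and "summable (\<lambda>N. L N * (\<Sum>k. if N \<le> k then c k else 0))"
proof -
  have L0: "L 0 \<le> L k" for k using incseqD[OF L(1), of 0 k] by simp
  have L_pos: "0 < L k" for k using L0[of k] L(2) by simp
  have "c k \<le> 1 / L 0 * (real (k + 1) * L k * c k)" for k
  proof -
    have "L 0 * c k \<le> real (k + 1) * L k * c k"
      using mult_mono[of 1 "real (k + 1)" "L 0" "L k"] L0[of k] L(2) c[of k] by (intro mult_right_mono) auto
    then show ?thesis using L(2) by (simp add: field_simps)
  qed
  then show sc: "summable c"
    by (intro summable_comparison_test[OF _ summable_mult[OF s, of "1 / L 0"]]) (use c in auto)
  have sf: "summable (\<lambda>k. if N \<le> k then c k else 0)" for N
    by (intro summable_comparison_test[OF _ sc]) (use c in auto)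
  show "summable (\<lambda>N. L N * (\<Sum>k. if N \<le> k then c k else 0))"
  proof (rule summableI_nonneg_bounded)
    fix n
    show "0 \<le> L n * (\<Sum>k. if n \<le> k then c k else 0)"
      using L_pos[of n] c by (intro mult_nonneg_nonneg suminf_nonneg sf) auto
    have "(\<Sum>N<n. L N * (\<Sum>k. if N \<le> k then c k else 0)) = (\<Sum>N<n. \<Sum>k. L N * (if N \<le> k then c k else 0))"
      by (intro sum.cong refl suminf_mult[symmetric] sf)
    also have "\<dots> = (\<Sum>k. \<Sum>N<n. L N * (if N \<le> k then c k else 0))"
      by (intro suminf_sum[symmetric] summable_mult sf)
    also have "\<dots> \<le> (\<Sum>k. real (k + 1) * L k * c k)"
    proof (intro suminf_le summable_sum summable_mult sf s)
      fix k
      have "(\<Sum>N<n. L N * (if N \<le> k then c k else 0)) = (\<Sum>N\<in>{..<n} \<inter> {..k}. L N * c k)"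
        by (subst sum.inter_restrict) (auto intro!: sum.cong)
      also have "\<dots> \<le> (\<Sum>N\<le>k. L N * c k)"
        using L_pos c by (intro sum_mono2) (auto intro!: mult_nonneg_nonneg simp: less_imp_le)
      also have "\<dots> \<le> (\<Sum>N\<le>k. L k * c k)"
        using c by (intro sum_mono mult_right_mono incseqD[OF L(1)]) auto
      also have "\<dots> = real (k + 1) * L k * c k" by simp
      finally show "(\<Sum>N<n. L N * (if N \<le> k then c k else 0)) \<le> real (k + 1) * L k * c k" .
    qed
    finally show "(\<Sum>N<n. L N * (\<Sum>k. if N \<le> k then c k else 0)) \<le> (\<Sum>k. real (k + 1) * L k * c k)" .
  qed
qed

section \<open>Markov chains\<close>

context ergodic_markov_chain
begin

lemma sets_stationary [measurable_cong]: "sets \<pi> = sets S"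
  using W_marginal[of 0] by (metis sets_distr)

lemma prob_space_stationary: "prob_space \<pi>"
  using prob_space_distr[OF W_measurable[of 0]] by (simp add: W_marginal)

lemma W_measurable' [measurable]: "W k \<in> M \<rightarrow>\<^sub>M S"
  by (rule W_measurable)

lemma kernel_measurable [measurable]: "Q \<in> S \<rightarrow>\<^sub>M subprob_algebra S"
  by (rule measurable_prob_algebraD[OF Q_kernel])

lemma kernel_prob_space: "w \<in> space S \<Longrightarrow> prob_space (Q w)"
  using measurable_space[OF Q_kernel] by (auto simp: space_prob_algebra)

lemma kernel_sets: "w \<in> space S \<Longrightarrow> sets (Q w) = sets S"
  using measurable_space[OF Q_kernel] by (auto simp: space_prob_algebra)

lemma transition_op_measurable [measurable]:
  assumes [measurable]: "f \<in> borel_measurable S"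
  shows "transition_op Q f \<in> borel_measurable S"
  unfolding transition_op_def[abs_def]
  by (rule measurable_compose[OF kernel_measurable]) measurable

lemma AE_W: "AE w in \<pi>. P w \<Longrightarrow> AE \<omega> in M. P (W k \<omega>)"
  unfolding W_marginal[of k, symmetric] by (rule AE_distrD[OF W_measurable])

lemma AE_stationary:
  assumes "AE \<omega> in M. P (W k \<omega>)" and "Measurable.pred S P"
  shows "AE w in \<pi>. P w"
proof -
  have "{w\<in>space S. P w} \<in> sets S" using assms(2) by (simp add: pred_def)
  from AE_distr_iff[OF W_measurable[of k] this] show ?thesis
    using assms(1) unfolding W_marginal by blast
qed

lemma L2_fun_W: "L2_fun \<pi> f \<Longrightarrow> L2_fun M (\<lambda>\<omega>. f (W k \<omega>))"
  and L2_norm_W: "L2_fun \<pi> f \<Longrightarrow> L2_norm M (\<lambda>\<omega>. f (W k \<omega>)) = L2_norm \<pi> f"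
  using L2_fun_distr[OF W_measurable[of k], of f] by (simp_all add: W_marginal)

lemma subalgebra_past: "subalgebra M (past M S W k)"
proof -
  have "sigma_sets (space M) {W j -` B \<inter> space M |j B. j \<le> k \<and> B \<in> sets S} \<subseteq> sets M"
    by (rule sets.sigma_sets_subset) (auto intro: measurable_sets)
  then show ?thesis
    by (subst subalgebra_def) (auto simp: past_def sets_measure_of_conv space_measure_of_conv)
qed

lemma past_generators: "{W j -` B \<inter> space M |j B. j \<le> k \<and> B \<in> sets S} \<subseteq> Pow (space M)"
  by auto

lemma sets_past: "sets (past M S W k) = sigma_sets (space M) {W j -` B \<inter> space M |j B. j \<le> k \<and> B \<in> sets S}"
  unfolding past_def by (rule sets_measure_of[OF past_generators])

lemma space_past [simp]: "space (past M S W k) = space M"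
  unfolding past_def by (rule space_measure_of[OF past_generators])

lemma W_measurable_past:
  assumes "j \<le> k" shows "W j \<in> past M S W k \<rightarrow>\<^sub>M S"
proof (rule measurableI)
  fix B assume "B \<in> sets S"
  then show "W j -` B \<inter> space (past M S W k) \<in> sets (past M S W k)"
    unfolding sets_past space_past using assms by (intro sigma_sets.Basic) auto
qed (use measurable_space[OF W_measurable] in auto)

lemma past_mono:
  assumes "j \<le> k" shows "subalgebra (past M S W k) (past M S W j)"
proof -
  have "sets (past M S W j) \<subseteq> sets (past M S W k)"
    unfolding sets_past using assms by (intro sigma_sets_mono') force
  then show ?thesis by (simp add: subalgebra_def)
qed

lemma sigma_finite_past: "sigma_finite_subalgebra M (past M S W k)"
proof -
  interpret finite_measure_subalgebra M "past M S W k"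
    by unfold_locales (rule subalgebra_past)
  show ?thesis by unfold_locales
qed

section \<open>The Markov property for functions, and the transition operator on L2\<close>

text \<open>\<open>W_markov\<close> speaks of indicators. The step to functions is made at once, by
  identifying two measures on the state space: the image under \<open>W (k + 1)\<close> of the
  measure restricted to \<open>A\<close>, and the same restricted measure composed with the kernel
  at \<open>W k\<close>.\<close>

lemma nn_integral_markov:
  assumes A: "A \<in> sets (past M S W k)" and f [measurable]: "f \<in> borel_measurable S"
  shows "(\<integral>\<^sup>+\<omega>. indicator A \<omega> * f (W (k + 1) \<omega>) \<partial>M) = (\<integral>\<^sup>+\<omega>. indicator A \<omega> * (\<integral>\<^sup>+v. f v \<partial>Q (W k \<omega>)) \<partial>M)"
proof -
  interpret F: sigma_finite_subalgebra M "past M S W k" by (rule sigma_finite_past)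
  have AM [measurable]: "A \<in> sets M" using A subalgebra_past[of k] by (auto simp: subalgebra_def)
  define N where "N = density M (indicator A)"
  have N [measurable_cong]: "sets N = sets M" "space N = space M" by (simp_all add: N_def)
  have ne: "space N \<noteq> {}" using not_empty by (simp add: N)
  have K [measurable]: "(\<lambda>\<omega>. Q (W k \<omega>)) \<in> N \<rightarrow>\<^sub>M subprob_algebra S" by measurable
  \<comment> \<open>On a single set \<open>B\<close> the indicator may be replaced by its
    conditional expectation, because \<open>A\<close> belongs to the past.\<close>
  have "distr N S (W (k + 1)) = N \<bind> (\<lambda>\<omega>. Q (W k \<omega>))"
  proof (rule measure_eqI)
    show "sets (distr N S (W (k + 1))) = sets (N \<bind> (\<lambda>\<omega>. Q (W k \<omega>)))"
      using sets_bind_measurable[OF K ne] by simp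
    fix B assume "B \<in> sets (distr N S (W (k + 1)))"
    then have B [measurable]: "B \<in> sets S" by simp
    let ?I = "indicator (W (k + 1) -` B \<inter> space M) :: 'a \<Rightarrow> real"
    have B' [measurable]: "W (k + 1) -` B \<inter> space M \<in> sets M" by measurable
    have iI: "integrable M ?I" by (simp add: emeasure_eq_measure)
    have mQ [measurable]: "(\<lambda>\<omega>. measure (Q (W k \<omega>)) B) \<in> borel_measurable M"
      by (intro measurable_compose[OF W_measurable] measurable_compose[OF kernel_measurable] measurable_measure_subprob_algebra B)
    have le1: "measure (Q (W k \<omega>)) B \<le> 1" if "\<omega> \<in> space M" for \<omega>
      using prob_space.prob_le_1[OF kernel_prob_space] measurable_space[OF W_measurable that] by blast
    have iQ: "integrable M (\<lambda>\<omega>. indicator A \<omega> * measure (Q (W k \<omega>)) B)"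
      by (rule integrable_const_bound[of _ 1]) (auto simp: indicator_def le1)
    have "emeasure (distr N S (W (k + 1))) B = emeasure N (W (k + 1) -` B \<inter> space M)"
      by (simp add: emeasure_distr N)
    also have "\<dots> = (\<integral>\<^sup>+\<omega>. ennreal (indicator A \<omega> * ?I \<omega>) \<partial>M)"
      unfolding N_def by (subst emeasure_density) (auto intro!: nn_integral_cong simp: indicator_def)
    also have "\<dots> = ennreal (\<integral>\<omega>. indicator A \<omega> * ?I \<omega> \<partial>M)"
      using integrable_mult_indicator[OF AM iI] by (intro nn_integral_eq_integral) auto
    also have "(\<integral>\<omega>. indicator A \<omega> * ?I \<omega> \<partial>M) = (\<integral>\<omega>. indicator A \<omega> * real_cond_exp M (past M S W k) ?I \<omega> \<partial>M)"
      using F.real_cond_exp_intA[OF iI A] by (simp add: set_lebesgue_integral_def)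
    also have "\<dots> = (\<integral>\<omega>. indicator A \<omega> * measure (Q (W k \<omega>)) B \<partial>M)"
      using W_markov[OF B, of k] by (intro integral_cong_AE) (auto elim!: eventually_mono)
    also have "ennreal \<dots> = (\<integral>\<^sup>+\<omega>. ennreal (indicator A \<omega> * measure (Q (W k \<omega>)) B) \<partial>M)"
      using iQ by (intro nn_integral_eq_integral[symmetric]) auto
    also have "\<dots> = (\<integral>\<^sup>+\<omega>. indicator A \<omega> * emeasure (Q (W k \<omega>)) B \<partial>M)"
    proof (intro nn_integral_cong)
      fix \<omega> assume "\<omega> \<in> space M"
      then interpret Qw: prob_space "Q (W k \<omega>)"
        by (intro kernel_prob_space measurable_space[OF W_measurable])
      show "ennreal (indicator A \<omega> * measure (Q (W k \<omega>)) B) = indicator A \<omega> * emeasure (Q (W k \<omega>)) B"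
        by (simp add: Qw.emeasure_eq_measure indicator_def)
    qed
    also have "\<dots> = (\<integral>\<^sup>+\<omega>. emeasure (Q (W k \<omega>)) B \<partial>N)"
      unfolding N_def by (subst nn_integral_density) (auto intro!: measurable_emeasure_kernel)
    also have "\<dots> = emeasure (N \<bind> (\<lambda>\<omega>. Q (W k \<omega>))) B"
      by (rule emeasure_bind[OF ne K B, symmetric])
    finally show "emeasure (distr N S (W (k + 1))) B = emeasure (N \<bind> (\<lambda>\<omega>. Q (W k \<omega>))) B" .
  qed
  then have "(\<integral>\<^sup>+v. f v \<partial>distr N S (W (k + 1))) = (\<integral>\<^sup>+v. f v \<partial>(N \<bind> (\<lambda>\<omega>. Q (W k \<omega>))))" by simp
  then have "(\<integral>\<^sup>+\<omega>. f (W (k + 1) \<omega>) \<partial>N) = (\<integral>\<^sup>+\<omega>. \<integral>\<^sup>+v. f v \<partial>Q (W k \<omega>) \<partial>N)"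
    by (simp add: nn_integral_bind[OF f K] nn_integral_distr)
  then show ?thesis
    unfolding N_def by (simp add: nn_integral_density)
qed

text \<open>\<open>transition_op\<close> is a Bochner integral, hence 0 where the function is not
  integrable for the kernel, and it is linear only where integrability holds. Finiteness of the
  kernel integrals of the absolute value follows from the Markov property on the whole
  space.\<close>

lemma AE_kernel_integrable:
  fixes f :: "'w \<Rightarrow> real"
  assumes f: "integrable \<pi> f"
  shows "AE \<omega> in M. integrable (Q (W k \<omega>)) f"
proof -
  have [measurable]: "f \<in> borel_measurable S" using f by (auto simp: measurable_cong_sets[OF sets_stationary refl])
  have "integrable M (\<lambda>\<omega>. f (W (k + 1) \<omega>))"
    using integrable_distr_eq[OF W_measurable, of f "k + 1"] f unfolding W_marginal by simp
  then have "(\<integral>\<^sup>+\<omega>. ennreal (norm (f (W (k + 1) \<omega>))) \<partial>M) < \<infinity>" by (simp add: integrable_iff_bounded)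
  also have "(\<integral>\<^sup>+\<omega>. ennreal (norm (f (W (k + 1) \<omega>))) \<partial>M)
      = (\<integral>\<^sup>+\<omega>. indicator (space M) \<omega> * ennreal (norm (f (W (k + 1) \<omega>))) \<partial>M)"
    by (intro nn_integral_cong) simp
  also have "\<dots> = (\<integral>\<^sup>+\<omega>. indicator (space M) \<omega> * (\<integral>\<^sup>+v. ennreal (norm (f v)) \<partial>Q (W k \<omega>)) \<partial>M)"
    using sets.top[of "past M S W k"] by (intro nn_integral_markov) auto
  also have "\<dots> = (\<integral>\<^sup>+\<omega>. (\<integral>\<^sup>+v. ennreal (norm (f v)) \<partial>Q (W k \<omega>)) \<partial>M)"
    by (intro nn_integral_cong) simp
  finally have fin: "(\<integral>\<^sup>+\<omega>. (\<integral>\<^sup>+v. ennreal (norm (f v)) \<partial>Q (W k \<omega>)) \<partial>M) < \<infinity>" .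
  then have "AE \<omega> in M. (\<integral>\<^sup>+v. ennreal (norm (f v)) \<partial>Q (W k \<omega>)) \<noteq> \<infinity>"
    by (intro nn_integral_PInf_AE) auto
  then show ?thesis using AE_space
  proof eventually_elim
    case (elim \<omega>)
    then have "sets (Q (W k \<omega>)) = sets S" by (intro kernel_sets measurable_space[OF W_measurable])
    then have "f \<in> borel_measurable (Q (W k \<omega>))"
      using \<open>f \<in> borel_measurable S\<close> measurable_cong_sets by blast
    then show ?case using elim by (simp add: integrable_iff_bounded less_top[symmetric])
  qed
qed

lemma integrable_W:
  fixes f :: "'w \<Rightarrow> real"
  assumes f: "integrable \<pi> f"
  shows "integrable M (\<lambda>\<omega>. f (W k \<omega>))"
proof -
  have "f \<in> borel_measurable S" using f by (auto simp: measurable_cong_sets[OF sets_stationary refl])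
  from integrable_distr_eq[OF W_measurable this, of k] show ?thesis
    using f unfolding W_marginal by simp
qed

lemma markov_integral_nonneg:
  assumes f: "integrable \<pi> f" and f0: "\<And>w. 0 \<le> f w" and A: "A \<in> sets (past M S W k)"
  shows "integrable M (\<lambda>\<omega>. transition_op Q f (W k \<omega>))"
    and "(\<integral>\<omega>\<in>A. f (W (k + 1) \<omega>) \<partial>M) = (\<integral>\<omega>\<in>A. transition_op Q f (W k \<omega>) \<partial>M)"
proof -
  have [measurable]: "f \<in> borel_measurable S" using f by (auto simp: measurable_cong_sets[OF sets_stationary refl])
  have Q0: "0 \<le> transition_op Q f w" for w by (simp add: transition_op_def f0)
  have eq: "(\<integral>\<^sup>+\<omega>. ennreal (indicator B \<omega> * transition_op Q f (W k \<omega>)) \<partial>M)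
      = ennreal (\<integral>\<omega>. indicator B \<omega> * f (W (k + 1) \<omega>) \<partial>M)" if B: "B \<in> sets (past M S W k)" for B
  proof -
    have [measurable]: "B \<in> sets M" using B subalgebra_past[of k] by (auto simp: subalgebra_def)
    have "(\<integral>\<^sup>+\<omega>. ennreal (indicator B \<omega> * transition_op Q f (W k \<omega>)) \<partial>M)
        = (\<integral>\<^sup>+\<omega>. indicator B \<omega> * (\<integral>\<^sup>+v. ennreal (f v) \<partial>Q (W k \<omega>)) \<partial>M)"
      using AE_kernel_integrable[OF f, of k]
    proof (intro nn_integral_cong_AE, eventually_elim)
      case (elim \<omega>)
      then show ?case
        by (simp add: transition_op_def nn_integral_eq_integral f0 indicator_def)
    qed
    also have "\<dots> = (\<integral>\<^sup>+\<omega>. indicator B \<omega> * ennreal (f (W (k + 1) \<omega>)) \<partial>M)"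
      by (rule nn_integral_markov[OF B, symmetric]) measurable
    also have "\<dots> = (\<integral>\<^sup>+\<omega>. ennreal (indicator B \<omega> * f (W (k + 1) \<omega>)) \<partial>M)"
      by (intro nn_integral_cong) (simp add: indicator_def)
    also have "\<dots> = ennreal (\<integral>\<omega>. indicator B \<omega> * f (W (k + 1) \<omega>) \<partial>M)"
      using integrable_mult_indicator[OF _ integrable_W[OF f, of "k + 1"], of B] f0
      by (intro nn_integral_eq_integral) auto
    finally show ?thesis .
  qed
  have M: "space M \<in> sets (past M S W k)" using sets.top[of "past M S W k"] by simp
  have "(\<integral>\<^sup>+\<omega>. ennreal (transition_op Q f (W k \<omega>)) \<partial>M)
      = (\<integral>\<^sup>+\<omega>. ennreal (indicator (space M) \<omega> * transition_op Q f (W k \<omega>)) \<partial>M)"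
    by (intro nn_integral_cong) simp
  also have "\<dots> < \<infinity>" unfolding eq[OF M] by simp
  finally show int: "integrable M (\<lambda>\<omega>. transition_op Q f (W k \<omega>))"
    by (intro integrableI_nonneg) (use Q0 in auto)
  have AM: "A \<in> sets M" using A subalgebra_past[of k] by (auto simp: subalgebra_def)
  have "ennreal (\<integral>\<omega>. indicator A \<omega> * transition_op Q f (W k \<omega>) \<partial>M) = ennreal (\<integral>\<omega>. indicator A \<omega> * f (W (k + 1) \<omega>) \<partial>M)"
    using integrable_mult_indicator[OF AM int] Q0
    by (subst eq[OF A, symmetric], intro nn_integral_eq_integral[symmetric]) auto
  then show "(\<integral>\<omega>\<in>A. f (W (k + 1) \<omega>) \<partial>M) = (\<integral>\<omega>\<in>A. transition_op Q f (W k \<omega>) \<partial>M)"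
    using f0 Q0 by (simp add: set_lebesgue_integral_def)
qed

lemma transition_op_diff:
  assumes "integrable \<pi> f" "integrable \<pi> h"
  shows "AE \<omega> in M. transition_op Q (\<lambda>w. f w - h w) (W k \<omega>) = transition_op Q f (W k \<omega>) - transition_op Q h (W k \<omega>)"
  using AE_kernel_integrable[OF assms(1), of k] AE_kernel_integrable[OF assms(2), of k]
  by eventually_elim (simp add: transition_op_def)

lemma markov_cond_exp:
  assumes f: "integrable \<pi> f"
  shows "integrable M (\<lambda>\<omega>. transition_op Q f (W k \<omega>))"
    and "AE \<omega> in M. real_cond_exp M (past M S W k) (\<lambda>\<omega>. f (W (k + 1) \<omega>)) \<omega> = transition_op Q f (W k \<omega>)"
proof -
  interpret F: sigma_finite_subalgebra M "past M S W k" by (rule sigma_finite_past)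
  have [measurable]: "f \<in> borel_measurable S" using f by (auto simp: measurable_cong_sets[OF sets_stationary refl])
  let ?p = "\<lambda>w. max (f w) 0" and ?m = "\<lambda>w. max (- f w) 0"
  have ip: "integrable \<pi> ?p" "integrable \<pi> ?m" using f by auto
  have fpm: "f = (\<lambda>w. ?p w - ?m w)" by auto
  \<comment> \<open>The integrability conclusion of \<open>markov_integral_nonneg\<close> does not
    mention the set; any member of the past instantiates it.\<close>
  have A0: "{} \<in> sets (past M S W k)" by simp
  note pp = markov_integral_nonneg[OF ip(1)] and mm = markov_integral_nonneg[OF ip(2)]
  have d: "AE \<omega> in M. transition_op Q f (W k \<omega>) = transition_op Q ?p (W k \<omega>) - transition_op Q ?m (W k \<omega>)"
    using transition_op_diff[OF ip, of k] by (subst fpm)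
  have id: "integrable M (\<lambda>\<omega>. transition_op Q ?p (W k \<omega>) - transition_op Q ?m (W k \<omega>))"
    by (intro Bochner_Integration.integrable_diff pp(1)[OF _ A0] mm(1)[OF _ A0]) auto
  then show int: "integrable M (\<lambda>\<omega>. transition_op Q f (W k \<omega>))"
    using d by (subst integrable_cong_AE) auto
  show "AE \<omega> in M. real_cond_exp M (past M S W k) (\<lambda>\<omega>. f (W (k + 1) \<omega>)) \<omega> = transition_op Q f (W k \<omega>)"
  proof (rule F.real_cond_exp_charact)
    fix A assume A: "A \<in> sets (past M S W k)"
    then have AM [measurable]: "A \<in> sets M" using subalgebra_past[of k] by (auto simp: subalgebra_def)
    have si: "set_integrable M A h" if "integrable M h" for h :: "'a \<Rightarrow> real"
      unfolding set_integrable_def using integrable_mult_indicator[OF AM that] by simp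
    have "(\<integral>\<omega>\<in>A. f (W (k + 1) \<omega>) \<partial>M) = (\<integral>\<omega>\<in>A. ?p (W (k + 1) \<omega>) - ?m (W (k + 1) \<omega>) \<partial>M)"
      by (intro set_lebesgue_integral_cong AM) auto
    also have "\<dots> = (\<integral>\<omega>\<in>A. ?p (W (k + 1) \<omega>) \<partial>M) - (\<integral>\<omega>\<in>A. ?m (W (k + 1) \<omega>) \<partial>M)"
      by (intro set_integral_diff(2) si integrable_W ip)
    also have "\<dots> = (\<integral>\<omega>\<in>A. transition_op Q ?p (W k \<omega>) \<partial>M) - (\<integral>\<omega>\<in>A. transition_op Q ?m (W k \<omega>) \<partial>M)"
      using pp(2)[OF _ A] mm(2)[OF _ A] by simp
    also have "\<dots> = (\<integral>\<omega>\<in>A. transition_op Q ?p (W k \<omega>) - transition_op Q ?m (W k \<omega>) \<partial>M)"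
      by (intro set_integral_diff(2)[symmetric] si pp(1)[OF _ A] mm(1)[OF _ A]) auto
    also have "\<dots> = (\<integral>\<omega>\<in>A. transition_op Q f (W k \<omega>) \<partial>M)"
      unfolding set_lebesgue_integral_def using d by (intro integral_cong_AE) (auto elim!: eventually_mono)
    finally show "(\<integral>\<omega>\<in>A. f (W (k + 1) \<omega>) \<partial>M) = (\<integral>\<omega>\<in>A. transition_op Q f (W k \<omega>) \<partial>M)" .
  qed (use \<open>f \<in> borel_measurable S\<close> int integrable_W[OF f] measurable_compose[OF W_measurable_past transition_op_measurable, of k k f] in auto)
qed

lemma L2_fun_stationary_integrable: "L2_fun \<pi> f \<Longrightarrow> integrable \<pi> f"
  by (rule finite_measure.L2_fun_integrable[OF prob_space.finite_measure[OF prob_space_stationary]])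

lemma L2_fun_stationary_measurable: "L2_fun \<pi> f \<Longrightarrow> f \<in> borel_measurable S"
  by (auto simp: L2_fun_def measurable_cong_sets[OF sets_stationary refl])

lemma L2_fun_stationary_iff:
  assumes [measurable]: "f \<in> borel_measurable S"
  shows "L2_fun \<pi> f \<longleftrightarrow> L2_fun M (\<lambda>\<omega>. f (W k \<omega>))"
proof -
  have "integrable (distr M S (W k)) (\<lambda>w. (f w)\<^sup>2) \<longleftrightarrow> integrable M (\<lambda>\<omega>. (f (W k \<omega>))\<^sup>2)"
    by (rule integrable_distr_eq) measurable
  then show ?thesis
    by (simp add: L2_fun_def W_marginal measurable_cong_sets[OF sets_stationary refl])
qed

text \<open>Contraction by Jensen's inequality under each kernel measure, in the form of a
  nonnegative variance, followed by integration of the conditional expectation.\<close>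

lemma transition_op_L2:
  assumes f: "L2_fun \<pi> f"
  shows "L2_fun \<pi> (transition_op Q f)" and "L2_norm \<pi> (transition_op Q f) \<le> L2_norm \<pi> f"
proof -
  interpret F: sigma_finite_subalgebra M "past M S W 0" by (rule sigma_finite_past)
  have [measurable]: "f \<in> borel_measurable S" by (rule L2_fun_stationary_measurable[OF f])
  note i1 = L2_fun_stationary_integrable[OF f]
  have i2: "integrable \<pi> (\<lambda>w. (f w)\<^sup>2)" using f by (simp add: L2_fun_def)
  note m2 = markov_cond_exp[OF i2, of 0]
  have le: "AE \<omega> in M. (transition_op Q f (W 0 \<omega>))\<^sup>2 \<le> transition_op Q (\<lambda>w. (f w)\<^sup>2) (W 0 \<omega>)"
    using AE_kernel_integrable[OF i1, of 0] AE_kernel_integrable[OF i2, of 0] AE_space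
  proof eventually_elim
    case (elim \<omega>)
    interpret Qw: prob_space "Q (W 0 \<omega>)"
      by (rule kernel_prob_space[OF measurable_space[OF W_measurable elim(3)]])
    show ?case
      using Qw.variance_eq[OF elim(1,2)] Qw.variance_positive[of f] by (simp add: transition_op_def)
  qed
  have "integrable M (\<lambda>\<omega>. (transition_op Q f (W 0 \<omega>))\<^sup>2)"
    by (rule Bochner_Integration.integrable_bound[OF m2(1)])
      (use le in \<open>auto elim!: eventually_mono\<close>)
  then have L: "L2_fun M (\<lambda>\<omega>. transition_op Q f (W 0 \<omega>))" by (simp add: L2_fun_def)
  then show L': "L2_fun \<pi> (transition_op Q f)" by (subst L2_fun_stationary_iff) auto
  have "(L2_norm \<pi> (transition_op Q f))\<^sup>2 = (\<integral>\<omega>. (transition_op Q f (W 0 \<omega>))\<^sup>2 \<partial>M)"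
    using L2_norm_W[OF L', of 0] L2_norm_power2[of M] by metis
  also have "\<dots> \<le> (\<integral>\<omega>. transition_op Q (\<lambda>w. (f w)\<^sup>2) (W 0 \<omega>) \<partial>M)"
    using L m2(1) le by (intro integral_mono_AE) (auto simp: L2_fun_def)
  also have "\<dots> = (\<integral>\<omega>. real_cond_exp M (past M S W 0) (\<lambda>\<omega>. (f (W (0 + 1) \<omega>))\<^sup>2) \<omega> \<partial>M)"
    using m2(2) by (intro integral_cong_AE) (auto elim!: eventually_mono)
  also have "\<dots> = (\<integral>\<omega>. (f (W (0 + 1) \<omega>))\<^sup>2 \<partial>M)"
    by (rule F.real_cond_exp_int(2)[OF integrable_W[OF i2]])
  also have "\<dots> = (L2_norm \<pi> f)\<^sup>2"
    using L2_norm_W[OF f, of "0 + 1"] L2_norm_power2[of M] by metis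
  finally show "L2_norm \<pi> (transition_op Q f) \<le> L2_norm \<pi> f"
    by (rule power2_le_imp_le) simp
qed

lemma transition_op_iterate_L2:
  assumes f: "L2_fun \<pi> f"
  shows "L2_fun \<pi> ((transition_op Q ^^ n) f)" and "L2_norm \<pi> ((transition_op Q ^^ n) f) \<le> L2_norm \<pi> f"
proof (induction n)
  case (Suc n)
  { case 1 show ?case using transition_op_L2[OF Suc(1)] by simp }
  { case 2 show ?case using order.trans[OF transition_op_L2(2)[OF Suc(1)] Suc(2)] by simp }
qed (use f in auto)

text \<open>Conditioning first on the past up to \<open>n\<close> turns \<open>f\<close> at time
  \<open>n + 1\<close> into its image under the transition operator at time \<open>n\<close>; this
  is why the induction ranges over all \<open>f\<close>.\<close>

lemma past_cond_exp:
  assumes "L2_fun \<pi> f"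
  shows "AE \<omega> in M. real_cond_exp M (past M S W 0) (\<lambda>\<omega>. f (W (int n) \<omega>)) \<omega> = (transition_op Q ^^ n) f (W 0 \<omega>)"
  using assms
proof (induction n arbitrary: f)
  case 0
  interpret F: sigma_finite_subalgebra M "past M S W 0" by (rule sigma_finite_past)
  have "AE \<omega> in M. real_cond_exp M (past M S W 0) (\<lambda>\<omega>. f (W 0 \<omega>)) \<omega> = f (W 0 \<omega>)"
    by (intro F.real_cond_exp_F_meas integrable_W L2_fun_stationary_integrable[OF 0]
        measurable_compose[OF W_measurable_past L2_fun_stationary_measurable[OF 0]]) simp
  then show ?case by simp
next
  case (Suc n)
  interpret F: sigma_finite_subalgebra M "past M S W 0" by (rule sigma_finite_past)
  note i = L2_fun_stationary_integrable[OF Suc(2)]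
  let ?G = "past M S W (int n)"
  have [measurable]: "f \<in> borel_measurable S" by (rule L2_fun_stationary_measurable[OF Suc(2)])
  have "AE \<omega> in M. real_cond_exp M (past M S W 0) (real_cond_exp M ?G (\<lambda>\<omega>. f (W (int n + 1) \<omega>))) \<omega>
      = real_cond_exp M (past M S W 0) (\<lambda>\<omega>. f (W (int n + 1) \<omega>)) \<omega>"
    by (intro F.real_cond_exp_nested_subalg subalgebra_past past_mono integrable_W i) simp
  moreover have "AE \<omega> in M. real_cond_exp M (past M S W 0) (real_cond_exp M ?G (\<lambda>\<omega>. f (W (int n + 1) \<omega>))) \<omega>
      = real_cond_exp M (past M S W 0) (\<lambda>\<omega>. transition_op Q f (W (int n) \<omega>)) \<omega>"
    by (intro F.real_cond_exp_cong markov_cond_exp(2) i) measurable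
  moreover note Suc.IH[OF transition_op_L2(1)[OF Suc(2)]]
  ultimately show ?case
    by eventually_elim (simp add: funpow_swap1 add.commute)
qed

text \<open>Moves the hypothesis of the theorem to the state space, where all resolvent estimates
  take place.\<close>

lemma cond_exp_partial_sum:
  assumes f: "L2_fun \<pi> f"
  shows "L2_norm M (real_cond_exp M (past M S W 0) (partial_sum W f n))
    = L2_norm \<pi> (\<lambda>w. \<Sum>i<n. (transition_op Q ^^ Suc i) f w)"
proof -
  interpret F: sigma_finite_subalgebra M "past M S W 0" by (rule sigma_finite_past)
  have L: "L2_fun \<pi> (\<lambda>w. \<Sum>i<n. (transition_op Q ^^ Suc i) f w)"
    by (intro L2_fun_sum transition_op_iterate_L2 f)
  have "AE \<omega> in M. \<forall>k. real_cond_exp M (past M S W 0) (\<lambda>\<omega>. f (W (int k) \<omega>)) \<omega> = (transition_op Q ^^ k) f (W 0 \<omega>)"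
    unfolding AE_all_countable by (intro allI past_cond_exp f)
  moreover have "AE \<omega> in M. real_cond_exp M (past M S W 0) (\<lambda>\<omega>. \<Sum>k\<in>{1..n}. f (W (int k) \<omega>)) \<omega>
      = (\<Sum>k\<in>{1..n}. real_cond_exp M (past M S W 0) (\<lambda>\<omega>. f (W (int k) \<omega>)) \<omega>)"
    by (intro F.real_cond_exp_sum integrable_W L2_fun_stationary_integrable f)
  ultimately have "AE \<omega> in M. real_cond_exp M (past M S W 0) (partial_sum W f n) \<omega>
      = (\<Sum>i<n. (transition_op Q ^^ Suc i) f (W 0 \<omega>))"
  proof eventually_elim
    case (elim \<omega>)
    have "(\<Sum>k\<in>{1..n}. (transition_op Q ^^ k) f (W 0 \<omega>)) = (\<Sum>i<n. (transition_op Q ^^ Suc i) f (W 0 \<omega>))"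
      by (rule sum.reindex_bij_witness[of _ Suc "\<lambda>k. k - 1"]) auto
    then show ?case using elim by (simp add: partial_sum_def[abs_def])
  qed
  then have "L2_norm M (real_cond_exp M (past M S W 0) (partial_sum W f n))
      = L2_norm M (\<lambda>\<omega>. \<Sum>i<n. (transition_op Q ^^ Suc i) f (W 0 \<omega>))"
    by (rule L2_norm_cong_AE) (use L2_fun_W[OF L, of 0] in \<open>auto simp: L2_fun_def\<close>)
  also have "\<dots> = L2_norm \<pi> (\<lambda>w. \<Sum>i<n. (transition_op Q ^^ Suc i) f w)"
    by (rule L2_norm_W[OF L])
  finally show ?thesis .
qed

section \<open>Martingale differences generated by functions on the state space\<close>

text \<open>For a resolvent this is the approximate increment evaluated along the chain. A general
  \<open>u\<close> is allowed so that differences of two resolvents are covered.\<close>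

definition mart_diff :: "('w \<Rightarrow> real) \<Rightarrow> int \<Rightarrow> 'a \<Rightarrow> real" where
  "mart_diff u k \<omega> = u (W k \<omega>) - transition_op Q u (W (k - 1) \<omega>)"

lemma mart_diff_L2: "L2_fun \<pi> u \<Longrightarrow> L2_fun M (mart_diff u k)"
  unfolding mart_diff_def[abs_def] by (intro L2_fun_diff L2_fun_W transition_op_L2)

lemma mart_diff_orthogonal:
  assumes u: "L2_fun \<pi> u" and Y: "L2_fun M Y" "Y \<in> borel_measurable (past M S W k)"
  shows "(\<integral>\<omega>. Y \<omega> * mart_diff u (k + 1) \<omega> \<partial>M) = 0"
proof -
  interpret F: sigma_finite_subalgebra M "past M S W k" by (rule sigma_finite_past)
  have [measurable]: "u \<in> borel_measurable S" by (rule L2_fun_stationary_measurable[OF u])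
  have [measurable]: "Y \<in> borel_measurable M" using Y by (simp add: L2_fun_def)
  have i: "integrable M (\<lambda>\<omega>. Y \<omega> * u (W (k + 1) \<omega>))" "integrable M (\<lambda>\<omega>. Y \<omega> * transition_op Q u (W k \<omega>))"
    by (intro L2_fun_mult_integrable Y L2_fun_W transition_op_L2 u)+
  have "(\<integral>\<omega>. Y \<omega> * u (W (k + 1) \<omega>) \<partial>M) = (\<integral>\<omega>. Y \<omega> * real_cond_exp M (past M S W k) (\<lambda>\<omega>. u (W (k + 1) \<omega>)) \<omega> \<partial>M)"
    by (rule F.real_cond_exp_intg(2)[OF i(1) Y(2), symmetric]) measurable
  also have "\<dots> = (\<integral>\<omega>. Y \<omega> * transition_op Q u (W k \<omega>) \<partial>M)"
    using markov_cond_exp(2)[OF L2_fun_stationary_integrable[OF u], of k]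
    by (intro integral_cong_AE) (auto elim!: eventually_mono)
  finally show ?thesis
    using i by (simp add: mart_diff_def right_diff_distrib)
qed

text \<open>Pythagoras for \<open>u (W k)\<close>, split into its prediction from time
  \<open>k - 1\<close> and the innovation.\<close>

lemma mart_diff_norm:
  assumes u: "L2_fun \<pi> u"
  shows "(L2_norm M (mart_diff u k))\<^sup>2 = (L2_norm \<pi> u)\<^sup>2 - (L2_norm \<pi> (transition_op Q u))\<^sup>2"
proof -
  have [measurable]: "u \<in> borel_measurable S" by (rule L2_fun_stationary_measurable[OF u])
  note Lu = L2_fun_W[OF u, of k] and LQ = L2_fun_W[OF transition_op_L2(1)[OF u], of "k - 1"]
  let ?Y = "\<lambda>\<omega>. transition_op Q u (W (k - 1) \<omega>)"
  have o: "(\<integral>\<omega>. ?Y \<omega> * mart_diff u (k - 1 + 1) \<omega> \<partial>M) = 0"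
    by (intro mart_diff_orthogonal u LQ measurable_compose[OF W_measurable_past transition_op_measurable]) auto
  have "(L2_norm M (\<lambda>\<omega>. u (W k \<omega>)))\<^sup>2 = (L2_norm M (\<lambda>\<omega>. ?Y \<omega> + mart_diff u k \<omega>))\<^sup>2"
    by (simp add: mart_diff_def)
  also have "\<dots> = (L2_norm M ?Y)\<^sup>2 + (L2_norm M (mart_diff u k))\<^sup>2"
    using o by (simp add: L2_norm_add_power2[OF LQ mart_diff_L2[OF u]])
  finally show ?thesis
    by (simp add: L2_norm_W u transition_op_L2)
qed

text \<open>Orthogonality of each difference to the past gives growth of the norm by
  \<open>sqrt n\<close>, where the triangle inequality would give \<open>n\<close>.\<close>

lemma mart_diff_sum_norm:
  assumes u: "L2_fun \<pi> u"
  shows "(L2_norm M (\<lambda>\<omega>. \<Sum>k=1..n. mart_diff u (int k) \<omega>))\<^sup>2 = real n * (L2_norm M (mart_diff u 1))\<^sup>2"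
proof (induction n)
  case (Suc n)
  let ?Y = "\<lambda>\<omega>. \<Sum>k=1..n. mart_diff u (int k) \<omega>"
  have [measurable]: "u \<in> borel_measurable S" by (rule L2_fun_stationary_measurable[OF u])
  have LY: "L2_fun M ?Y" by (intro L2_fun_sum mart_diff_L2 u)
  have mY: "?Y \<in> borel_measurable (past M S W (int n))"
    unfolding mart_diff_def
    by (intro borel_measurable_sum borel_measurable_diff measurable_compose[OF W_measurable_past]
        transition_op_measurable) auto
  have o: "(\<integral>\<omega>. ?Y \<omega> * mart_diff u (int n + 1) \<omega> \<partial>M) = 0"
    by (rule mart_diff_orthogonal[OF u LY mY])
  have "(L2_norm M (\<lambda>\<omega>. \<Sum>k=1..Suc n. mart_diff u (int k) \<omega>))\<^sup>2
      = (L2_norm M (\<lambda>\<omega>. ?Y \<omega> + mart_diff u (int n + 1) \<omega>))\<^sup>2"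
    by (simp add: add.commute)
  also have "\<dots> = (L2_norm M ?Y)\<^sup>2 + (L2_norm M (mart_diff u (int n + 1)))\<^sup>2"
    unfolding L2_norm_add_power2[OF LY mart_diff_L2[OF u]] o by simp
  also have "\<dots> = real (Suc n) * (L2_norm M (mart_diff u 1))\<^sup>2"
    using Suc by (simp add: mart_diff_norm[OF u] algebra_simps)
  finally show ?case .
qed (simp add: L2_norm_def)

lemma transition_op_lincomb:
  fixes f :: "nat \<Rightarrow> 'w \<Rightarrow> real"
  assumes f: "\<And>i. integrable \<pi> (f i)"
  shows "AE \<omega> in M. transition_op Q (\<lambda>w. \<Sum>i<n. f i w / c i) (W k \<omega>) = (\<Sum>i<n. transition_op Q (f i) (W k \<omega>) / c i)"
proof -
  have "AE \<omega> in M. \<forall>i. integrable (Q (W k \<omega>)) (f i)"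
    unfolding AE_all_countable by (intro allI AE_kernel_integrable f)
  then show ?thesis
    by eventually_elim (simp add: transition_op_def)
qed

text \<open>The \<open>a\<^sub>n\<close> of the overview; the iterates start at exponent 1 because
  the partial sums start at time 1.\<close>

definition drift_norm :: "('w \<Rightarrow> real) \<Rightarrow> nat \<Rightarrow> real" where
  "drift_norm f n = L2_norm \<pi> (\<lambda>w. \<Sum>i<n. (transition_op Q ^^ Suc i) f w)"

lemma drift_norm_nonneg: "0 \<le> drift_norm f n"
  by (simp add: drift_norm_def)

lemma drift_norm_le:
  assumes f: "L2_fun \<pi> f" shows "drift_norm f n \<le> real n * L2_norm \<pi> f"
proof -
  have "drift_norm f n \<le> (\<Sum>i<n. L2_norm \<pi> ((transition_op Q ^^ Suc i) f))"
    unfolding drift_norm_def by (intro L2_norm_sum_le transition_op_iterate_L2 f)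
  also have "\<dots> \<le> (\<Sum>i<n. L2_norm \<pi> f)" by (intro sum_mono transition_op_iterate_L2 f)
  finally show ?thesis by simp
qed

abbreviation "\<Phi> f \<equiv> resolvent_bound (L2_norm \<pi> f) (drift_norm f)"

section \<open>The resolvent: its equation and its norm\<close>

context
  fixes g :: "'w \<Rightarrow> real"
  assumes g: "L2_fun \<pi> g"
begin

context
  fixes \<epsilon> :: real
  assumes \<epsilon>: "0 < \<epsilon>"
begin

lemma resolvent_term_L2: "L2_fun \<pi> (\<lambda>w. (transition_op Q ^^ k) g w / (1 + \<epsilon>) ^ Suc k)"
  using L2_fun_cmult[OF transition_op_iterate_L2(1)[OF g, of k], of "1 / (1 + \<epsilon>) ^ Suc k"] by simp

lemma resolvent_term_summable: "summable (\<lambda>k. L2_norm \<pi> (\<lambda>w. (transition_op Q ^^ k) g w / (1 + \<epsilon>) ^ Suc k))"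
proof (rule summable_comparison_test)
  have "norm (1 / (1 + \<epsilon>)) < 1" using \<epsilon> by simp
  then show "summable (\<lambda>k. L2_norm \<pi> g * (1 / (1 + \<epsilon>)) ^ k)"
    by (intro summable_mult summable_geometric)
  have "norm (L2_norm \<pi> (\<lambda>w. (transition_op Q ^^ k) g w / (1 + \<epsilon>) ^ Suc k)) \<le> L2_norm \<pi> g * (1 / (1 + \<epsilon>)) ^ k" for k
  proof -
    have "L2_norm \<pi> (\<lambda>w. (transition_op Q ^^ k) g w / (1 + \<epsilon>) ^ Suc k) = L2_norm \<pi> ((transition_op Q ^^ k) g) / (1 + \<epsilon>) ^ Suc k"
      using L2_norm_cmult[of \<pi> "1 / (1 + \<epsilon>) ^ Suc k" "(transition_op Q ^^ k) g"] \<epsilon> by simp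
    also have "\<dots> \<le> L2_norm \<pi> g / (1 + \<epsilon>) ^ k"
      using \<epsilon> transition_op_iterate_L2(2)[OF g, of k] by (intro frac_le) (auto simp: mult_ac)
    finally show ?thesis by (simp add: power_one_over)
  qed
  then show "\<exists>N. \<forall>k\<ge>N. norm (L2_norm \<pi> (\<lambda>w. (transition_op Q ^^ k) g w / (1 + \<epsilon>) ^ Suc k)) \<le> L2_norm \<pi> g * (1 / (1 + \<epsilon>)) ^ k"
    by blast
qed

lemma resolvent_L2: "L2_fun \<pi> (resolvent Q g \<epsilon>)"
  unfolding resolvent_def[abs_def]
  by (rule prob_space.L2_series(2)[OF prob_space_stationary resolvent_term_L2 resolvent_term_summable])

lemma resolvent_partial_L2: "L2_fun \<pi> (\<lambda>w. \<Sum>k<n. (transition_op Q ^^ k) g w / (1 + \<epsilon>) ^ Suc k)"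
  by (intro L2_fun_sum resolvent_term_L2)

lemma resolvent_partial_tendsto:
  "(\<lambda>n. L2_norm \<pi> (\<lambda>w. resolvent Q g \<epsilon> w - (\<Sum>k<n. (transition_op Q ^^ k) g w / (1 + \<epsilon>) ^ Suc k))) \<longlonglongrightarrow> 0"
  unfolding resolvent_def
  by (rule prob_space.L2_series_tail[OF prob_space_stationary resolvent_term_L2 resolvent_term_summable])

lemma transition_op_resolvent_partial:
  "AE w in \<pi>. transition_op Q (\<lambda>w. \<Sum>k<n. (transition_op Q ^^ k) g w / (1 + \<epsilon>) ^ Suc k) w
    = (\<Sum>k<n. (transition_op Q ^^ Suc k) g w / (1 + \<epsilon>) ^ Suc k)"
proof (rule AE_stationary)
  have m [measurable]: "(transition_op Q ^^ k) g \<in> borel_measurable S" for k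
    by (intro L2_fun_stationary_measurable transition_op_iterate_L2 g)
  show "AE \<omega> in M. transition_op Q (\<lambda>w. \<Sum>k<n. (transition_op Q ^^ k) g w / (1 + \<epsilon>) ^ Suc k) (W 0 \<omega>)
    = (\<Sum>k<n. (transition_op Q ^^ Suc k) g (W 0 \<omega>) / (1 + \<epsilon>) ^ Suc k)"
    using transition_op_lincomb[where f = "\<lambda>k. (transition_op Q ^^ k) g" and n = n and c = "\<lambda>k. (1 + \<epsilon>) ^ Suc k" and k = 0,
        OF L2_fun_stationary_integrable[OF transition_op_iterate_L2(1)[OF g]]] by simp
  have [measurable]: "(\<lambda>w. (transition_op Q ^^ Suc k) g w) \<in> borel_measurable S" for k
    by (rule m)
  show "Measurable.pred S (\<lambda>w. transition_op Q (\<lambda>w. \<Sum>k<n. (transition_op Q ^^ k) g w / (1 + \<epsilon>) ^ Suc k) w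
    = (\<Sum>k<n. (transition_op Q ^^ Suc k) g w / (1 + \<epsilon>) ^ Suc k))"
    unfolding pred_def
    using m by (intro measurable_equality_set transition_op_measurable borel_measurable_sum borel_measurable_divide) auto
qed

lemma transition_op_diff_norm:
  assumes "L2_fun \<pi> f" "L2_fun \<pi> h"
  shows "L2_norm \<pi> (\<lambda>w. transition_op Q f w - transition_op Q h w) \<le> L2_norm \<pi> (\<lambda>w. f w - h w)"
proof -
  have [measurable]: "f \<in> borel_measurable S" "h \<in> borel_measurable S"
    by (auto intro: L2_fun_stationary_measurable assms)
  have "AE w in \<pi>. transition_op Q f w - transition_op Q h w = transition_op Q (\<lambda>w. f w - h w) w"
    by (rule AE_stationary[where k = 0])
      (use transition_op_diff[OF assms[THEN L2_fun_stationary_integrable], of 0] in \<open>auto elim!: eventually_mono\<close>)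
  then have "L2_norm \<pi> (\<lambda>w. transition_op Q f w - transition_op Q h w) = L2_norm \<pi> (transition_op Q (\<lambda>w. f w - h w))"
    by (rule L2_norm_cong_AE) measurable
  also have "\<dots> \<le> L2_norm \<pi> (\<lambda>w. f w - h w)"
    by (intro transition_op_L2 L2_fun_diff assms)
  finally show ?thesis .
qed

text \<open>The partial sums of the resolvent satisfy the equation up to a term of norm at most
  \<open>L2_norm \<pi> g / (1 + \<epsilon>) ^ n\<close>. Since the transition operator is a
  contraction, the defect of the full series is bounded by quantities tending to 0.\<close>

lemma resolvent_equation: "AE w in \<pi>. (1 + \<epsilon>) * resolvent Q g \<epsilon> w = g w + transition_op Q (resolvent Q g \<epsilon>) w"
proof -
  let ?h = "resolvent Q g \<epsilon>"
  let ?p = "\<lambda>n w. \<Sum>k<n. (transition_op Q ^^ k) g w / (1 + \<epsilon>) ^ Suc k"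
  let ?d = "\<lambda>w. (1 + \<epsilon>) * ?h w - g w - transition_op Q ?h w"
  note L [intro] = resolvent_L2 resolvent_partial_L2 g transition_op_L2(1) L2_fun_diff L2_fun_cmult
    transition_op_iterate_L2(1)
  have Ld: "L2_fun \<pi> ?d" by (intro L)
  have "L2_norm \<pi> ?d \<le> (2 + \<epsilon>) * L2_norm \<pi> (\<lambda>w. ?h w - ?p n w) + L2_norm \<pi> g * (1 / (1 + \<epsilon>)) ^ n" for n
  proof -
    let ?A = "\<lambda>w. (1 + \<epsilon>) * (?h w - ?p n w)" and ?B = "\<lambda>w. transition_op Q ?h w - transition_op Q (?p n) w"
      and ?C = "\<lambda>w. (1 / (1 + \<epsilon>)) ^ n * (transition_op Q ^^ n) g w"
    \<comment> \<open>Multiplied by \<open>1 + \<epsilon>\<close>, term \<open>k + 1\<close> of the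
      first sum cancels term \<open>k\<close> of the second.\<close>
    have tel: "(1 + \<epsilon>) * (\<Sum>k<n. (transition_op Q ^^ k) g w / (1 + \<epsilon>) ^ Suc k) - g w
        - (\<Sum>k<n. (transition_op Q ^^ Suc k) g w / (1 + \<epsilon>) ^ Suc k) = - ((1 / (1 + \<epsilon>)) ^ n * (transition_op Q ^^ n) g w)" for w
    proof (induction n)
      case (Suc n)
      have "(1 + \<epsilon>) * ((transition_op Q ^^ n) g w / (1 + \<epsilon>) ^ Suc n) = (1 / (1 + \<epsilon>)) ^ n * (transition_op Q ^^ n) g w"
        using \<epsilon> by (simp add: power_one_over)
      moreover have "(transition_op Q ^^ Suc n) g w / (1 + \<epsilon>) ^ Suc n = (1 / (1 + \<epsilon>)) ^ Suc n * (transition_op Q ^^ Suc n) g w"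
        by (simp add: power_one_over)
      ultimately show ?case using Suc by (simp only: sum.lessThan_Suc distrib_left)
    qed simp
    have "AE w in \<pi>. ?d w = (?A w - ?B w) - ?C w"
      using transition_op_resolvent_partial[of n]
    proof eventually_elim
      case (elim w)
      show ?case unfolding elim using tel[of w] by (simp only: right_diff_distrib)
    qed
    then have "L2_norm \<pi> ?d = L2_norm \<pi> (\<lambda>w. (?A w - ?B w) - ?C w)"
      by (rule L2_norm_cong_AE) (intro L2_fun_measurable L)+
    also have "\<dots> \<le> (L2_norm \<pi> ?A + L2_norm \<pi> ?B) + L2_norm \<pi> ?C"
      by (intro order.trans[OF L2_norm_diff_le] add_right_mono L2_norm_diff_le L)
    also have "L2_norm \<pi> ?A = (1 + \<epsilon>) * L2_norm \<pi> (\<lambda>w. ?h w - ?p n w)"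
      using \<epsilon> by (subst L2_norm_cmult) simp
    also have "L2_norm \<pi> ?B \<le> L2_norm \<pi> (\<lambda>w. ?h w - ?p n w)"
      by (intro transition_op_diff_norm L)
    also have "L2_norm \<pi> ?C \<le> L2_norm \<pi> g * (1 / (1 + \<epsilon>)) ^ n"
      using \<epsilon> transition_op_iterate_L2(2)[OF g, of n] by (subst L2_norm_cmult) (simp add: mult.commute mult_right_mono)
    finally show ?thesis by (simp add: algebra_simps)
  qed
  moreover have "(\<lambda>n. (2 + \<epsilon>) * L2_norm \<pi> (\<lambda>w. ?h w - ?p n w) + L2_norm \<pi> g * (1 / (1 + \<epsilon>)) ^ n)
      \<longlonglongrightarrow> (2 + \<epsilon>) * 0 + L2_norm \<pi> g * 0"
    using \<epsilon> by (intro tendsto_intros resolvent_partial_tendsto LIMSEQ_power_zero) simp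
  ultimately have "L2_norm \<pi> ?d \<le> 0"
    using LIMSEQ_le_const by fastforce
  from L2_norm_eq_0D[OF Ld this] show ?thesis by eventually_elim simp
qed

text \<open>Bounding the terms of the series separately would only give
  \<open>L2_norm \<pi> g / \<epsilon>\<close> and lose the cancellation measured by the hypothesis.
  Summation by parts rewrites the series through the sums of iterates, whose norms are
  \<open>drift_norm\<close>, with coefficients
  \<open>\<epsilon> / (1 + \<epsilon>) ^ Suc k\<close>.\<close>

lemma transition_op_resolvent_norm_le:
  "L2_norm \<pi> (transition_op Q (resolvent Q g \<epsilon>)) \<le> \<epsilon> * (\<Sum>k. drift_norm g k / (1 + \<epsilon>) ^ Suc k)"
proof -
  let ?h = "resolvent Q g \<epsilon>"
  let ?p = "\<lambda>n w. \<Sum>k<n. (transition_op Q ^^ k) g w / (1 + \<epsilon>) ^ Suc k"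
  let ?u = "\<lambda>n w. \<Sum>i<n. (transition_op Q ^^ Suc i) g w"
  let ?a = "drift_norm g"
  note L = resolvent_L2 resolvent_partial_L2 g transition_op_L2(1) L2_fun_diff L2_fun_cmult L2_fun_sum L2_fun_add
    transition_op_iterate_L2(1)
  note s = summable_linear_resolvent[where a = ?a, OF drift_norm_nonneg drift_norm_le[OF g] \<epsilon>]
  have "L2_norm \<pi> (transition_op Q ?h) \<le> L2_norm \<pi> (\<lambda>w. ?h w - ?p n w)
      + (\<epsilon> * (\<Sum>k. ?a k / (1 + \<epsilon>) ^ Suc k) + (1 + \<epsilon>) * (?a n / (1 + \<epsilon>) ^ Suc n))" for n
  proof -
    let ?F = "\<lambda>w. \<Sum>k<n. \<epsilon> / (1 + \<epsilon>) ^ Suc k * ?u k w" and ?E = "\<lambda>w. (1 + \<epsilon>) / (1 + \<epsilon>) ^ Suc n * ?u n w"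
    \<comment> \<open>The boundary term \<open>?E\<close> is \<open>1 + \<epsilon>\<close> times the
      n-th term of the convergent series before multiplication by \<epsilon>, hence vanishes in the
      limit.\<close>
    have parts: "(\<Sum>k<n. (transition_op Q ^^ Suc k) g w / (1 + \<epsilon>) ^ Suc k) = ?F w + ?E w" for w
    proof (induction n)
      case (Suc n)
      define x where "x = 1 / (1 + \<epsilon>) ^ Suc n"
      have x: "(1 + \<epsilon>) / (1 + \<epsilon>) ^ Suc (Suc n) = x" "\<epsilon> / (1 + \<epsilon>) ^ Suc n = \<epsilon> * x"
        "(1 + \<epsilon>) / (1 + \<epsilon>) ^ Suc n = (1 + \<epsilon>) * x" "(transition_op Q ^^ Suc n) g w / (1 + \<epsilon>) ^ Suc n = (transition_op Q ^^ Suc n) g w * x"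
        using \<epsilon> by (simp_all add: x_def)
      show ?case using Suc unfolding sum.lessThan_Suc x by (simp only: x distrib_left distrib_right) (simp only: algebra_simps)
    qed simp
    have "AE w in \<pi>. transition_op Q ?h w = (transition_op Q ?h w - transition_op Q (?p n) w) + (?F w + ?E w)"
      using transition_op_resolvent_partial[of n]
    proof eventually_elim
      case (elim w)
      show ?case using elim parts[of w] by linarith
    qed
    then have "L2_norm \<pi> (transition_op Q ?h)
        = L2_norm \<pi> (\<lambda>w. (transition_op Q ?h w - transition_op Q (?p n) w) + (?F w + ?E w))"
      by (rule L2_norm_cong_AE) (intro L2_fun_measurable L)+
    also have "\<dots> \<le> L2_norm \<pi> (\<lambda>w. transition_op Q ?h w - transition_op Q (?p n) w) + (L2_norm \<pi> ?F + L2_norm \<pi> ?E)"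
      by (intro order.trans[OF L2_norm_add_le] add_left_mono L2_norm_add_le L)
    also have "L2_norm \<pi> (\<lambda>w. transition_op Q ?h w - transition_op Q (?p n) w) \<le> L2_norm \<pi> (\<lambda>w. ?h w - ?p n w)"
      by (intro transition_op_diff_norm L)
    also have "L2_norm \<pi> ?F \<le> (\<Sum>k<n. L2_norm \<pi> (\<lambda>w. \<epsilon> / (1 + \<epsilon>) ^ Suc k * ?u k w))"
      by (intro L2_norm_sum_le L)
    also have "\<dots> = \<epsilon> * (\<Sum>k<n. ?a k / (1 + \<epsilon>) ^ Suc k)"
    proof -
      have "L2_norm \<pi> (\<lambda>w. \<epsilon> / (1 + \<epsilon>) ^ Suc k * ?u k w) = \<epsilon> * (?a k / (1 + \<epsilon>) ^ Suc k)" for k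
        using \<epsilon> by (subst L2_norm_cmult) (simp add: drift_norm_def)
      then show ?thesis by (simp only: sum_distrib_left)
    qed
    also have "\<dots> \<le> \<epsilon> * (\<Sum>k. ?a k / (1 + \<epsilon>) ^ Suc k)"
      using \<epsilon> by (intro mult_left_mono sum_le_suminf s) (auto simp: drift_norm_nonneg)
    also have "L2_norm \<pi> ?E = (1 + \<epsilon>) * (?a n / (1 + \<epsilon>) ^ Suc n)"
      using \<epsilon> by (subst L2_norm_cmult) (simp add: drift_norm_def)
    finally show ?thesis by simp
  qed
  moreover have "(\<lambda>n. L2_norm \<pi> (\<lambda>w. ?h w - ?p n w)
      + (\<epsilon> * (\<Sum>k. ?a k / (1 + \<epsilon>) ^ Suc k) + (1 + \<epsilon>) * (?a n / (1 + \<epsilon>) ^ Suc n)))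
      \<longlonglongrightarrow> 0 + (\<epsilon> * (\<Sum>k. ?a k / (1 + \<epsilon>) ^ Suc k) + (1 + \<epsilon>) * 0)"
    by (intro tendsto_add tendsto_mult tendsto_const resolvent_partial_tendsto summable_LIMSEQ_zero[OF s])
  ultimately show ?thesis
    using LIMSEQ_le_const by fastforce
qed

lemma resolvent_norm_le: "L2_norm \<pi> (resolvent Q g \<epsilon>) \<le> \<Phi> g \<epsilon>"
  and transition_op_resolvent_norm_le': "L2_norm \<pi> (transition_op Q (resolvent Q g \<epsilon>)) \<le> \<Phi> g \<epsilon>"
proof -
  let ?h = "resolvent Q g \<epsilon>"
  note L = resolvent_L2 g transition_op_L2(1) L2_fun_cmult L2_fun_add
  have "L2_norm \<pi> ?h \<le> (1 + \<epsilon>) * L2_norm \<pi> ?h" using \<epsilon> by (simp add: distrib_right)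
  also have "\<dots> = L2_norm \<pi> (\<lambda>w. (1 + \<epsilon>) * ?h w)" using \<epsilon> by (subst L2_norm_cmult) simp
  also have "\<dots> = L2_norm \<pi> (\<lambda>w. g w + transition_op Q ?h w)"
    by (rule L2_norm_cong_AE[OF resolvent_equation]) (intro L2_fun_measurable L)+
  also have "\<dots> \<le> L2_norm \<pi> g + L2_norm \<pi> (transition_op Q ?h)"
    by (intro L2_norm_add_le L)
  finally show "L2_norm \<pi> ?h \<le> \<Phi> g \<epsilon>"
    using transition_op_resolvent_norm_le by (simp add: resolvent_bound_def)
  show "L2_norm \<pi> (transition_op Q ?h) \<le> \<Phi> g \<epsilon>"
    using transition_op_resolvent_norm_le L2_norm_nonneg[of \<pi> g]
    unfolding resolvent_bound_def by linarith
qed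

end

text \<open>In the difference of the two resolvent equations \<open>g\<close> cancels: the
  transition operator maps \<open>?u\<close> to \<open>?u + ?v\<close>, where \<open>?v\<close> has
  norm at most \<epsilon> times the sum of the bounds. So the squared norms of \<open>?u\<close> and
  of its image differ by at most twice the inner product of \<open>?u\<close> and \<open>?v\<close>,
  which is of order \<epsilon>.\<close>

lemma mart_diff_resolvent_norm_le:
  assumes \<delta>: "0 < \<delta>" "\<delta> \<le> \<epsilon>"
  shows "L2_norm M (mart_diff (\<lambda>w. resolvent Q g \<epsilon> w - resolvent Q g \<delta> w) k) \<le> sqrt (2 * \<epsilon>) * (\<Phi> g \<epsilon> + \<Phi> g \<delta>)"
proof (rule power2_le_imp_le)
  have \<epsilon>: "0 < \<epsilon>" using \<delta> by simp
  let ?h = "resolvent Q g \<epsilon>" and ?k = "resolvent Q g \<delta>"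
  let ?u = "\<lambda>w. ?h w - ?k w" and ?v = "\<lambda>w. \<epsilon> * ?h w - \<delta> * ?k w"
  note L = resolvent_L2[OF \<epsilon>] resolvent_L2[OF \<delta>(1)] transition_op_L2(1) L2_fun_diff L2_fun_cmult L2_fun_add
  have Lu: "L2_fun \<pi> ?u" and Lv: "L2_fun \<pi> ?v" by (intro L)+
  have [measurable]: "?h \<in> borel_measurable S" "?k \<in> borel_measurable S"
    by (auto intro!: L2_fun_stationary_measurable L)
  have "AE w in \<pi>. transition_op Q ?u w = transition_op Q ?h w - transition_op Q ?k w"
    by (rule AE_stationary[where k = 0])
      (use transition_op_diff[OF L(1,2)[THEN L2_fun_stationary_integrable], of 0] in auto)
  then have "AE w in \<pi>. transition_op Q ?u w = ?u w + ?v w"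
    using resolvent_equation[OF \<epsilon>] resolvent_equation[OF \<delta>(1)]
    by eventually_elim (simp add: algebra_simps)
  then have "L2_norm \<pi> (transition_op Q ?u) = L2_norm \<pi> (\<lambda>w. ?u w + ?v w)"
    by (rule L2_norm_cong_AE) (intro L2_fun_measurable L)+
  then have "(L2_norm \<pi> (transition_op Q ?u))\<^sup>2 = (L2_norm \<pi> (\<lambda>w. ?u w + ?v w))\<^sup>2"
    by (simp only:)
  also have "\<dots> = (L2_norm \<pi> ?u)\<^sup>2 + (L2_norm \<pi> ?v)\<^sup>2 + 2 * (\<integral>w. ?u w * ?v w \<partial>\<pi>)"
    by (rule L2_norm_add_power2[OF Lu Lv])
  finally have "(L2_norm M (mart_diff ?u k))\<^sup>2 \<le> 2 * \<bar>\<integral>w. ?u w * ?v w \<partial>\<pi>\<bar>"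
    unfolding mart_diff_norm[OF Lu] using zero_le_power2[of "L2_norm \<pi> ?v"] by linarith
  also have "\<dots> \<le> 2 * (L2_norm \<pi> ?u * L2_norm \<pi> ?v)"
    using L2_Cauchy_Schwarz[OF Lu Lv] by simp
  also have "\<dots> \<le> 2 * ((\<Phi> g \<epsilon> + \<Phi> g \<delta>) * (\<epsilon> * (\<Phi> g \<epsilon> + \<Phi> g \<delta>)))"
  proof (intro mult_left_mono mult_mono)
    note n = resolvent_norm_le[OF \<epsilon>] resolvent_norm_le[OF \<delta>(1)]
    have p: "0 \<le> \<Phi> g \<epsilon>" "0 \<le> \<Phi> g \<delta>" using n L2_norm_nonneg order.trans by blast+
    show "L2_norm \<pi> ?u \<le> \<Phi> g \<epsilon> + \<Phi> g \<delta>"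
      using n by (intro order.trans[OF L2_norm_diff_le] add_mono L)
    have "L2_norm \<pi> ?v \<le> L2_norm \<pi> (\<lambda>w. \<epsilon> * ?h w) + L2_norm \<pi> (\<lambda>w. \<delta> * ?k w)"
      by (intro L2_norm_diff_le L)
    also have "\<dots> = \<epsilon> * L2_norm \<pi> ?h + \<delta> * L2_norm \<pi> ?k"
      using \<epsilon> \<delta> by (simp add: L2_norm_cmult)
    also have "\<dots> \<le> \<epsilon> * \<Phi> g \<epsilon> + \<epsilon> * \<Phi> g \<delta>"
      using \<epsilon> \<delta> n p by (intro add_mono mult_mono) auto
    finally show "L2_norm \<pi> ?v \<le> \<epsilon> * (\<Phi> g \<epsilon> + \<Phi> g \<delta>)" by (simp add: distrib_left)
    show "0 \<le> \<Phi> g \<epsilon> + \<Phi> g \<delta>" using p by simp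
  qed auto
  also have "\<dots> = (sqrt (2 * \<epsilon>) * (\<Phi> g \<epsilon> + \<Phi> g \<delta>))\<^sup>2"
    using \<epsilon> by (simp add: power_mult_distrib) (simp add: power2_eq_square mult_ac)
  finally show "(L2_norm M (mart_diff ?u k))\<^sup>2 \<le> (sqrt (2 * \<epsilon>) * (\<Phi> g \<epsilon> + \<Phi> g \<delta>))\<^sup>2" .
  have "0 \<le> \<Phi> g \<epsilon> + \<Phi> g \<delta>"
    using resolvent_norm_le[OF \<epsilon>] resolvent_norm_le[OF \<delta>(1)] L2_norm_nonneg[of \<pi> ?h] L2_norm_nonneg[of \<pi> ?k] by linarith
  then show "0 \<le> sqrt (2 * \<epsilon>) * (\<Phi> g \<epsilon> + \<Phi> g \<delta>)" using \<epsilon> by simp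
qed

end

section \<open>The joint law of two consecutive states and the limit increment\<close>

abbreviation "J \<equiv> joint_law M S W"

lemma prob_space_joint_law: "prob_space J"
  unfolding joint_law_def by (rule prob_space_distr) measurable

lemma sets_joint_law [measurable_cong]: "sets J = sets (S \<Otimes>\<^sub>M S)"
  by (simp add: joint_law_def)

lemma joint_law_shift: "distr M (S \<Otimes>\<^sub>M S) (\<lambda>\<omega>. (W (int n) \<omega>, W (int n + 1) \<omega>)) = J"
proof (induction n)
  case (Suc n)
  have \<theta> [measurable]: "\<theta> \<in> M \<rightarrow>\<^sub>M M" and d: "distr M M \<theta> = M"
    using ergodic by (auto simp: ergodic_transformation_def)
  have "J = distr (distr M M \<theta>) (S \<Otimes>\<^sub>M S) (\<lambda>\<omega>. (W (int n) \<omega>, W (int n + 1) \<omega>))"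
    using Suc d by simp
  also have "\<dots> = distr M (S \<Otimes>\<^sub>M S) ((\<lambda>\<omega>. (W (int n) \<omega>, W (int n + 1) \<omega>)) \<circ> \<theta>)"
    by (rule distr_distr) measurable
  also have "\<dots> = distr M (S \<Otimes>\<^sub>M S) (\<lambda>\<omega>. (W (int (Suc n)) \<omega>, W (int (Suc n) + 1) \<omega>))"
    by (intro distr_cong) (auto simp: W_shift add.commute)
  finally show ?case by simp
qed (simp add: joint_law_def)

lemma L2_joint_law:
  assumes "L2_fun J F" "1 \<le> n"
  shows "L2_fun M (\<lambda>\<omega>. F (W (int n - 1) \<omega>, W (int n) \<omega>))"
    and "L2_norm M (\<lambda>\<omega>. F (W (int n - 1) \<omega>, W (int n) \<omega>)) = L2_norm J F"
proof -
  obtain m where n: "n = Suc m" using assms(2) by (cases n) auto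
  have e: "int n - 1 = int m" "int n = int m + 1" using n by auto
  have "(\<lambda>\<omega>. (W (int m) \<omega>, W (int m + 1) \<omega>)) \<in> M \<rightarrow>\<^sub>M S \<Otimes>\<^sub>M S" by measurable
  from L2_fun_distr[OF this, of F, unfolded joint_law_shift]
  show "L2_fun M (\<lambda>\<omega>. F (W (int n - 1) \<omega>, W (int n) \<omega>))"
    and "L2_norm M (\<lambda>\<omega>. F (W (int n - 1) \<omega>, W (int n) \<omega>)) = L2_norm J F"
    using assms(1) unfolding e by auto
qed

context
  fixes g :: "'w \<Rightarrow> real"
  assumes g: "L2_fun \<pi> g"
begin

lemma increment_approx_W:
  "increment_approx Q g \<epsilon> (W (k - 1) \<omega>, W k \<omega>) = mart_diff (resolvent Q g \<epsilon>) k \<omega>"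
  by (simp add: increment_approx_def mart_diff_def)

lemma increment_approx_measurable:
  assumes "0 < \<epsilon>" shows "increment_approx Q g \<epsilon> \<in> borel_measurable (S \<Otimes>\<^sub>M S)"
proof -
  have [measurable]: "resolvent Q g \<epsilon> \<in> borel_measurable S"
    by (intro L2_fun_stationary_measurable resolvent_L2 g assms)
  show ?thesis unfolding increment_approx_def by measurable
qed

lemma increment_approx_L2:
  assumes "0 < \<epsilon>" shows "L2_fun J (increment_approx Q g \<epsilon>)"
proof -
  have m: "(\<lambda>x. (increment_approx Q g \<epsilon> x)\<^sup>2) \<in> borel_measurable (S \<Otimes>\<^sub>M S)"
    using increment_approx_measurable[OF assms] by measurable
  have "integrable M (\<lambda>\<omega>. (increment_approx Q g \<epsilon> (W 0 \<omega>, W 1 \<omega>))\<^sup>2)"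
    using mart_diff_L2[OF resolvent_L2[OF g assms], of 1] increment_approx_W[of \<epsilon> 1] by (simp add: L2_fun_def)
  then have "integrable J (\<lambda>x. (increment_approx Q g \<epsilon> x)\<^sup>2)"
    unfolding joint_law_def by (subst integrable_distr_eq[OF _ m]) auto
  then show ?thesis
    using increment_approx_measurable[OF assms] by (simp add: L2_fun_def measurable_cong_sets[OF sets_joint_law refl])
qed

lemma mart_diff_diff:
  assumes "L2_fun \<pi> u" "L2_fun \<pi> v"
  shows "AE \<omega> in M. mart_diff u k \<omega> - mart_diff v k \<omega> = mart_diff (\<lambda>w. u w - v w) k \<omega>"
  using transition_op_diff[OF assms[THEN L2_fun_stationary_integrable], of "k - 1"]
  by eventually_elim (simp add: mart_diff_def)

lemma increment_approx_diff_norm: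
  assumes "0 < \<epsilon>" "0 < \<delta>"
  shows "L2_norm J (\<lambda>p. increment_approx Q g \<epsilon> p - increment_approx Q g \<delta> p)
    = L2_norm M (mart_diff (\<lambda>w. resolvent Q g \<epsilon> w - resolvent Q g \<delta> w) 1)"
proof -
  note r = resolvent_L2[OF g assms(1)] resolvent_L2[OF g assms(2)]
  have "L2_norm J (\<lambda>p. increment_approx Q g \<epsilon> p - increment_approx Q g \<delta> p)
    = L2_norm M (\<lambda>\<omega>. increment_approx Q g \<epsilon> (W (int 1 - 1) \<omega>, W (int 1) \<omega>) - increment_approx Q g \<delta> (W (int 1 - 1) \<omega>, W (int 1) \<omega>))"
    by (intro L2_joint_law(2)[symmetric] L2_fun_diff increment_approx_L2 assms) simp
  also have "\<dots> = L2_norm M (\<lambda>\<omega>. mart_diff (resolvent Q g \<epsilon>) (int 1) \<omega> - mart_diff (resolvent Q g \<delta>) (int 1) \<omega>)"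
    by (simp only: increment_approx_W)
  also have "\<dots> = L2_norm M (mart_diff (\<lambda>w. resolvent Q g \<epsilon> w - resolvent Q g \<delta> w) (int 1))"
    by (rule L2_norm_cong_AE[OF mart_diff_diff[OF r]]) (intro L2_fun_measurable L2_fun_diff mart_diff_L2 r)+
  finally show ?thesis by simp
qed

lemma increment_approx_diff_norm_le:
  assumes "0 < \<delta>" "\<delta> \<le> \<epsilon>"
  shows "L2_norm J (\<lambda>p. increment_approx Q g \<epsilon> p - increment_approx Q g \<delta> p) \<le> sqrt (2 * \<epsilon>) * (\<Phi> g \<epsilon> + \<Phi> g \<delta>)"
  using mart_diff_resolvent_norm_le[OF g assms] increment_approx_diff_norm[of \<epsilon> \<delta>] assms by simp

lemma resolvent_bound_drift_nonneg: "0 < \<epsilon> \<Longrightarrow> 0 \<le> \<Phi> g \<epsilon>"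
  by (rule resolvent_bound_nonneg) (auto intro: drift_norm_nonneg drift_norm_le[OF g])

definition dyadic_bound :: "nat \<Rightarrow> real" where
  "dyadic_bound N = (1 / sqrt 2) ^ N * \<Phi> g ((1/2) ^ N)"

lemma dyadic_bound_nonneg: "0 \<le> dyadic_bound N"
  unfolding dyadic_bound_def by (intro mult_nonneg_nonneg resolvent_bound_drift_nonneg) auto

lemma sqrt_dyadic: "sqrt (2 * (1/2) ^ N) \<le> 3/2 * (1 / sqrt 2) ^ N" "(1 / sqrt 2) ^ N \<le> 3/2 * (1 / sqrt 2) ^ Suc N"
proof -
  have s: "sqrt 2 \<le> 3/2" by (rule real_le_lsqrt) (auto simp: power2_eq_square)
  have "sqrt (2 * (1/2) ^ N) = sqrt 2 * (1 / sqrt 2) ^ N"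
    by (simp add: real_sqrt_mult real_sqrt_power real_sqrt_divide)
  also have "\<dots> \<le> 3/2 * (1 / sqrt 2) ^ N" using s by (intro mult_right_mono) auto
  finally show "sqrt (2 * (1/2) ^ N) \<le> 3/2 * (1 / sqrt 2) ^ N" .
  have "(1 / sqrt 2) ^ N = sqrt 2 * (1 / sqrt 2) ^ Suc N" by simp
  also have "\<dots> \<le> 3/2 * (1 / sqrt 2) ^ Suc N" using s by (intro mult_right_mono) auto
  finally show "(1 / sqrt 2) ^ N \<le> 3/2 * (1 / sqrt 2) ^ Suc N" .
qed

text \<open>The whole dyadic interval is covered, since the defining limit of H runs through all
  \<epsilon> and not only the powers of 1/2.\<close>

lemma increment_approx_dyadic_le:
  assumes "(1/2) ^ Suc N \<le> \<epsilon>" "\<epsilon> \<le> (1/2) ^ N"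
  shows "L2_norm J (\<lambda>p. increment_approx Q g ((1/2) ^ N) p - increment_approx Q g \<epsilon> p)
    \<le> 2 * dyadic_bound N + 5 * dyadic_bound (Suc N)"
proof -
  have \<epsilon>: "0 < \<epsilon>" using assms(1) by (rule less_le_trans[rotated]) simp
  note p = resolvent_bound_drift_nonneg[of "(1/2) ^ N"] resolvent_bound_drift_nonneg[of "(1/2) ^ Suc N"]
  have "\<Phi> g \<epsilon> \<le> 2 * \<Phi> g ((1/2) ^ Suc N)"
    by (rule resolvent_bound_le_double) (use assms in \<open>auto intro: drift_norm_nonneg drift_norm_le[OF g]\<close>)
  then have "L2_norm J (\<lambda>p. increment_approx Q g ((1/2) ^ N) p - increment_approx Q g \<epsilon> p)
      \<le> sqrt (2 * (1/2) ^ N) * (\<Phi> g ((1/2) ^ N) + 2 * \<Phi> g ((1/2) ^ Suc N))"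
    by (intro order.trans[OF increment_approx_diff_norm_le[OF \<epsilon> assms(2)]] mult_left_mono) auto
  also have "\<dots> \<le> (3/2 * (1 / sqrt 2) ^ N) * (\<Phi> g ((1/2) ^ N) + 2 * \<Phi> g ((1/2) ^ Suc N))"
    using p by (intro mult_right_mono sqrt_dyadic) auto
  also have "\<dots> = 3/2 * dyadic_bound N + 3 * ((1 / sqrt 2) ^ N * \<Phi> g ((1/2) ^ Suc N))"
    by (simp add: dyadic_bound_def algebra_simps)
  also have "(1 / sqrt 2) ^ N * \<Phi> g ((1/2) ^ Suc N) \<le> (3/2 * (1 / sqrt 2) ^ Suc N) * \<Phi> g ((1/2) ^ Suc N)"
    using p by (intro mult_right_mono sqrt_dyadic) auto
  also have "\<dots> = 3/2 * dyadic_bound (Suc N)" unfolding dyadic_bound_def by (simp only: mult.assoc)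
  \<comment> \<open>The coefficients obtained are 3/2 and 9/2; they are rounded up to 2 and
    5.\<close>
  finally show ?thesis using dyadic_bound_nonneg[of N] dyadic_bound_nonneg[of "Suc N"] by linarith
qed

context
  assumes summ: "summable dyadic_bound"
begin

text \<open>Gives the choice in \<open>L2_lim\<close> a witness, which makes its defining property
  available. The candidate is a telescoping series over dyadic scales, and every other \<epsilon> is
  compared with the power of 1/2 just above it.\<close>

lemma mart_increment_exists: "\<exists>h. L2_tendsto J (increment_approx Q g) h (at_right 0)"
proof -
  interpret J: prob_space J by (rule prob_space_joint_law)
  let ?H = "\<lambda>N. increment_approx Q g ((1/2) ^ N)"
  let ?D = "\<lambda>N p. ?H (Suc N) p - ?H N p"
  let ?b = "\<lambda>N. 2 * dyadic_bound N + 5 * dyadic_bound (Suc N)"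
  have LH: "L2_fun J (?H N)" for N by (rule increment_approx_L2) simp
  have LD: "L2_fun J (?D N)" for N by (intro L2_fun_diff LH)
  have sb: "summable ?b"
    using summ by (intro summable_add summable_mult) (simp_all add: summable_Suc_iff)
  have "L2_norm J (?D N) \<le> ?b N" for N
    using increment_approx_dyadic_le[of N "(1/2) ^ Suc N"] by (subst L2_norm_commute) simp
  then have sD: "summable (\<lambda>N. L2_norm J (?D N))"
    by (intro summable_comparison_test[OF _ sb]) auto
  define h where "h p = ?H 0 p + (\<Sum>N. ?D N p)" for p
  have Lh: "L2_fun J h"
    unfolding h_def by (intro L2_fun_add LH J.L2_series(2)[OF LD sD])
  define t where "t N = L2_norm J (\<lambda>p. ?H N p - h p)" for N
  have t_eq: "t n = L2_norm J (\<lambda>p. (\<Sum>N. ?D N p) - (\<Sum>N<n. ?D N p))" for n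
  proof -
    have H: "?H 0 p + (\<Sum>N<n. ?D N p) = ?H n p" for p by (induction n) auto
    have "h p - ?H n p = (\<Sum>N. ?D N p) - (\<Sum>N<n. ?D N p)" for p
      unfolding h_def using H[of p] by linarith
    then have "(\<lambda>p. h p - ?H n p) = (\<lambda>p. (\<Sum>N. ?D N p) - (\<Sum>N<n. ?D N p))" by (rule ext)
    then show ?thesis
      unfolding t_def L2_norm_commute[of J "?H n" h] by (simp only:)
  qed
  have "t = (\<lambda>n. L2_norm J (\<lambda>p. (\<Sum>N. ?D N p) - (\<Sum>N<n. ?D N p)))"
    by (rule ext) (rule t_eq)
  then have t: "t \<longlonglongrightarrow> 0"
    using J.L2_series_tail[OF LD sD] by (simp only:)
  have "(\<lambda>N. ?b N + t N) \<longlonglongrightarrow> 0 + 0"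
    by (rule tendsto_add[OF summable_LIMSEQ_zero[OF sb] t])
  then have bt: "(\<lambda>N. ?b N + t N) \<longlonglongrightarrow> 0" by simp
  have "((\<lambda>\<epsilon>. L2_norm J (\<lambda>p. increment_approx Q g \<epsilon> p - h p)) \<longlongrightarrow> 0) (at_right 0)"
  proof (rule tendstoI)
    fix \<eta> :: real assume "0 < \<eta>"
    with bt have "\<forall>\<^sub>F N in sequentially. ?b N + t N < \<eta>" by (rule order_tendstoD)
    then obtain N0 where N0: "\<And>N. N0 \<le> N \<Longrightarrow> ?b N + t N < \<eta>"
      unfolding eventually_sequentially by auto
    have "\<forall>\<^sub>F \<epsilon> in at_right 0. \<epsilon> \<in> {0<..<(1/2) ^ N0 :: real}"
      by (rule eventually_at_right_real) simp
    then show "\<forall>\<^sub>F \<epsilon> in at_right 0. dist (L2_norm J (\<lambda>p. increment_approx Q g \<epsilon> p - h p)) 0 < \<eta>"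
    proof eventually_elim
      case (elim \<epsilon>)
      then have \<epsilon>: "0 < \<epsilon>" "\<epsilon> < (1/2) ^ N0" by auto
      moreover have "(1/2) ^ N0 \<le> (1::real)" by (rule power_le_one) auto
      ultimately obtain N where N: "(1/2) ^ Suc N < \<epsilon>" "\<epsilon> \<le> (1/2) ^ N"
        using dyadic_bracket[of \<epsilon>] by auto
      have "N0 \<le> N"
      proof (rule ccontr)
        assume "\<not> N0 \<le> N"
        then have "(1/2) ^ N0 \<le> ((1/2) ^ Suc N :: real)" by (intro power_decreasing) auto
        then show False using N \<epsilon> by simp
      qed
      have "L2_norm J (\<lambda>p. increment_approx Q g \<epsilon> p - h p)
          \<le> L2_norm J (\<lambda>p. increment_approx Q g \<epsilon> p - ?H N p) + t N"
        unfolding t_def by (intro L2_norm_triangle increment_approx_L2 \<epsilon> LH Lh)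
      also have "L2_norm J (\<lambda>p. increment_approx Q g \<epsilon> p - ?H N p) \<le> ?b N"
        using increment_approx_dyadic_le[of N \<epsilon>] N by (subst L2_norm_commute) simp
      finally show ?case using N0[OF \<open>N0 \<le> N\<close>] by (simp add: dist_real_def)
    qed
  qed
  moreover have "\<forall>\<^sub>F \<epsilon> in at_right 0. L2_fun J (increment_approx Q g \<epsilon>)"
    using eventually_at_right_less[of 0] by eventually_elim (rule increment_approx_L2)
  ultimately have "L2_tendsto J (increment_approx Q g) h (at_right 0)"
    using Lh unfolding L2_tendsto_def by blast
  then show ?thesis by blast
qed

lemma mart_increment_tendsto: "L2_tendsto J (increment_approx Q g) (mart_increment M S W Q g) (at_right 0)"
  unfolding mart_increment_def L2_lim_def by (rule someI_ex[OF mart_increment_exists])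

lemma mart_increment_L2: "L2_fun J (mart_increment M S W Q g)"
  using mart_increment_tendsto by (simp add: L2_tendsto_def)

section \<open>The L2 norm of the remainder\<close>

lemma partial_sum_L2: "L2_fun M (partial_sum W g n)"
  unfolding partial_sum_def[abs_def] by (intro L2_fun_sum L2_fun_W g)

lemma mart_part_L2: "L2_fun M (mart_part M S W Q g n)"
  unfolding mart_part_def[abs_def] by (intro L2_fun_sum L2_joint_law mart_increment_L2) auto

lemma mart_remainder_L2: "L2_fun M (mart_remainder M S W Q g n)"
  unfolding mart_remainder_def[abs_def] by (intro L2_fun_diff partial_sum_L2 mart_part_L2)

text \<open>By the resolvent equation, \<open>g (W k)\<close> minus the martingale difference is
  \<epsilon> times the resolvent at \<open>W k\<close> plus a telescoping term. At \<epsilon> = 1/n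
  the bound is three times \<Phi>.\<close>

lemma partial_sum_approx_norm:
  assumes \<epsilon>: "0 < \<epsilon>"
  shows "L2_norm M (\<lambda>\<omega>. partial_sum W g n \<omega> - (\<Sum>k=1..n. mart_diff (resolvent Q g \<epsilon>) (int k) \<omega>)) \<le> (real n * \<epsilon> + 2) * \<Phi> g \<epsilon>"
proof -
  let ?h = "resolvent Q g \<epsilon>" and ?q = "transition_op Q (resolvent Q g \<epsilon>)"
  have Lh: "L2_fun \<pi> ?h" and Lq: "L2_fun \<pi> ?q"
    using resolvent_L2[OF g \<epsilon>] transition_op_L2(1) by auto
  note L = L2_fun_W[OF Lh] L2_fun_W[OF Lq] L2_fun_add L2_fun_diff L2_fun_sum L2_fun_cmult
    partial_sum_L2 mart_diff_L2[OF Lh]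
  have "AE \<omega> in M. \<forall>k::nat. (1 + \<epsilon>) * ?h (W (int k) \<omega>) = g (W (int k) \<omega>) + ?q (W (int k) \<omega>)"
    unfolding AE_all_countable by (intro allI AE_W resolvent_equation g \<epsilon>)
  then have "AE \<omega> in M. partial_sum W g n \<omega> - (\<Sum>k=1..n. mart_diff ?h (int k) \<omega>)
      = \<epsilon> * (\<Sum>k=1..n. ?h (W (int k) \<omega>)) + (?q (W 0 \<omega>) - ?q (W (int n) \<omega>))"
  proof eventually_elim
    case (elim \<omega>)
    show ?case
    proof (induction n)
      case (Suc n)
      have "(1 + \<epsilon>) * ?h (W (int n + 1) \<omega>) = g (W (int n + 1) \<omega>) + ?q (W (int n + 1) \<omega>)"
        using elim[rule_format, of "Suc n"] by (simp add: add.commute)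
      then show ?case using Suc
        by (simp add: partial_sum_def mart_diff_def algebra_simps)
    qed (simp add: partial_sum_def)
  qed
  then have "L2_norm M (\<lambda>\<omega>. partial_sum W g n \<omega> - (\<Sum>k=1..n. mart_diff ?h (int k) \<omega>))
      = L2_norm M (\<lambda>\<omega>. \<epsilon> * (\<Sum>k=1..n. ?h (W (int k) \<omega>)) + (?q (W 0 \<omega>) - ?q (W (int n) \<omega>)))"
    by (rule L2_norm_cong_AE) (intro L2_fun_measurable L)+
  also have "\<dots> \<le> L2_norm M (\<lambda>\<omega>. \<epsilon> * (\<Sum>k=1..n. ?h (W (int k) \<omega>))) + (L2_norm M (\<lambda>\<omega>. ?q (W 0 \<omega>)) + L2_norm M (\<lambda>\<omega>. ?q (W (int n) \<omega>)))"
    by (intro order.trans[OF L2_norm_add_le] add_left_mono L2_norm_diff_le L)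
  also have "L2_norm M (\<lambda>\<omega>. \<epsilon> * (\<Sum>k=1..n. ?h (W (int k) \<omega>))) = \<epsilon> * L2_norm M (\<lambda>\<omega>. \<Sum>k=1..n. ?h (W (int k) \<omega>))"
    using \<epsilon> by (simp add: L2_norm_cmult)
  also have "\<dots> \<le> \<epsilon> * (\<Sum>k=1..n. L2_norm M (\<lambda>\<omega>. ?h (W (int k) \<omega>)))"
    using \<epsilon> by (intro mult_left_mono L2_norm_sum_le L) auto
  also have "\<dots> \<le> \<epsilon> * (real n * \<Phi> g \<epsilon>)"
    using \<epsilon> resolvent_norm_le[OF g \<epsilon>] by (simp add: L2_norm_W[OF Lh] mult_left_mono)
  finally show ?thesis
    using transition_op_resolvent_norm_le'[OF g \<epsilon>] by (simp add: L2_norm_W[OF Lq] algebra_simps)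
qed

text \<open>The crude factor \<open>n\<close> is acceptable: the estimate is used with
  \<open>n\<close> fixed and \<epsilon> tending to 0.\<close>

lemma mart_part_approx_norm:
  assumes \<epsilon>: "0 < \<epsilon>"
  shows "L2_norm M (\<lambda>\<omega>. (\<Sum>k=1..n. mart_diff (resolvent Q g \<epsilon>) (int k) \<omega>) - mart_part M S W Q g n \<omega>)
    \<le> real n * L2_norm J (\<lambda>p. increment_approx Q g \<epsilon> p - mart_increment M S W Q g p)"
proof -
  let ?F = "\<lambda>p. increment_approx Q g \<epsilon> p - mart_increment M S W Q g p"
  have LF: "L2_fun J ?F" by (intro L2_fun_diff increment_approx_L2 \<epsilon> mart_increment_L2)
  have "L2_norm M (\<lambda>\<omega>. (\<Sum>k=1..n. mart_diff (resolvent Q g \<epsilon>) (int k) \<omega>) - mart_part M S W Q g n \<omega>)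
      = L2_norm M (\<lambda>\<omega>. \<Sum>k=1..n. ?F (W (int k - 1) \<omega>, W (int k) \<omega>))"
    unfolding mart_part_def increment_approx_W[symmetric] by (simp only: sum_subtractf)
  also have "\<dots> \<le> (\<Sum>k=1..n. L2_norm M (\<lambda>\<omega>. ?F (W (int k - 1) \<omega>, W (int k) \<omega>)))"
    by (intro L2_norm_sum_le L2_joint_law(1)[OF LF]) auto
  also have "\<dots> = (\<Sum>k=1..n. L2_norm J ?F)"
    by (intro sum.cong refl L2_joint_law(2)[OF LF]) auto
  finally show ?thesis by simp
qed

text \<open>The differences of two approximations are again martingale differences, of the
  difference of the resolvents, so orthogonality yields \<open>sqrt n\<close>.\<close>

lemma mart_diff_sum_diff_norm:
  assumes "0 < \<epsilon>" "0 < \<delta>"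
  shows "L2_norm M (\<lambda>\<omega>. (\<Sum>k=1..n. mart_diff (resolvent Q g \<epsilon>) (int k) \<omega>) - (\<Sum>k=1..n. mart_diff (resolvent Q g \<delta>) (int k) \<omega>))
    = sqrt (real n) * L2_norm J (\<lambda>p. increment_approx Q g \<epsilon> p - increment_approx Q g \<delta> p)"
proof -
  note r = resolvent_L2[OF g assms(1)] resolvent_L2[OF g assms(2)]
  let ?u = "\<lambda>w. resolvent Q g \<epsilon> w - resolvent Q g \<delta> w"
  have Lu: "L2_fun \<pi> ?u" by (intro L2_fun_diff r)
  have "AE \<omega> in M. \<forall>k::nat. mart_diff (resolvent Q g \<epsilon>) (int k) \<omega> - mart_diff (resolvent Q g \<delta>) (int k) \<omega> = mart_diff ?u (int k) \<omega>"
    unfolding AE_all_countable by (intro allI mart_diff_diff r)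
  then have "AE \<omega> in M. (\<Sum>k=1..n. mart_diff (resolvent Q g \<epsilon>) (int k) \<omega>) - (\<Sum>k=1..n. mart_diff (resolvent Q g \<delta>) (int k) \<omega>)
      = (\<Sum>k=1..n. mart_diff ?u (int k) \<omega>)"
    by eventually_elim (simp only: sum_subtractf[symmetric])
  then have "L2_norm M (\<lambda>\<omega>. (\<Sum>k=1..n. mart_diff (resolvent Q g \<epsilon>) (int k) \<omega>) - (\<Sum>k=1..n. mart_diff (resolvent Q g \<delta>) (int k) \<omega>))
      = L2_norm M (\<lambda>\<omega>. \<Sum>k=1..n. mart_diff ?u (int k) \<omega>)"
    by (rule L2_norm_cong_AE) (intro L2_fun_measurable L2_fun_diff L2_fun_sum mart_diff_L2 r Lu)+
  also have "\<dots> = sqrt (real n) * L2_norm M (mart_diff ?u 1)"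
    by (rule power2_eq_imp_eq, unfold mart_diff_sum_norm[OF Lu]) (simp_all add: power_mult_distrib)
  also have "L2_norm M (mart_diff ?u 1) = L2_norm J (\<lambda>p. increment_approx Q g \<epsilon> p - increment_approx Q g \<delta> p)"
    by (rule increment_approx_diff_norm[OF assms, symmetric])
  finally show ?thesis .
qed

text \<open>The cut-off form matches \<open>weighted_tail_summable\<close>.\<close>

definition dyadic_tail :: "nat \<Rightarrow> real" where
  "dyadic_tail N = (\<Sum>k. if N \<le> k then dyadic_bound k else 0)"

lemma sum_le_dyadic_tail:
  assumes "finite I" "\<And>k. k \<in> I \<Longrightarrow> N \<le> k"
  shows "(\<Sum>k\<in>I. dyadic_bound k) \<le> dyadic_tail N"
proof -
  have "(\<Sum>k\<in>I. dyadic_bound k) = (\<Sum>k\<in>I. if N \<le> k then dyadic_bound k else 0)"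
    using assms by (intro sum.cong) auto
  also have "\<dots> \<le> dyadic_tail N"
    unfolding dyadic_tail_def
    by (intro sum_le_suminf assms summable_comparison_test[OF _ summ]) (auto simp: dyadic_bound_nonneg)
  finally show ?thesis .
qed

lemma increment_approx_dyadic_tail:
  assumes "N \<le> m"
  shows "L2_norm J (\<lambda>p. increment_approx Q g ((1/2) ^ N) p - increment_approx Q g ((1/2) ^ m) p) \<le> 7 * dyadic_tail N"
proof -
  let ?H = "\<lambda>N. increment_approx Q g ((1/2) ^ N)"
  have LH: "L2_fun J (?H N)" for N by (rule increment_approx_L2) simp
  have "L2_norm J (\<lambda>p. ?H N p - ?H m p) \<le> (\<Sum>k\<in>{N..<m}. 2 * dyadic_bound k + 5 * dyadic_bound (Suc k))"
    using assms
  proof (induction m rule: dec_induct)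
    case (step m)
    have "L2_norm J (\<lambda>p. ?H N p - ?H (Suc m) p) \<le> L2_norm J (\<lambda>p. ?H N p - ?H m p) + L2_norm J (\<lambda>p. ?H m p - ?H (Suc m) p)"
      by (intro L2_norm_triangle LH)
    then show ?case
      using step increment_approx_dyadic_le[of m "(1/2) ^ Suc m"] by simp
  qed simp
  also have "\<dots> = 2 * (\<Sum>k\<in>{N..<m}. dyadic_bound k) + 5 * (\<Sum>k\<in>{Suc N..<Suc m}. dyadic_bound k)"
    by (simp only: sum.distrib sum_distrib_left sum.shift_bounds_Suc_ivl)
  also have "\<dots> \<le> 2 * dyadic_tail N + 5 * dyadic_tail N"
    by (intro add_mono mult_left_mono sum_le_dyadic_tail) auto
  finally show ?thesis by simp
qed

lemma mart_remainder_norm_le: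
  "(1 / sqrt 2) ^ N * L2_norm M (mart_remainder M S W Q g (2 ^ N)) \<le> 10 * dyadic_tail N"
proof -
  let ?n = "2 ^ N :: nat" and ?H = "\<lambda>m. increment_approx Q g ((1/2) ^ m)"
  let ?D = "\<lambda>m \<omega>. \<Sum>k=1..2 ^ N. mart_diff (resolvent Q g ((1/2) ^ m)) (int k) \<omega>"
  let ?h = "mart_increment M S W Q g"
  have e: "0 < ((1/2) ^ m :: real)" for m by simp
  have LD: "L2_fun M (?D m)" for m by (intro L2_fun_sum mart_diff_L2 resolvent_L2 g e)
  have s: "sqrt (2 ^ N) * (1 / sqrt 2) ^ N = 1"
    by (simp add: real_sqrt_power power_mult_distrib[symmetric])
  have s': "sqrt (real ?n) = sqrt (2 ^ N)" by simp
  have *: "L2_norm M (mart_remainder M S W Q g ?n) \<le> (3 * \<Phi> g ((1/2) ^ N) + sqrt (2 ^ N) * (7 * dyadic_tail N))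
      + 2 ^ N * L2_norm J (\<lambda>p. ?H m p - ?h p)" if "N \<le> m" for m
  proof -
    have "L2_norm M (mart_remainder M S W Q g ?n)
        \<le> L2_norm M (\<lambda>\<omega>. partial_sum W g ?n \<omega> - ?D N \<omega>) + L2_norm M (\<lambda>\<omega>. ?D N \<omega> - mart_part M S W Q g ?n \<omega>)"
      unfolding mart_remainder_def[abs_def] by (intro L2_norm_triangle partial_sum_L2 LD mart_part_L2)
    also have "L2_norm M (\<lambda>\<omega>. partial_sum W g ?n \<omega> - ?D N \<omega>) \<le> (real ?n * (1/2) ^ N + 2) * \<Phi> g ((1/2) ^ N)"
      by (rule partial_sum_approx_norm[OF e])
    also have "real ?n * (1/2) ^ N = 1" by (simp add: power_mult_distrib[symmetric])
    also have "L2_norm M (\<lambda>\<omega>. ?D N \<omega> - mart_part M S W Q g ?n \<omega>)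
        \<le> L2_norm M (\<lambda>\<omega>. ?D N \<omega> - ?D m \<omega>) + L2_norm M (\<lambda>\<omega>. ?D m \<omega> - mart_part M S W Q g ?n \<omega>)"
      by (intro L2_norm_triangle LD mart_part_L2)
    also have "L2_norm M (\<lambda>\<omega>. ?D N \<omega> - ?D m \<omega>) = sqrt (real ?n) * L2_norm J (\<lambda>p. ?H N p - ?H m p)"
      by (rule mart_diff_sum_diff_norm[OF e e])
    also have "\<dots> \<le> sqrt (real ?n) * (7 * dyadic_tail N)"
      by (intro mult_left_mono increment_approx_dyadic_tail that) simp
    also have "L2_norm M (\<lambda>\<omega>. ?D m \<omega> - mart_part M S W Q g ?n \<omega>) \<le> real ?n * L2_norm J (\<lambda>p. ?H m p - ?h p)"
      by (rule mart_part_approx_norm[OF e])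
    finally show ?thesis unfolding s' by simp
  qed
  have "filterlim (\<lambda>m. (1/2) ^ m :: real) (at_right 0) sequentially"
    unfolding filterlim_at by (auto intro!: LIMSEQ_power_zero)
  moreover have "((\<lambda>\<epsilon>. L2_norm J (\<lambda>p. increment_approx Q g \<epsilon> p - ?h p)) \<longlongrightarrow> 0) (at_right 0)"
    using mart_increment_tendsto by (simp add: L2_tendsto_def)
  ultimately have "(\<lambda>m. L2_norm J (\<lambda>p. ?H m p - ?h p)) \<longlonglongrightarrow> 0"
    by (rule filterlim_compose[rotated])
  then have "(\<lambda>m. (3 * \<Phi> g ((1/2) ^ N) + sqrt (2 ^ N) * (7 * dyadic_tail N)) + 2 ^ N * L2_norm J (\<lambda>p. ?H m p - ?h p))
      \<longlonglongrightarrow> (3 * \<Phi> g ((1/2) ^ N) + sqrt (2 ^ N) * (7 * dyadic_tail N)) + 2 ^ N * 0"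
    by (intro tendsto_intros)
  then have "L2_norm M (mart_remainder M S W Q g ?n) \<le> (3 * \<Phi> g ((1/2) ^ N) + sqrt (2 ^ N) * (7 * dyadic_tail N)) + 2 ^ N * 0"
    by (rule LIMSEQ_le_const) (use * in blast)
  then have "(1 / sqrt 2) ^ N * L2_norm M (mart_remainder M S W Q g ?n)
      \<le> (1 / sqrt 2) ^ N * ((3 * \<Phi> g ((1/2) ^ N) + sqrt (2 ^ N) * (7 * dyadic_tail N)) + 2 ^ N * 0)"
    by (intro mult_left_mono) auto
  also have "\<dots> = 3 * dyadic_bound N + (sqrt (2 ^ N) * (1 / sqrt 2) ^ N) * (7 * dyadic_tail N)"
    unfolding dyadic_bound_def by (simp only: mult_zero_right add_0_right distrib_left mult_ac)
  also have "\<dots> = 3 * dyadic_bound N + 7 * dyadic_tail N" unfolding s by simp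
  also have "dyadic_bound N \<le> dyadic_tail N"
    using sum_le_dyadic_tail[of "{N}" N] by simp
  finally show ?thesis by simp
qed

end

end

text \<open>\<open>mart_increment\<close> is one fixed function of two states, whichever version was
  chosen, and \<open>W_shift\<close> holds at every point; hence the identity is valid on the whole
  space and not just almost everywhere.\<close>

lemma mart_remainder_shift:
  assumes "\<omega> \<in> space M"
  shows "mart_remainder M S W Q g (m + n) \<omega> - mart_remainder M S W Q g m \<omega> = mart_remainder M S W Q g n ((\<theta> ^^ m) \<omega>)"
proof -
  have \<theta>: "\<theta> \<in> M \<rightarrow>\<^sub>M M" using ergodic by (simp add: ergodic_transformation_def)
  have W\<theta>: "W k ((\<theta> ^^ m) \<omega>) = W (k + int m) \<omega>" for k
  proof (induction m arbitrary: k)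
    case (Suc m)
    have "(\<theta> ^^ m) \<omega> \<in> space M"
      by (rule measurable_space[OF measurable_compose_n[OF \<theta>] assms])
    from W_shift[OF this, of k] show ?case using Suc[of "k + 1"] by (simp add: add.assoc)
  qed simp
  show ?thesis
  proof (induction n)
    case (Suc n)
    have "int (Suc n) + int m = int (Suc (m + n))" "int (Suc n) - 1 + int m = int (Suc (m + n)) - 1" by simp_all
    then have "mart_remainder M S W Q g (Suc n) ((\<theta> ^^ m) \<omega>) - mart_remainder M S W Q g n ((\<theta> ^^ m) \<omega>)
        = mart_remainder M S W Q g (m + Suc n) \<omega> - mart_remainder M S W Q g (m + n) \<omega>"
      unfolding mart_remainder_def partial_sum_def mart_part_def add_Suc_right
      by (simp only: sum.cl_ivl_Suc W\<theta>) simp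
    then show ?case using Suc by simp
  qed (simp add: mart_remainder_def partial_sum_def mart_part_def)
qed

end

theorem theorem1:
  fixes M :: "'a measure" and \<theta> :: "'a \<Rightarrow> 'a"
    and S :: "'w measure" and W :: "int \<Rightarrow> 'a \<Rightarrow> 'w"
    and Q :: "'w \<Rightarrow> 'w measure" and \<pi> :: "'w measure"
    and g :: "'w \<Rightarrow> real" and ell :: "real \<Rightarrow> real"
  assumes chain: "ergodic_markov_chain M \<theta> S W Q \<pi>"
    and g_L2: "L2_fun \<pi> g"
    and g_mean: "(\<integral>w. g w \<partial>\<pi>) = 0"
    and ell_pos: "\<And>x. 0 < x \<Longrightarrow> 0 < ell x"
    and ell_mono: "mono_on {0<..} ell"
    and ell_slow: "slowly_varying ell"
    and series: "summable (\<lambda>m. let n = Suc m in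
      real n powr (- 3 / 2) * sqrt (ell (real n)) * ln (real n) *
      L2_norm M (real_cond_exp M (past M S W 0) (partial_sum W g n)))"
  shows "AE \<omega> in M. (\<lambda>n. mart_remainder M S W Q g n \<omega> / sqrt (real n * ell_star ell n)) \<longlonglongrightarrow> 0"
proof -
  interpret ergodic_markov_chain M \<theta> S W Q \<pi> by (rule chain)
  have \<theta>: "\<theta> \<in> M \<rightarrow>\<^sub>M M" "distr M M \<theta> = M"
    using ergodic by (auto simp: ergodic_transformation_def)
  have drift: "L2_norm M (real_cond_exp M (past M S W 0) (partial_sum W g n)) = drift_norm g n" for n
    unfolding drift_norm_def by (rule cond_exp_partial_sum[OF g_L2])
  define L where "L N = sqrt (ell (2 ^ N))" for N :: nat
  have L: "incseq L" "0 < L 0"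
  proof -
    show "incseq L"
      unfolding L_def using mono_onD[OF ell_mono] by (intro incseq_SucI) auto
    show "0 < L 0" using ell_pos[of 1] by (simp add: L_def)
  qed
  have c: "summable (\<lambda>N. real (N + 1) * L N * dyadic_bound g N)"
    using dyadic_resolvent_summable[OF ell_pos ell_mono ell_slow L2_norm_nonneg drift_norm_nonneg drift_norm_le[OF g_L2]
        series[unfolded drift]]
    unfolding L_def dyadic_bound_def[OF g_L2] by (simp add: mult.assoc)
  note s = weighted_tail_summable[OF L dyadic_bound_nonneg[OF g_L2] c]
  note R = mart_remainder_norm_le[OF g_L2 s(1)]
  have summ: "summable (\<lambda>j. sqrt (ell (2 ^ j)) * ((1 / sqrt 2) ^ j * L2_norm M (mart_remainder M S W Q g (2 ^ j))))"
  proof (rule summable_comparison_test)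
    show "summable (\<lambda>j. 10 * (L j * dyadic_tail g j))"
      unfolding dyadic_tail_def[OF g_L2 s(1)] by (intro summable_mult s(2))
    have "norm (sqrt (ell (2 ^ j)) * ((1 / sqrt 2) ^ j * L2_norm M (mart_remainder M S W Q g (2 ^ j)))) \<le> 10 * (L j * dyadic_tail g j)" for j
      using mult_left_mono[OF R[of j], of "L j"] ell_pos[of "2 ^ j"] by (simp add: L_def abs_mult)
    then show "\<exists>N. \<forall>j\<ge>N. norm (sqrt (ell (2 ^ j)) * ((1 / sqrt 2) ^ j * L2_norm M (mart_remainder M S W Q g (2 ^ j)))) \<le> 10 * (L j * dyadic_tail g j)"
      by blast
  qed
  show ?thesis
  proof (rule stationary_increments_AE_tendsto_0[OF \<theta> _ mart_remainder_shift mart_remainder_L2[OF g_L2 s(1)] _ summ])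
    \<comment> \<open>The lower bound for \<open>ell_star\<close> is its term at
      \<open>j = 1\<close>.\<close>
    show "0 < 1 / ell 1" using ell_pos[of 1] by simp
  qed (use ell_pos ell_star_lower[OF ell_pos] sum_dyadic_le_ell_star[OF ell_pos ell_mono]
      in \<open>auto simp: mart_remainder_def partial_sum_def mart_part_def\<close>)
qed

end
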